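(* Let $\nu>0$, $T>0$, let $N\ge 2$ be an integer, and set $\Delta t=T/N$, $t^n=n\Delta t$. Let $\{(\tilde{\mathbf u}^{n+1},\mathbf u^{n+1},p^{n+1},q^{n+1})\}_{0\le n\le N-1}$ be a solution of the second-order rotational SAV pressure-correction scheme without external force ($\mathbf f=0$): for each $1\le n\le N-1$, with $\bar{\mathbf u}^n=2\mathbf u^n-\mathbf u^{n-1}$, $$\frac{3\tilde{\mathbf u}^{n+1}-4\mathbf u^{n}+\mathbf u^{n-1}}{2\Delta t}+\frac{q^{n+1}}{\exp(-t^{n+1}/T)}\,\bar{\mathbf u}^{n}\cdot\nabla\bar{\mathbf u}^{n}-\nu\Delta\tilde{\mathbf u}^{n+1}+\nabla p^{n}=0\ \text{ in }\Omega,\qquad \tilde{\mathbf u}^{n+1}|_{\partial\Omega}=0,$$ $$\frac{3\mathbf u^{n+1}-3\tilde{\mathbf u}^{n+1}}{2\Delta t}+\nabla\big(p^{n+1}-p^n+\nu\nabla\cdot\tilde{\mathbf u}^{n+1}\big)=0\ \text{ in }\Omega,$$ $$\nabla\cdot\mathbf u^{n+1}=0\ \text{ in }\Omega,\qquad \mathbf u^{n+1}\cdot\mathbf n|_{\partial\Omega}=0,$$ $$\frac{3q^{n+1}-4q^n+q^{n-1}}{2\Delta t}=-\frac1T q^{n+1}+\frac{1}{\exp(-t^{n+1}/T)}\big(\bar{\mathbf u}^n\cdot\nabla\bar{\mathbf u}^n,\tilde{\mathbf u}^{n+1}\big),$$ where the first step $(\tilde{\mathbf u}^{1},\mathbf u^{1},p^{1},q^{1})$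 is computed from the initial data $(\mathbf u^0,p^0,q^0)$ by the first-order scheme given in the context. Define $\{g^n\}$ recursively by $$g^0=0,\qquad g^{n+1}=\nu\nabla\cdot\tilde{\mathbf u}^{n+1}+g^n,\quad n\ge 0,$$ and, for $n\ge 0$, $$E^{n+1}=\|\mathbf u^{n+1}\|^2+\|2\mathbf u^{n+1}-\mathbf u^{n}\|^2+\tfrac43(\Delta t)^2\|\nabla(p^{n+1}+g^{n+1})\|^2+2\nu^{-1}\Delta t\|g^{n+1}\|^2+|q^{n+1}|^2+|2q^{n+1}-q^n|^2 .$$ Then the scheme is unconditionally energy stable, in the sense that, with no restriction on $\Delta t$, $$E^{n+1}-E^{n}\le -2\nu\Delta t\,\|\nabla\tilde{\mathbf u}^{n+1}\|^2\qquad\text{for all } 1\le n\le N-1 .$$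
   Context: $\Omega\subset\mathbb R^2$ is an open bounded domain with sufficiently smooth boundary $\partial\Omega$ and unit outward normal $\mathbf n$. $(\cdot,\cdot)$ and $\|\cdot\|$ denote the inner product and norm of $L^2(\Omega)$ (for scalar-, vector- or matrix-valued functions). $\mathbf u\cdot\nabla\mathbf v=(\mathbf u\cdot\nabla)\mathbf v$. The unknowns are vector fields $\tilde{\mathbf u}^{n+1},\mathbf u^{n+1}:\Omega\to\mathbb R^2$, a scalar function $p^{n+1}:\Omega\to\mathbb R$ and a real number $q^{n+1}$. There is no spatial discretization. First-order scheme used for the first step (with $\mathbf f=0$ and $n=0$): $$\frac{\tilde{\mathbf u}^{1}-\mathbf u^{0}}{\Delta t}+\frac{q^{1}}{\exp(-t^{1}/T)}\mathbf u^{0}\cdot\nabla\mathbf u^{0}-\nu\Delta\tilde{\mathbf u}^{1}+\nabla p^{0}=0,\quad \tilde{\mathbf u}^{1}|_{\partial\Omega}=0;\qquad \frac{\mathbf u^{1}-\tilde{\mathbf u}^{1}}{\Delta t}+\nabla(p^{1}-p^0)=0;$$ $$\nabla\cdot\mathbf u^{1}=0,\quad \mathbf u^{1}\cdot\mathbf n|_{\partial\Omega}=0;\qquad \frac{q^{1}-q^0}{\Delta t}=-\frac1T q^{1}+\frac{1}{\exp(-t^{1}/T)}(\mathbf u^0\cdot\nabla\mathbf u^0,\tilde{\mathbf u}^{1}).$$ The equations are understood for functions regular enough to make sense of them almost everywhere: $\tilde{\mathbf u}^{n}\in \mathbf H^2(\Omega)\cap\mathbf H^1_0(\Omega)$, $\mathbf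 u^n\in\mathbf H^2(\Omega)$, $p^n\in H^1(\Omega)$; the initial data satisfy $\mathbf u^0\in\mathbf H^2(\Omega)\cap\mathbf H^1_0(\Omega)$, $\nabla\cdot\mathbf u^0=0$, $p^0\in H^1(\Omega)$, $q^0\in\mathbb R$. *)

theory Defs
  imports "HOL-Analysis.Analysis"
begin

section \<open>Differentiability classes and domains with smooth boundary\<close>

definition partial_deriv :: "2 \<Rightarrow> (real^2 \<Rightarrow> real) \<Rightarrow> real^2 \<Rightarrow> real" where
  "partial_deriv i f x = frechet_derivative f (at x) (axis i 1)"

definition gradient :: "(real^2 \<Rightarrow> real) \<Rightarrow> real^2 \<Rightarrow> real^2" where
  "gradient f x = (\<chi> i. partial_deriv i f x)"

text \<open>Intended for open sets \<open>S\<close> only.\<close>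

primrec Ck_on :: "nat \<Rightarrow> (real^2) set \<Rightarrow> (real^2 \<Rightarrow> real) \<Rightarrow> bool" where
  "Ck_on 0 S f \<longleftrightarrow> continuous_on S f"
| "Ck_on (Suc k) S f \<longleftrightarrow>
     (\<forall>x\<in>S. f differentiable (at x)) \<and> (\<forall>i. Ck_on k S (partial_deriv i f))"

definition local_defining_function ::
  "nat \<Rightarrow> (real^2) set \<Rightarrow> real^2 \<Rightarrow> (real^2) set \<Rightarrow> (real^2 \<Rightarrow> real) \<Rightarrow> bool" where
  "local_defining_function k \<Omega> x U \<rho> \<longleftrightarrow>
     open U \<and> x \<in> U \<and> Ck_on k U \<rho> \<and> (\<forall>y\<in>U. gradient \<rho> y \<noteq> 0) \<and>
     \<Omega> \<inter> U = {y\<in>U. \<rho> y < 0}"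

definition Ck_boundary :: "nat \<Rightarrow> (real^2) set \<Rightarrow> bool" where
  "Ck_boundary k \<Omega> \<longleftrightarrow> (\<forall>x\<in>frontier \<Omega>. \<exists>U \<rho>. local_defining_function k \<Omega> x U \<rho>)"

text \<open>The normalized gradient at a boundary point is the same for all local defining functions,
  so the description is unique whenever the boundary is \<open>C\<^sup>1\<close>; it points outwards
  because \<open>\<rho>\<close> is negative exactly on the inside.\<close>

definition outward_normal :: "(real^2) set \<Rightarrow> real^2 \<Rightarrow> real^2" where
  "outward_normal \<Omega> x =
     (THE \<eta>. \<exists>U \<rho>. local_defining_function 1 \<Omega> x U \<rho> \<and>
        \<eta> = gradient \<rho> x /\<^sub>R norm (gradient \<rho> x))"


section \<open>The space $L^2$ and weak derivatives\<close>

text \<open>Elements of Lebesgue and Sobolev spaces are represented by functions defined everywhere;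
  functions that agree almost everywhere on \<open>\<Omega>\<close> represent the same element. The value
  type \<open>'a\<close> covers scalars, vectors and (with the Frobenius product) matrices.\<close>

definition L2 :: "(real^2) set \<Rightarrow> (real^2 \<Rightarrow> 'a::euclidean_space) set" where
  "L2 \<Omega> = {f. f \<in> borel_measurable (lebesgue_on \<Omega>) \<and>
              integrable (lebesgue_on \<Omega>) (\<lambda>x. (norm (f x))\<^sup>2)}"

definition L2_inner ::
  "(real^2) set \<Rightarrow> (real^2 \<Rightarrow> 'a::euclidean_space) \<Rightarrow> (real^2 \<Rightarrow> 'a) \<Rightarrow> real" where
  "L2_inner \<Omega> f g = integral\<^sup>L (lebesgue_on \<Omega>) (\<lambda>x. f x \<bullet> g x)"

definition L2_norm :: "(real^2) set \<Rightarrow> (real^2 \<Rightarrow> 'a::euclidean_space) \<Rightarrow> real" where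
  "L2_norm \<Omega> f = sqrt (L2_inner \<Omega> f f)"

definition test_function :: "(real^2) set \<Rightarrow> (real^2 \<Rightarrow> real) \<Rightarrow> bool" where
  "test_function \<Omega> \<phi> \<longleftrightarrow>
     (\<forall>k. Ck_on k UNIV \<phi>) \<and> compact (closure {x. \<phi> x \<noteq> 0}) \<and> closure {x. \<phi> x \<noteq> 0} \<subseteq> \<Omega>"

definition locally_integrable :: "(real^2) set \<Rightarrow> (real^2 \<Rightarrow> real) \<Rightarrow> bool" where
  "locally_integrable \<Omega> f \<longleftrightarrow> (\<forall>K. compact K \<and> K \<subseteq> \<Omega> \<longrightarrow> f absolutely_integrable_on K)"

definition has_weak_partial ::
  "(real^2) set \<Rightarrow> 2 \<Rightarrow> (real^2 \<Rightarrow> real) \<Rightarrow> (real^2 \<Rightarrow> real) \<Rightarrow> bool" where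
  "has_weak_partial \<Omega> i f g \<longleftrightarrow>
     locally_integrable \<Omega> f \<and> locally_integrable \<Omega> g \<and>
     (\<forall>\<phi>. test_function \<Omega> \<phi> \<longrightarrow>
        L2_inner \<Omega> f (partial_deriv i \<phi>) = - L2_inner \<Omega> g \<phi>)"

text \<open>A representative of the weak derivative; it is determined up to equality almost everywhere
  on \<open>\<Omega>\<close>, and carries no information if no weak derivative exists.\<close>

definition weak_partial :: "(real^2) set \<Rightarrow> 2 \<Rightarrow> (real^2 \<Rightarrow> real) \<Rightarrow> real^2 \<Rightarrow> real" where
  "weak_partial \<Omega> i f = (SOME g. has_weak_partial \<Omega> i f g)"

definition weak_grad :: "(real^2) set \<Rightarrow> (real^2 \<Rightarrow> real) \<Rightarrow> real^2 \<Rightarrow> real^2" where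
  "weak_grad \<Omega> f x = (\<chi> i. weak_partial \<Omega> i f x)"

definition weak_jacobian :: "(real^2) set \<Rightarrow> (real^2 \<Rightarrow> real^2) \<Rightarrow> real^2 \<Rightarrow> real^2^2" where
  "weak_jacobian \<Omega> v x = (\<chi> i j. weak_partial \<Omega> j (\<lambda>y. v y $ i) x)"

definition weak_div :: "(real^2) set \<Rightarrow> (real^2 \<Rightarrow> real^2) \<Rightarrow> real^2 \<Rightarrow> real" where
  "weak_div \<Omega> v x = (\<Sum>i\<in>UNIV. weak_partial \<Omega> i (\<lambda>y. v y $ i) x)"

definition weak_laplacian :: "(real^2) set \<Rightarrow> (real^2 \<Rightarrow> real^2) \<Rightarrow> real^2 \<Rightarrow> real^2" where
  "weak_laplacian \<Omega> v x =
     (\<chi> i. \<Sum>j\<in>UNIV. weak_partial \<Omega> j (weak_partial \<Omega> j (\<lambda>y. v y $ i)) x)"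

text \<open>The field $(v\cdot\nabla)w$.\<close>

definition convection ::
  "(real^2) set \<Rightarrow> (real^2 \<Rightarrow> real^2) \<Rightarrow> (real^2 \<Rightarrow> real^2) \<Rightarrow> real^2 \<Rightarrow> real^2" where
  "convection \<Omega> v w x = (\<chi> i. \<Sum>j\<in>UNIV. v x $ j * weak_partial \<Omega> j (\<lambda>y. w y $ i) x)"


section \<open>Sobolev spaces\<close>

text \<open>\<open>sobolev \<Omega> k\<close> is $H^k(\Omega)$.\<close>

primrec sobolev :: "(real^2) set \<Rightarrow> nat \<Rightarrow> (real^2 \<Rightarrow> real) set" where
  "sobolev \<Omega> 0 = L2 \<Omega>"
| "sobolev \<Omega> (Suc k) = {f \<in> L2 \<Omega>. \<forall>i. \<exists>g\<in>sobolev \<Omega> k. has_weak_partial \<Omega> i f g}"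

definition H1_norm :: "(real^2) set \<Rightarrow> (real^2 \<Rightarrow> real) \<Rightarrow> real" where
  "H1_norm \<Omega> f = sqrt ((L2_norm \<Omega> f)\<^sup>2 + (L2_norm \<Omega> (weak_grad \<Omega> f))\<^sup>2)"

text \<open>$H^1_0(\Omega)$, the closure of the test functions in $H^1(\Omega)$.\<close>

definition H10 :: "(real^2) set \<Rightarrow> (real^2 \<Rightarrow> real) set" where
  "H10 \<Omega> = {f \<in> sobolev \<Omega> 1. \<exists>\<phi> :: nat \<Rightarrow> real^2 \<Rightarrow> real.
     (\<forall>k. test_function \<Omega> (\<phi> k)) \<and> (\<lambda>k. H1_norm \<Omega> (\<lambda>x. f x - \<phi> k x)) \<longlonglongrightarrow> 0}"

definition vec_sobolev :: "(real^2) set \<Rightarrow> nat \<Rightarrow> (real^2 \<Rightarrow> real^2) set" where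
  "vec_sobolev \<Omega> k = {v. \<forall>i. (\<lambda>x. v x $ i) \<in> sobolev \<Omega> k}"

definition vec_H10 :: "(real^2) set \<Rightarrow> (real^2 \<Rightarrow> real^2) set" where
  "vec_H10 \<Omega> = {v. \<forall>i. (\<lambda>x. v x $ i) \<in> H10 \<Omega>}"

text \<open>The condition $v\cdot n|_{\partial\Omega}=0$ for $v\in H^2(\Omega)^2$. In two dimensions
  such a \<open>v\<close> has exactly one representative on the closure of \<open>\<Omega>\<close> that is continuous there,
  and the trace of \<open>v\<close> is the restriction of this representative to the boundary.\<close>

definition zero_normal_trace :: "(real^2) set \<Rightarrow> (real^2 \<Rightarrow> real^2) \<Rightarrow> bool" where
  "zero_normal_trace \<Omega> v \<longleftrightarrow>
     (\<exists>w. continuous_on (closure \<Omega>) w \<and> (AE x in lebesgue_on \<Omega>. w x = v x) \<and>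
          (\<forall>x\<in>frontier \<Omega>. w x \<bullet> outward_normal \<Omega> x = 0))"


section \<open>The scheme\<close>

text \<open>\<open>ut n\<close>, \<open>u n\<close>, \<open>p n\<close>, \<open>q n\<close> are the intermediate velocity, velocity,
  pressure and scalar auxiliary variable at time \<open>real n * dt\<close>. The Dirichlet condition on
  \<open>ut\<close> is expressed by membership in $H^1_0$.\<close>

definition first_order_step ::
  "(real^2) set \<Rightarrow> real \<Rightarrow> real \<Rightarrow> real \<Rightarrow> (nat \<Rightarrow> real^2 \<Rightarrow> real^2) \<Rightarrow> (nat \<Rightarrow> real^2 \<Rightarrow> real^2) \<Rightarrow>
   (nat \<Rightarrow> real^2 \<Rightarrow> real) \<Rightarrow> (nat \<Rightarrow> real) \<Rightarrow> bool" where
  "first_order_step \<Omega> \<nu> T dt ut u p q \<longleftrightarrow>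
     (AE x in lebesgue_on \<Omega>.
        (ut 1 x - u 0 x) /\<^sub>R dt
        + (q 1 / exp (- dt / T)) *\<^sub>R convection \<Omega> (u 0) (u 0) x
        - \<nu> *\<^sub>R weak_laplacian \<Omega> (ut 1) x + weak_grad \<Omega> (p 0) x = 0) \<and>
     ut 1 \<in> vec_H10 \<Omega> \<and>
     (AE x in lebesgue_on \<Omega>.
        (u 1 x - ut 1 x) /\<^sub>R dt + weak_grad \<Omega> (\<lambda>y. p 1 y - p 0 y) x = 0) \<and>
     (AE x in lebesgue_on \<Omega>. weak_div \<Omega> (u 1) x = 0) \<and>
     zero_normal_trace \<Omega> (u 1) \<and>
     (q 1 - q 0) / dt =
       - (1 / T) * q 1
       + 1 / exp (- dt / T) * L2_inner \<Omega> (convection \<Omega> (u 0) (u 0)) (ut 1)"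

definition extrapolation :: "(nat \<Rightarrow> real^2 \<Rightarrow> real^2) \<Rightarrow> nat \<Rightarrow> real^2 \<Rightarrow> real^2" where
  "extrapolation u n x = 2 *\<^sub>R u n x - u (n - 1) x"

text \<open>The step from level \<open>n \<ge> 1\<close> to level \<open>n + 1\<close>.\<close>

definition rotational_step ::
  "(real^2) set \<Rightarrow> real \<Rightarrow> real \<Rightarrow> real \<Rightarrow> (nat \<Rightarrow> real^2 \<Rightarrow> real^2) \<Rightarrow> (nat \<Rightarrow> real^2 \<Rightarrow> real^2) \<Rightarrow>
   (nat \<Rightarrow> real^2 \<Rightarrow> real) \<Rightarrow> (nat \<Rightarrow> real) \<Rightarrow> nat \<Rightarrow> bool" where
  "rotational_step \<Omega> \<nu> T dt ut u p q n \<longleftrightarrow>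
     (AE x in lebesgue_on \<Omega>.
        (3 *\<^sub>R ut (n+1) x - 4 *\<^sub>R u n x + u (n-1) x) /\<^sub>R (2 * dt)
        + (q (n+1) / exp (- (real (n+1) * dt) / T))
            *\<^sub>R convection \<Omega> (extrapolation u n) (extrapolation u n) x
        - \<nu> *\<^sub>R weak_laplacian \<Omega> (ut (n+1)) x + weak_grad \<Omega> (p n) x = 0) \<and>
     ut (n+1) \<in> vec_H10 \<Omega> \<and>
     (AE x in lebesgue_on \<Omega>.
        (3 *\<^sub>R u (n+1) x - 3 *\<^sub>R ut (n+1) x) /\<^sub>R (2 * dt)
        + weak_grad \<Omega> (\<lambda>y. p (n+1) y - p n y + \<nu> * weak_div \<Omega> (ut (n+1)) y) x = 0) \<and>
     (AE x in lebesgue_on \<Omega>. weak_div \<Omega> (u (n+1)) x = 0) \<and>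
     zero_normal_trace \<Omega> (u (n+1)) \<and>
     (3 * q (n+1) - 4 * q n + q (n-1)) / (2 * dt) =
       - (1 / T) * q (n+1)
       + 1 / exp (- (real (n+1) * dt) / T)
         * L2_inner \<Omega> (convection \<Omega> (extrapolation u n) (extrapolation u n)) (ut (n+1))"

primrec div_sum ::
  "(real^2) set \<Rightarrow> real \<Rightarrow> (nat \<Rightarrow> real^2 \<Rightarrow> real^2) \<Rightarrow> nat \<Rightarrow> real^2 \<Rightarrow> real" where
  "div_sum \<Omega> \<nu> ut 0 = (\<lambda>x. 0)"
| "div_sum \<Omega> \<nu> ut (Suc n) = (\<lambda>x. \<nu> * weak_div \<Omega> (ut (Suc n)) x + div_sum \<Omega> \<nu> ut n x)"

text \<open>The energy at level \<open>n \<ge> 1\<close>; it involves the level \<open>n - 1\<close> as well.\<close>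

definition sav_energy ::
  "(real^2) set \<Rightarrow> real \<Rightarrow> real \<Rightarrow> (nat \<Rightarrow> real^2 \<Rightarrow> real^2) \<Rightarrow> (nat \<Rightarrow> real^2 \<Rightarrow> real^2) \<Rightarrow>
   (nat \<Rightarrow> real^2 \<Rightarrow> real) \<Rightarrow> (nat \<Rightarrow> real) \<Rightarrow> nat \<Rightarrow> real" where
  "sav_energy \<Omega> \<nu> dt ut u p q n =
     (L2_norm \<Omega> (u n))\<^sup>2 + (L2_norm \<Omega> (\<lambda>x. 2 *\<^sub>R u n x - u (n-1) x))\<^sup>2
     + 4 / 3 * dt\<^sup>2 * (L2_norm \<Omega> (weak_grad \<Omega> (\<lambda>x. p n x + div_sum \<Omega> \<nu> ut n x)))\<^sup>2
     + 2 * inverse \<nu> * dt * (L2_norm \<Omega> (div_sum \<Omega> \<nu> ut n))\<^sup>2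
     + \<bar>q n\<bar>\<^sup>2 + \<bar>2 * q n - q (n-1)\<bar>\<^sup>2"

end

theory Submission
  imports Defs
begin

text \<open>
  Write \<open>v\<close> for the new intermediate velocity, \<open>a, b, c\<close> for the velocities at the levels \<open>n+1, n, n-1\<close>,
  and \<open>H\<^sub>k = p\<^sub>k + g\<^sub>k\<close>. Testing the momentum equation with \<open>v\<close> gives \<open>\<parallel>\<nabla>v\<parallel>\<^sup>2\<close>, because \<open>v\<close> vanishes on
  the boundary. By the choice of \<open>g\<close> the projection step reads \<open>v = a + s (\<nabla>H\<^sub>n\<^sub>+\<^sub>1 - \<nabla>H\<^sub>n)\<close> with
  \<open>s = 2 dt / 3\<close>. All velocities \<open>a, b, c\<close> are orthogonal to gradients, so in the time difference
  tested with \<open>v\<close> the cross terms disappear: what remains is \<open>(3a - 4b + c, a)\<close>, to which the identity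
  \<open>2(3a - 4b + c)a = a\<^sup>2 + (2a-b)\<^sup>2 - b\<^sup>2 - (2b-c)\<^sup>2 + (a-2b+c)\<^sup>2\<close> applies, plus differences of \<open>\<parallel>\<nabla>H\<parallel>\<^sup>2\<close>.
  The remaining pressure term is \<open>(g\<^sub>n, div v)\<close>; since \<open>g\<^sub>n\<^sub>+\<^sub>1 - g\<^sub>n = \<nu> div v\<close> it is a difference of
  \<open>\<parallel>g\<parallel>\<^sup>2\<close> up to the error \<open>2 \<nu> dt \<parallel>div v\<parallel>\<^sup>2 \<le> 2 \<nu> dt \<parallel>\<nabla>v\<parallel>\<^sup>2\<close>, which costs half of the viscous dissipation
  \<open>4 \<nu> dt \<parallel>\<nabla>v\<parallel>\<^sup>2\<close>. The nonlinear term carries the factor \<open>q\<close>, and multiplying the scalar equation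
  by \<open>q\<close> cancels it exactly, whatever the size of the velocity; this is why the time step is
  unrestricted. The computation is \<open>rotational_step_energy\<close>.

  The analytic facts behind it are the following.

  Weak derivatives are unique (\<open>has_weak_partial_unique\<close>) and may be tested with functions that are only
  \<open>C\<^sup>1\<close> (\<open>has_weak_partial_compact_C1\<close>). Both follow from smoothing by convolution with a mollifier, which
  converges in the mean because translation is continuous in the mean (\<open>translation_gap_tendsto\<close>).

  For fields vanishing on the boundary, integration by parts and \<open>\<parallel>div v\<parallel> \<le> \<parallel>\<nabla>v\<parallel>\<close> follow by
  approximation with test functions (\<open>H10_integration_by_parts\<close>, \<open>L2_inner_weak_div_le_jacobian\<close>).

  The delicate point is that a solenoidal field with vanishing normal component is orthogonal to the
  gradient of every \<open>H\<close> in \<open>H\<^sup>1\<close> (\<open>normal_trace_orthogonal\<close>). The field has a representative \<open>w\<close> that is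
  continuous up to the boundary, and there are cutoffs \<open>\<zeta>\<^sub>k\<close> vanishing near the boundary with
  \<open>\<integral> \<bar>w \<cdot> \<nabla>\<zeta>\<^sub>k\<bar> \<longlonglongrightarrow> 0\<close> (\<open>boundary_cutoffs_exist\<close>): the gradient of \<open>\<zeta>\<^sub>k\<close> has size \<open>k\<close>, lives on a strip of
  measure \<open>O(1/k)\<close>, and points, up to a bounded part, in the normal direction, in which \<open>w\<close> is
  uniformly small there.
  This controls \<open>\<integral> H w \<cdot> \<nabla>\<zeta>\<^sub>k\<close> for bounded \<open>H\<close>; for general \<open>H\<close> one replaces \<open>H\<close> by the bounded function
  \<open>M arctan (H/M)\<close> and lets \<open>M\<close> tend to infinity.
\<close>

section \<open>Calculus of continuously differentiable functions on the plane\<close>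

lemma has_derivative_partial_deriv:
  assumes "(f has_derivative D) (at x)"
  shows "partial_deriv i f x = D (axis i 1)"
  using frechet_derivative_at[OF assms] by (simp add: partial_deriv_def)

lemma has_derivative_gradient:
  assumes "f differentiable (at x)"
  shows "(f has_derivative (\<lambda>v. gradient f x \<bullet> v)) (at x)"
proof -
  obtain D where D: "(f has_derivative D) (at x)"
    using assms by (auto simp: differentiable_def)
  have lin: "linear D" using D by (simp add: has_derivative_linear)
  have "D v = gradient f x \<bullet> v" for v
  proof -
    have "D v = D (\<Sum>i\<in>UNIV. v $ i *\<^sub>R axis i 1)"
      using basis_expansion[of v] by (simp add: scalar_mult_eq_scaleR)
    also have "\<dots> = (\<Sum>i\<in>UNIV. v $ i * D (axis i 1))"
      by (simp add: linear_sum[OF lin] linear_scale[OF lin])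
    also have "\<dots> = gradient f x \<bullet> v"
      by (simp add: inner_vec_def gradient_def has_derivative_partial_deriv[OF D] mult.commute)
    finally show ?thesis .
  qed
  then have "D = (\<lambda>v. gradient f x \<bullet> v)" by auto
  with D show ?thesis by simp
qed

lemma gradient_eqI:
  assumes "(f has_derivative (\<lambda>v. G \<bullet> v)) (at x)"
  shows "gradient f x = G"
  by (simp add: gradient_def has_derivative_partial_deriv[OF assms] vec_eq_iff inner_axis)

lemma partial_deriv_eq_gradient: "partial_deriv i f x = gradient f x $ i"
  by (simp add: gradient_def)

lemma Ck_on_has_derivative:
  assumes "Ck_on (Suc k) S f" "x \<in> S"
  shows "(f has_derivative (\<lambda>v. gradient f x \<bullet> v)) (at x)"
  using assms by (intro has_derivative_gradient) auto

lemma Ck_on_lower: "Ck_on (Suc k) S f \<Longrightarrow> Ck_on k S f"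
proof (induction k arbitrary: f)
  case 0
  then show ?case
    by (auto intro!: differentiable_imp_continuous_on differentiable_on_def[THEN iffD2]
        simp: differentiable_at_withinI)
next
  case (Suc k)
  then show ?case by auto
qed

lemma Ck_on_continuous: "Ck_on k S f \<Longrightarrow> continuous_on S f"
proof (induction k)
  case (Suc k)
  show ?case by (rule Suc.IH[OF Ck_on_lower[OF Suc.prems]])
qed simp

lemma Ck_on_continuous_gradient:
  assumes "Ck_on (Suc k) S f"
  shows "continuous_on S (gradient f)"
  unfolding gradient_def
  by (rule continuous_on_vec_lambda, rule Ck_on_continuous[of k]) (use assms in auto)

lemma Ck1_I:
  assumes "\<And>x. x \<in> S \<Longrightarrow> (f has_derivative (\<lambda>v. G x \<bullet> v)) (at x)" "continuous_on S G"
  shows "Ck_on (Suc 0) S f"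
proof -
  have "continuous_on S (partial_deriv i f) \<longleftrightarrow> continuous_on S (\<lambda>x. G x $ i)" for i
    by (rule continuous_on_cong) (auto simp: partial_deriv_eq_gradient gradient_eqI[OF assms(1)])
  then show ?thesis
    using assms by (auto simp: differentiable_def intro: continuous_intros)
qed

lemma partial_deriv_cong_open:
  assumes "open S" "x \<in> S" "\<And>y. y \<in> S \<Longrightarrow> f y = g y"
  shows "partial_deriv i f x = partial_deriv i g x" "f differentiable (at x) \<longleftrightarrow> g differentiable (at x)"
proof -
  have "(f has_derivative D) (at x) \<longleftrightarrow> (g has_derivative D) (at x)" for D
    using has_derivative_transform_within_open[OF _ assms(1,2), of f D UNIV g]
      has_derivative_transform_within_open[OF _ assms(1,2), of g D UNIV f] assms(3) by auto
  then show "partial_deriv i f x = partial_deriv i g x" "f differentiable (at x) \<longleftrightarrow> g differentiable (at x)"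
    by (simp_all add: partial_deriv_def frechet_derivative_def differentiable_def)
qed

lemma Ck_on_cong:
  assumes "open S" "\<And>y. y \<in> S \<Longrightarrow> f y = g y"
  shows "Ck_on k S f \<longleftrightarrow> Ck_on k S g"
  using assms(2)
proof (induction k arbitrary: f g)
  case 0
  then show ?case by (simp cong: continuous_on_cong)
next
  case (Suc k)
  have "Ck_on k S (partial_deriv i f) \<longleftrightarrow> Ck_on k S (partial_deriv i g)" for i
    by (rule Suc.IH, rule partial_deriv_cong_open(1)[OF assms(1)]) (simp_all add: Suc.prems)
  moreover have "f differentiable (at x) \<longleftrightarrow> g differentiable (at x)" if "x \<in> S" for x
    by (rule partial_deriv_cong_open(2)[OF assms(1) that]) (rule Suc.prems)
  ultimately show ?case by simp
qed

lemma Ck_on_congI: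
  assumes "open S" "Ck_on k S g" "\<And>y. y \<in> S \<Longrightarrow> f y = g y"
  shows "Ck_on k S f"
  using Ck_on_cong[OF assms(1,3)] assms(2) by simp

lemma Ck_on_subset: "Ck_on k S f \<Longrightarrow> T \<subseteq> S \<Longrightarrow> Ck_on k T f"
  by (induction k arbitrary: f) (auto intro: continuous_on_subset)

lemma Ck_on_const: "Ck_on k S (\<lambda>x. c)"
proof (induction k arbitrary: c)
  case (Suc k)
  have "partial_deriv i (\<lambda>x. c) = (\<lambda>x. 0)" for i
    by (rule ext) (simp add: has_derivative_partial_deriv[OF has_derivative_const])
  with Suc show ?case by simp
qed simp

lemma Ck_on_component: "Ck_on k S (\<lambda>x. x $ j)"
proof (cases k)
  case (Suc m)
  have D: "((\<lambda>x::real^2. x $ j) has_derivative (\<lambda>v. v $ j)) (at x)" for x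
    by (rule bounded_linear_imp_has_derivative) (rule bounded_linear_vec_nth)
  have "partial_deriv i (\<lambda>x. x $ j) = (\<lambda>x. axis i 1 $ j)" for i
    by (rule ext) (simp add: has_derivative_partial_deriv[OF D])
  with D show ?thesis by (auto simp: Suc Ck_on_const differentiable_def)
qed (simp add: continuous_intros)

lemma Ck_on_add:
  assumes "open S" "Ck_on k S f" "Ck_on k S g"
  shows "Ck_on k S (\<lambda>x. f x + g x)"
  using assms(2,3)
proof (induction k arbitrary: f g)
  case (Suc k)
  have pd: "partial_deriv i (\<lambda>x. f x + g x) x = partial_deriv i f x + partial_deriv i g x" if "x \<in> S" for i x
    by (subst has_derivative_partial_deriv[OF has_derivative_add[OF
            Ck_on_has_derivative[OF Suc.prems(1) that] Ck_on_has_derivative[OF Suc.prems(2) that]]])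
      (simp add: partial_deriv_eq_gradient inner_axis)
  have ck: "Ck_on k S (\<lambda>x. partial_deriv i f x + partial_deriv i g x)" for i
    by (rule Suc.IH) (use Suc.prems in auto)
  have "Ck_on k S (partial_deriv i (\<lambda>x. f x + g x))" for i
    by (rule Ck_on_congI[OF assms(1) ck pd])
  then show ?case using Suc.prems by auto
qed (auto intro: continuous_intros)

lemma Ck_on_mult:
  assumes "open S" "Ck_on k S f" "Ck_on k S g"
  shows "Ck_on k S (\<lambda>x. f x * g x)"
  using assms(2,3)
proof (induction k arbitrary: f g)
  case (Suc k)
  have pd: "partial_deriv i (\<lambda>x. f x * g x) x = f x * partial_deriv i g x + partial_deriv i f x * g x"
    if "x \<in> S" for i x
    by (subst has_derivative_partial_deriv[OF has_derivative_mult[OF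
            Ck_on_has_derivative[OF Suc.prems(1) that] Ck_on_has_derivative[OF Suc.prems(2) that]]])
      (simp add: partial_deriv_eq_gradient inner_axis)
  have ck: "Ck_on k S (\<lambda>x. f x * partial_deriv i g x + partial_deriv i f x * g x)" for i
    by (intro Ck_on_add[OF assms(1)] Suc.IH)
      (use Suc.prems Ck_on_lower[OF Suc.prems(1)] Ck_on_lower[OF Suc.prems(2)] in simp_all)
  have "Ck_on k S (partial_deriv i (\<lambda>x. f x * g x))" for i
    by (rule Ck_on_congI[OF assms(1) ck pd])
  then show ?case using Suc.prems by auto
qed (auto intro: continuous_intros)

text \<open>A family closed under differentiation, up to linear combinations, can be composed with a \<open>C\<^sup>k\<close>
  function: the chain rule stays within the family, so the induction on \<open>k\<close> runs for all its members
  at once.\<close>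

lemma Ck_on_compose:
  assumes "open S" "\<And>n t. (h n has_real_derivative h' n t) (at t)"
    and "\<And>n. \<exists>a b. \<forall>t. h' n t = a * h (Suc n) t + b * h (Suc (Suc n)) t"
    and "Ck_on k S f"
  shows "Ck_on k S (\<lambda>x. h n (f x))"
  using assms(4)
proof (induction k arbitrary: n f)
  case 0
  have "continuous_on UNIV (h n)"
    using assms(2) by (meson DERIV_continuous_on has_field_derivative_at_within)
  then show ?case using 0 by (simp add: continuous_on_compose2)
next
  case (Suc k)
  obtain a b where ab: "\<And>t. h' n t = a * h (Suc n) t + b * h (Suc (Suc n)) t"
    using assms(3) by meson
  have D: "((\<lambda>x. h n (f x)) has_derivative (\<lambda>v. (gradient f x \<bullet> v) * h' n (f x))) (at x)"
    if "x \<in> S" for x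
    using has_derivative_compose[OF Ck_on_has_derivative[OF Suc.prems that]
        assms(2)[of n "f x", unfolded has_field_derivative_def]] by (simp add: mult.commute)
  have pd: "partial_deriv i (\<lambda>x. h n (f x)) x
      = partial_deriv i f x * (a * h (Suc n) (f x) + b * h (Suc (Suc n)) (f x))"
    if "x \<in> S" for i x
    using has_derivative_partial_deriv[OF D[OF that]]
    by (simp add: partial_deriv_eq_gradient inner_axis ab)
  have ck: "Ck_on k S (\<lambda>x. partial_deriv i f x * (a * h (Suc n) (f x) + b * h (Suc (Suc n)) (f x)))"
    for i
    by (intro Ck_on_mult Ck_on_add Ck_on_const Suc.IH assms(1))
      (use Suc.prems Ck_on_lower[OF Suc.prems] in simp_all)
  have "Ck_on k S (partial_deriv i (\<lambda>x. h n (f x)))" for i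
    by (rule Ck_on_congI[OF assms(1) ck pd])
  then show ?case using D by (auto simp: differentiable_def)
qed

text \<open>The function \<open>exp (-1/t)\<close> is smooth across \<open>0\<close>. The extra factor \<open>t\<^sup>-\<^sup>n\<close> makes the family closed under
  differentiation.\<close>

definition bump_profile :: "nat \<Rightarrow> real \<Rightarrow> real" where
  "bump_profile n t = (if t > 0 then exp (- 1 / t) / t ^ n else 0)"

text \<open>The exponential beats every power. The quadratic rate is what makes the difference quotient at \<open>0\<close>
  tend to \<open>0\<close>.\<close>

lemma bump_profile_bound: "\<bar>bump_profile n t\<bar> \<le> real (n + 2) ^ (n + 2) * t\<^sup>2"
proof (cases "t > 0")
  case True
  have "(1 / (t * real (n + 2))) ^ (n + 2) \<le> (1 + (1 / t) / real (n + 2)) ^ (n + 2)"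
    using True by (intro power_mono) (auto simp: field_simps)
  also have "\<dots> \<le> exp (1 / t)"
    by (rule exp_ge_one_plus_x_over_n_power_n) (use True in \<open>auto intro: order_trans[of _ 0]\<close>)
  finally have "inverse (exp (1 / t)) \<le> inverse ((1 / (t * real (n + 2))) ^ (n + 2))"
    by (rule le_imp_inverse_le) (use True in simp)
  then have "exp (- 1 / t) \<le> (t * real (n + 2)) ^ (n + 2)"
    using True by (simp only: minus_divide_left[symmetric] exp_minus power_one_over) simp
  then have "exp (- 1 / t) / t ^ n \<le> (t * real (n + 2)) ^ (n + 2) / t ^ n"
    using True by (simp add: divide_right_mono)
  also have "\<dots> = real (n + 2) ^ (n + 2) * t\<^sup>2"
    using True by (simp add: power_mult_distrib power_add power2_eq_square)
  finally show ?thesis using True by (simp add: bump_profile_def)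
qed (simp add: bump_profile_def)

lemma bump_profile_derivative:
  "(bump_profile n has_real_derivative
      (- real n * bump_profile (Suc n) t + 1 * bump_profile (Suc (Suc n)) t)) (at t)"
proof -
  consider "t > 0" | "t < 0" | "t = 0" by linarith
  then show ?thesis
  proof cases
    case 1
    have "((\<lambda>t. exp (- 1 / t) / t ^ n) has_real_derivative
      ((exp (- 1 / t) * (1 / t\<^sup>2)) * t ^ n - exp (- 1 / t) * (real n * t ^ (n - Suc 0))) / (t ^ n * t ^ n)) (at t)"
      using 1 by (auto intro!: derivative_eq_intros simp: power2_eq_square)
    also have "((exp (- 1 / t) * (1 / t\<^sup>2)) * t ^ n - exp (- 1 / t) * (real n * t ^ (n - Suc 0))) / (t ^ n * t ^ n)
        = - real n * bump_profile (Suc n) t + 1 * bump_profile (Suc (Suc n)) t"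
    proof (cases n)
      case 0
      then show ?thesis using 1 by (simp add: bump_profile_def power2_eq_square)
    next
      case (Suc m)
      have "t ^ m > 0" using 1 by simp
      then show ?thesis using 1 Suc
        by (simp add: bump_profile_def power2_eq_square divide_simps) (simp add: algebra_simps)
    qed
    finally have "((\<lambda>t. exp (- 1 / t) / t ^ n) has_real_derivative
      (- real n * bump_profile (Suc n) t + 1 * bump_profile (Suc (Suc n)) t)) (at t)" .
    then show ?thesis
      by (rule has_field_derivative_transform_within_open[where S="{0<..}"])
        (use 1 in \<open>auto simp: bump_profile_def\<close>)
  next
    case 2
    have "((\<lambda>t. 0) has_real_derivative
      (- real n * bump_profile (Suc n) t + 1 * bump_profile (Suc (Suc n)) t)) (at t)"
      using 2 by (simp add: bump_profile_def)
    then show ?thesis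
      by (rule has_field_derivative_transform_within_open[where S="{..<0}"])
        (use 2 in \<open>auto simp: bump_profile_def\<close>)
  next
    case 3
    have "((\<lambda>h. (bump_profile n (0 + h) - bump_profile n 0) / h) \<longlongrightarrow> 0) (at 0)"
    proof (rule Lim_null_comparison)
      have "norm (bump_profile n h / h) \<le> real (n + 2) ^ (n + 2) * \<bar>h\<bar>" if "h \<noteq> 0" for h
      proof -
        have "norm (bump_profile n h / h) = \<bar>bump_profile n h\<bar> / \<bar>h\<bar>"
          by (simp add: abs_divide)
        also have "\<dots> \<le> real (n + 2) ^ (n + 2) * h\<^sup>2 / \<bar>h\<bar>"
          by (rule divide_right_mono[OF bump_profile_bound]) simp
        also have "h\<^sup>2 / \<bar>h\<bar> = \<bar>h\<bar>"
          using that by (metis abs_mult_self_eq nonzero_mult_div_cancel_left power2_eq_square abs_eq_0)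
        then have "real (n + 2) ^ (n + 2) * h\<^sup>2 / \<bar>h\<bar> = real (n + 2) ^ (n + 2) * \<bar>h\<bar>"
          by (metis times_divide_eq_right)
        finally show ?thesis .
      qed
      then show "\<forall>\<^sub>F h in at 0. norm ((bump_profile n (0 + h) - bump_profile n 0) / h) \<le> real (n + 2) ^ (n + 2) * \<bar>h\<bar>"
        by (auto simp: eventually_at_filter bump_profile_def)
      show "((\<lambda>h. real (n + 2) ^ (n + 2) * \<bar>h\<bar>) \<longlongrightarrow> (0::real)) (at 0)"
        by (auto intro!: tendsto_eq_intros)
    qed
    then show ?thesis by (simp add: 3 DERIV_def bump_profile_def)
  qed
qed

lemma Ck_on_bump_profile:
  assumes "open S" "Ck_on k S f" shows "Ck_on k S (\<lambda>x. bump_profile n (f x))"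
  by (rule Ck_on_compose[OF assms(1) bump_profile_derivative _ assms(2)]) blast

lemma Ck_on_affine: "Ck_on k UNIV (\<lambda>y. f y) \<Longrightarrow> Ck_on k UNIV (\<lambda>y. f (x + c *\<^sub>R y))"
  and partial_deriv_affine: "Ck_on (Suc 0) UNIV f \<Longrightarrow> partial_deriv i (\<lambda>y. f (x + c *\<^sub>R y)) y = c * partial_deriv i f (x + c *\<^sub>R y)"
proof -
  have D: "((\<lambda>y. f (x + c *\<^sub>R y)) has_derivative (\<lambda>v. c * (gradient f (x + c *\<^sub>R y) \<bullet> v))) (at y)"
    if "Ck_on (Suc k) UNIV f" for f k y
  proof -
    have 1: "((\<lambda>y. x + c *\<^sub>R y) has_derivative (\<lambda>v. c *\<^sub>R v)) (at y)"
      by (auto intro!: derivative_eq_intros)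
    show ?thesis
      using has_derivative_compose[OF 1 Ck_on_has_derivative[OF that]] by simp
  qed
  have pd: "partial_deriv i (\<lambda>y. f (x + c *\<^sub>R y)) y = c * partial_deriv i f (x + c *\<^sub>R y)"
    if "Ck_on (Suc k) UNIV f" for f k y i
    by (simp add: has_derivative_partial_deriv[OF D[OF that]] partial_deriv_eq_gradient inner_axis)
  then show "Ck_on (Suc 0) UNIV f \<Longrightarrow> partial_deriv i (\<lambda>y. f (x + c *\<^sub>R y)) y = c * partial_deriv i f (x + c *\<^sub>R y)" .
  show "Ck_on k UNIV (\<lambda>y. f y) \<Longrightarrow> Ck_on k UNIV (\<lambda>y. f (x + c *\<^sub>R y))"
  proof (induction k arbitrary: f)
    case 0
    then show ?case by (auto intro!: continuous_intros continuous_on_compose2[of UNIV f])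
  next
    case (Suc k)
    have "Ck_on k UNIV (\<lambda>y. c * partial_deriv i f (x + c *\<^sub>R y))" for i
      by (intro Ck_on_mult Ck_on_const Suc.IH) (use Suc.prems in auto)
    then have "Ck_on k UNIV (partial_deriv i (\<lambda>y. f (x + c *\<^sub>R y)))" for i
      using pd[OF Suc.prems] by presburger
    then show ?case using D[OF Suc.prems] by (auto simp: differentiable_def)
  qed
qed

section \<open>Continuity of translation in the mean\<close>

lemma lborel_isometry:
  fixes t :: "'a::euclidean_space" assumes "\<bar>c\<bar> = 1"
  shows "distr lborel borel (\<lambda>x. t + c *\<^sub>R x) = lborel"
proof -
  have "c \<noteq> 0" using assms by auto
  from lborel_affine[OF this, of t] show ?thesis using assms by (simp add: density_1)
qed

lemma lborel_isometry_integral: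
  fixes t :: "'a::euclidean_space" and f :: "'a \<Rightarrow> real"
  assumes "\<bar>c\<bar> = 1" "f \<in> borel_measurable borel"
  shows "integral\<^sup>L lborel (\<lambda>x. f (t + c *\<^sub>R x)) = integral\<^sup>L lborel f"
    "integrable lborel (\<lambda>x. f (t + c *\<^sub>R x)) \<longleftrightarrow> integrable lborel f"
proof -
  have m: "(\<lambda>x. t + c *\<^sub>R x) \<in> measurable lborel borel" by simp
  show "integral\<^sup>L lborel (\<lambda>x. f (t + c *\<^sub>R x)) = integral\<^sup>L lborel f"
    using integral_distr[OF m assms(2)] lborel_isometry[OF assms(1), of t] by simp
  show "integrable lborel (\<lambda>x. f (t + c *\<^sub>R x)) \<longleftrightarrow> integrable lborel f"
    using integrable_distr_eq[OF m assms(2)] lborel_isometry[OF assms(1), of t] by simp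
qed

lemma integrable_translate:
  fixes f :: "'a::euclidean_space \<Rightarrow> real"
  assumes "integrable lborel f"
  shows "integrable lborel (\<lambda>x. f (x + v))" "integral\<^sup>L lborel (\<lambda>x. f (x + v)) = integral\<^sup>L lborel f"
proof -
  have "f \<in> borel_measurable borel" using borel_measurable_integrable[OF assms] by simp
  from lborel_isometry_integral[of 1 f v, OF _ this] show
    "integrable lborel (\<lambda>x. f (x + v))" "integral\<^sup>L lborel (\<lambda>x. f (x + v)) = integral\<^sup>L lborel f"
    using assms by (simp_all add: add.commute)
qed

definition translation_gap :: "('a::euclidean_space \<Rightarrow> real) \<Rightarrow> 'a \<Rightarrow> real" where
  "translation_gap f v = integral\<^sup>L lborel (\<lambda>x. \<bar>f (x + v) - f x\<bar>)"

lemma translation_gap_triangle: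
  assumes "integrable lborel f" "integrable lborel g"
  shows "translation_gap (\<lambda>x. f x + g x) v \<le> translation_gap f v + translation_gap g v"
proof -
  note i = integrable_translate(1)[OF assms(1), of v] integrable_translate(1)[OF assms(2), of v] assms
  have "translation_gap (\<lambda>x. f x + g x) v
      \<le> integral\<^sup>L lborel (\<lambda>x. \<bar>f (x + v) - f x\<bar> + \<bar>g (x + v) - g x\<bar>)"
    unfolding translation_gap_def by (intro integral_mono) (use i in auto)
  also have "\<dots> = translation_gap f v + translation_gap g v"
    unfolding translation_gap_def by (intro Bochner_Integration.integral_add) (use i in auto)
  finally show ?thesis .
qed

lemma translation_gap_le_norm:
  assumes "integrable lborel f"
  shows "translation_gap f v \<le> 2 * integral\<^sup>L lborel (\<lambda>x. \<bar>f x\<bar>)"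
proof -
  note i = integrable_translate(1)[OF assms, of v] assms
  have "translation_gap f v \<le> integral\<^sup>L lborel (\<lambda>x. \<bar>f (x + v)\<bar> + \<bar>f x\<bar>)"
    unfolding translation_gap_def by (intro integral_mono) (use i in auto)
  also have "\<dots> = 2 * integral\<^sup>L lborel (\<lambda>x. \<bar>f x\<bar>)"
    using integrable_translate(2)[of "\<lambda>x. \<bar>f x\<bar>" v] i by simp
  finally show ?thesis .
qed

lemma translation_gap_nonneg: "0 \<le> translation_gap f v"
  unfolding translation_gap_def by simp

lemma translation_gap_scale: "translation_gap (\<lambda>x. f x * c) v = translation_gap f v * \<bar>c\<bar>"
  unfolding translation_gap_def by (simp flip: left_diff_distrib add: abs_mult)

text \<open>For an open set \<open>U\<close> the part of the gap where the indicator decreases tends to \<open>0\<close> by dominated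
  convergence, since a point of \<open>U\<close> stays in \<open>U\<close> under small translations. The other part has the same
  integral, because translation preserves the measure.\<close>

lemma translation_gap_open:
  fixes U :: "'a::euclidean_space set"
  assumes "open U" "emeasure lborel U < \<infinity>"
  shows "((\<lambda>v. translation_gap (indicator U) v) \<longlongrightarrow> 0) (at 0)"
proof -
  let ?f = "indicator U :: 'a \<Rightarrow> real"
  have int: "integrable lborel ?f" using assms by auto
  have eq: "translation_gap ?f v = 2 * integral\<^sup>L lborel (\<lambda>x. max 0 (?f x - ?f (x + v)))" for v
  proof -
    note i = integrable_translate[OF int, of v] int
    have "translation_gap ?f v = integral\<^sup>L lborel (\<lambda>x. 2 * max 0 (?f x - ?f (x + v)) - (?f x - ?f (x + v)))"
      unfolding translation_gap_def
      by (rule Bochner_Integration.integral_cong) (auto simp: indicator_def)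
    also have "\<dots> = 2 * integral\<^sup>L lborel (\<lambda>x. max 0 (?f x - ?f (x + v))) -
        (integral\<^sup>L lborel ?f - integral\<^sup>L lborel (\<lambda>x. ?f (x + v)))"
      using i by (subst Bochner_Integration.integral_diff) auto
    finally show ?thesis using i by simp
  qed
  have "((\<lambda>v. integral\<^sup>L lborel (\<lambda>x. max 0 (?f x - ?f (x + v)))) \<longlongrightarrow> 0) (at 0)"
    unfolding tendsto_at_iff_sequentially o_def
  proof (intro allI impI)
    fix X :: "nat \<Rightarrow> 'a" assume X: "\<forall>i. X i \<in> UNIV - {0}" "X \<longlonglongrightarrow> 0"
    have "(\<lambda>i. integral\<^sup>L lborel (\<lambda>x. max 0 (?f x - ?f (x + X i)))) \<longlonglongrightarrow> integral\<^sup>L lborel (\<lambda>x::'a. 0)"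
    proof (rule integral_dominated_convergence[where w="?f"])
      show "AE x in lborel. (\<lambda>i. max 0 (?f x - ?f (x + X i))) \<longlonglongrightarrow> 0"
      proof (intro AE_I2)
        fix x
        have "\<forall>\<^sub>F i in sequentially. max 0 (?f x - ?f (x + X i)) = 0"
        proof (cases "x \<in> U")
          case True
          have "(\<lambda>i. x + X i) \<longlonglongrightarrow> x + 0" by (intro tendsto_intros X)
          then have "\<forall>\<^sub>F i in sequentially. x + X i \<in> U"
            using True assms(1) topological_tendstoD by fastforce
          then show ?thesis by eventually_elim (use True in auto)
        qed auto
        then show "(\<lambda>i. max 0 (?f x - ?f (x + X i))) \<longlonglongrightarrow> 0" by (rule tendsto_eventually)
      qed
      show "AE x in lborel. norm (max 0 (?f x - ?f (x + X i))) \<le> ?f x" for i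
        by (auto simp: indicator_def)
      show "(\<lambda>x. max 0 (?f x - ?f (x + X i))) \<in> borel_measurable lborel" for i
        using integrable_translate(1)[OF int, of "X i"] int by (intro borel_measurable_max) auto
    qed (use int in auto)
    then show "(\<lambda>i. integral\<^sup>L lborel (\<lambda>x. max 0 (?f x - ?f (x + X i)))) \<longlonglongrightarrow> 0" by simp
  qed
  then have "((\<lambda>v. 2 * integral\<^sup>L lborel (\<lambda>x. max 0 (?f x - ?f (x + v)))) \<longlongrightarrow> 2 * 0) (at 0)"
    by (intro tendsto_mult tendsto_const)
  then show ?thesis by (simp add: eq)
qed

text \<open>The property passes to limits in the mean, so it spreads from open sets to measurable sets by outer
  regularity, then to simple functions and to all integrable functions.\<close>

lemma translation_gap_tendsto:
  fixes f :: "'a::euclidean_space \<Rightarrow> real"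
  assumes "integrable lborel f"
  shows "((\<lambda>v. translation_gap f v) \<longlongrightarrow> 0) (at 0)"
proof -
  have approx: "((\<lambda>v. translation_gap g v) \<longlongrightarrow> 0) (at 0)"
    if g: "integrable lborel g" and ex: "\<And>e. e > 0 \<Longrightarrow> \<exists>h. integrable lborel h \<and>
        ((\<lambda>v. translation_gap h v) \<longlongrightarrow> 0) (at 0) \<and> integral\<^sup>L lborel (\<lambda>x. \<bar>g x - h x\<bar>) < e" 
    for g :: "'a \<Rightarrow> real"
  proof (rule tendstoI)
    fix e :: real assume e: "e > 0"
    obtain h where h: "integrable lborel h" "((\<lambda>v. translation_gap h v) \<longlongrightarrow> 0) (at 0)"
      "integral\<^sup>L lborel (\<lambda>x. \<bar>g x - h x\<bar>) < e / 4"
      using ex[of "e / 4"] e by auto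
    have "\<forall>\<^sub>F v in at 0. translation_gap h v < e / 2"
      using h(2) e by (intro order_tendstoD(2)[where a="e/2"]) auto
    then show "\<forall>\<^sub>F v in at 0. dist (translation_gap g v) 0 < e"
    proof eventually_elim
      case (elim v)
      have "translation_gap g v \<le> translation_gap h v + translation_gap (\<lambda>x. g x - h x) v"
        using translation_gap_triangle[of h "\<lambda>x. g x - h x" v] g h by simp
      also have "translation_gap (\<lambda>x. g x - h x) v < e / 2"
        using translation_gap_le_norm[of "\<lambda>x. g x - h x" v] g h by simp
      finally show ?case using elim translation_gap_nonneg[of g v] by simp
    qed
  qed
  show ?thesis using assms
  proof (induction rule: integrable_induct)
    case (base A c)
    have A: "A \<in> sets lebesgue" "emeasure lebesgue A < \<infinity>" using base by auto
    have "((\<lambda>v. translation_gap (indicator A) v) \<longlongrightarrow> 0) (at 0)"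
    proof (rule approx)
      show "integrable lborel (indicator A :: 'a \<Rightarrow> real)" using base by auto
      fix e :: real assume e: "e > 0"
      obtain U where U: "open U" "A \<subseteq> U" "(U - A) \<in> lmeasurable" "emeasure lebesgue (U - A) < ennreal e"
        using sets_lebesgue_outer_open[OF A(1) e] by blast
      have UA: "emeasure lborel (U - A) < ennreal e" using U base by auto
      have "emeasure lborel U = emeasure lborel A + emeasure lborel (U - A)"
        using base U by (subst plus_emeasure) (auto simp: Un_absorb1)
      also have "\<dots> < \<infinity>" using base UA by (auto simp: less_top[symmetric])
      finally have fin: "emeasure lborel U < \<infinity>" .
      have "integral\<^sup>L lborel (\<lambda>x. \<bar>indicator A x - indicator U x\<bar>)
          = integral\<^sup>L lborel (indicator (U - A) :: 'a \<Rightarrow> real)"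
        by (rule Bochner_Integration.integral_cong) (use U in \<open>auto simp: indicator_def\<close>)
      also have "\<dots> = measure lborel (U - A)" using base U by simp
      also have "\<dots> < e"
      proof -
        have "emeasure lborel (U - A) \<noteq> top" using less_trans[OF UA ennreal_less_top] by simp
        from emeasure_eq_ennreal_measure[OF this] show ?thesis using UA by (simp add: ennreal_less_iff)
      qed
      finally show "\<exists>h. integrable lborel h \<and> ((\<lambda>v. translation_gap h v) \<longlongrightarrow> 0) (at 0) \<and>
          integral\<^sup>L lborel (\<lambda>x. \<bar>indicator A x - h x\<bar>) < e"
        using translation_gap_open[OF U(1) fin] fin U(1)
        by (intro exI[of _ "indicator U"]) auto
    qed
    from tendsto_mult_left_zero[OF this, of "\<bar>c\<bar>"] show ?case by (simp add: translation_gap_scale)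
  next
    case (add f g)
    have "((\<lambda>v. translation_gap f v + translation_gap g v) \<longlongrightarrow> 0) (at 0)"
      using tendsto_add[OF add(3,4)] by simp
    then show ?case
    proof (rule Lim_null_comparison[rotated])
      show "\<forall>\<^sub>F v in at 0. norm (translation_gap (\<lambda>x. f x + g x) v) \<le> translation_gap f v + translation_gap g v"
        by (intro always_eventually allI)
          (simp add: translation_gap_triangle[OF add(1,2)] translation_gap_nonneg)
    qed
  next
    case (lim f s)
    have conv: "(\<lambda>i. integral\<^sup>L lborel (\<lambda>x. \<bar>f x - s i x\<bar>)) \<longlonglongrightarrow> integral\<^sup>L lborel (\<lambda>x::'a. 0)"
    proof (rule integral_dominated_convergence[where w="\<lambda>x. 3 * \<bar>f x\<bar>"])
      show "AE x in lborel. (\<lambda>i. \<bar>f x - s i x\<bar>) \<longlonglongrightarrow> 0"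
      proof (intro AE_I2)
        fix x
        have "(\<lambda>i. \<bar>f x - s i x\<bar>) \<longlonglongrightarrow> \<bar>f x - f x\<bar>"
          by (intro tendsto_intros lim) simp
        then show "(\<lambda>i. \<bar>f x - s i x\<bar>) \<longlonglongrightarrow> 0" by simp
      qed
      show "AE x in lborel. norm \<bar>f x - s i x\<bar> \<le> 3 * \<bar>f x\<bar>" for i
      proof (intro AE_I2)
        fix x
        have "norm (s i x) \<le> 2 * norm (f x)" using lim by simp
        then show "norm \<bar>f x - s i x\<bar> \<le> 3 * \<bar>f x\<bar>" by simp
      qed
    qed (use lim in auto)
    show ?case
    proof (rule approx)
      fix e :: real assume "e > 0"
      with conv have "\<forall>\<^sub>F i in sequentially. integral\<^sup>L lborel (\<lambda>x. \<bar>f x - s i x\<bar>) < e"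
        by (intro order_tendstoD(2)) auto
      then obtain i where "integral\<^sup>L lborel (\<lambda>x. \<bar>f x - s i x\<bar>) < e" 
        using eventually_happens trivial_limit_sequentially by blast
      then show "\<exists>h. integrable lborel h \<and> ((\<lambda>v. translation_gap h v) \<longlongrightarrow> 0) (at 0) \<and>
          integral\<^sup>L lborel (\<lambda>x. \<bar>f x - h x\<bar>) < e"
        using lim by (intro exI[of _ "s i"]) auto
    qed (use lim in auto)
  qed
qed

section \<open>Compactly supported functions and integration by parts\<close>

text \<open>Test functions of finite order of smoothness. Cutoffs built from a boundary of finite smoothness are
  only of this kind.\<close>

definition compact_Ck :: "nat \<Rightarrow> (real^2) set \<Rightarrow> (real^2 \<Rightarrow> real) \<Rightarrow> bool" where
  "compact_Ck k \<Omega> \<phi> \<longleftrightarrow>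
     Ck_on k UNIV \<phi> \<and> compact (closure {x. \<phi> x \<noteq> 0}) \<and> closure {x. \<phi> x \<noteq> 0} \<subseteq> \<Omega>"

lemma test_function_iff: "test_function \<Omega> \<phi> \<longleftrightarrow> (\<forall>k. compact_Ck k \<Omega> \<phi>)"
  by (auto simp: test_function_def compact_Ck_def)

lemma compact_CkI:
  assumes "Ck_on k UNIV \<phi>" "compact K" "K \<subseteq> \<Omega>" "\<And>x. x \<notin> K \<Longrightarrow> \<phi> x = 0"
  shows "compact_Ck k \<Omega> \<phi>"
proof -
  have sub: "closure {x. \<phi> x \<noteq> 0} \<subseteq> K"
    using assms by (intro closure_minimal compact_imp_closed) auto
  have "compact (K \<inter> closure {x. \<phi> x \<noteq> 0})"
    using assms(2) by (rule compact_Int_closed) simp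
  then show ?thesis
    using assms sub by (auto simp: compact_Ck_def Int_absorb1)
qed

lemma compact_Ck_zero: "compact_Ck k \<Omega> \<phi> \<Longrightarrow> x \<notin> closure {x. \<phi> x \<noteq> 0} \<Longrightarrow> \<phi> x = 0"
  using closure_subset[of "{x. \<phi> x \<noteq> 0}"] by auto

lemma compact_Ck_lower: "compact_Ck (Suc k) \<Omega> \<phi> \<Longrightarrow> compact_Ck k \<Omega> \<phi>"
  using Ck_on_lower by (auto simp: compact_Ck_def simp del: Ck_on.simps)

lemma gradient_zero_outside:
  assumes "x \<notin> closure {x. \<phi> x \<noteq> 0}" shows "gradient \<phi> x = 0"
proof -
  have "((\<lambda>x. 0) has_derivative (\<lambda>v. 0 \<bullet> v)) (at x)" by simp
  then have "(\<phi> has_derivative (\<lambda>v. 0 \<bullet> v)) (at x)"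
    by (rule has_derivative_transform_within_open[OF _ open_Compl[OF closed_closure[of "{x. \<phi> x \<noteq> 0}"]]])
      (use assms closure_subset[of "{x. \<phi> x \<noteq> 0}"] in auto)
  then show ?thesis by (rule gradient_eqI)
qed

lemma compact_Ck_partial_deriv:
  assumes "compact_Ck (Suc k) \<Omega> \<phi>" shows "compact_Ck k \<Omega> (partial_deriv i \<phi>)"
proof (rule compact_CkI)
  show "Ck_on k UNIV (partial_deriv i \<phi>)" using assms by (simp add: compact_Ck_def)
  show "partial_deriv i \<phi> x = 0" if "x \<notin> closure {x. \<phi> x \<noteq> 0}" for x
    using gradient_zero_outside[OF that] by (simp add: partial_deriv_eq_gradient)
  show "compact (closure {x. \<phi> x \<noteq> 0})" "closure {x. \<phi> x \<noteq> 0} \<subseteq> \<Omega>"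
    using assms unfolding compact_Ck_def by blast+
qed

lemma compact_support_uniformly_continuous:
  fixes h :: "'a::euclidean_space \<Rightarrow> 'b::real_normed_vector"
  assumes "continuous_on UNIV h" "compact K" "\<And>x. x \<notin> K \<Longrightarrow> h x = 0" "e > 0"
  shows "\<exists>d>0. \<forall>x v. norm v < d \<longrightarrow> norm (h (x + v) - h x) < e"
proof -
  obtain R where R: "\<And>x. x \<in> K \<Longrightarrow> norm x \<le> R"
    using compact_imp_bounded[OF assms(2)] by (auto simp: bounded_iff)
  have "uniformly_continuous_on (cball 0 (R + 2)) h"
    by (rule compact_uniformly_continuous) (use assms(1) continuous_on_subset in auto)
  then obtain d where d: "d > 0" "\<And>x y. x \<in> cball 0 (R+2) \<Longrightarrow> y \<in> cball 0 (R+2) \<Longrightarrow> dist y x < d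
      \<Longrightarrow> dist (h y) (h x) < e"
    using assms(4) unfolding uniformly_continuous_on_def by metis
  have "norm (h (x + v) - h x) < e" if v: "norm v < min d 1" for x v
  proof (cases "norm x \<le> R + 1")
    case True
    then have "x + v \<in> cball 0 (R + 2)" "x \<in> cball 0 (R + 2)" using v norm_triangle_ineq[of x v] by simp_all
    moreover have "dist (x + v) x < d" using v by (simp add: dist_norm)
    ultimately show ?thesis using d(2)[of x "x + v"] by (simp add: dist_norm)
  next
    case False
    then have "\<not> norm (x + v) \<le> R" using v norm_triangle_ineq4[of "x + v" v] by simp
    then have "x \<notin> K" "x + v \<notin> K" using False R by force+
    then show ?thesis using assms by simp
  qed
  then show ?thesis using d(1) by (intro exI[of _ "min d 1"]) auto
qed

lemma compact_support_bounded:
  fixes h :: "'a::euclidean_space \<Rightarrow> 'b::real_normed_vector"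
  assumes "continuous_on UNIV h" "compact K" "\<And>x. x \<notin> K \<Longrightarrow> h x = 0"
  shows "\<exists>B. \<forall>x. norm (h x) \<le> B"
proof -
  have "bounded (h ` K)"
    by (intro compact_imp_bounded compact_continuous_image assms(2) continuous_on_subset[OF assms(1)]) simp
  then obtain B where "\<And>x. x \<in> K \<Longrightarrow> norm (h x) \<le> B" by (auto simp: bounded_iff)
  then have "norm (h x) \<le> max B 0" for x by (cases "x \<in> K") (auto simp: assms(3) le_max_iff_disj)
  then show ?thesis by blast
qed

lemma compact_support_integrable:
  fixes h :: "'a::euclidean_space \<Rightarrow> real"
  assumes "continuous_on UNIV h" "compact K" "\<And>x. x \<notin> K \<Longrightarrow> h x = 0"
  shows "integrable lborel h"
proof -
  obtain B where B: "\<And>x. norm (h x) \<le> B" using compact_support_bounded[OF assms] by blast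
  have K: "integrable lborel (\<lambda>x. indicator K x * B)"
    using assms(2) emeasure_compact_finite[OF assms(2)]
    by (intro integrable_mult_left integrable_real_indicator) (auto simp: compact_imp_closed)
  show ?thesis
    by (rule Bochner_Integration.integrable_bound[OF K])
      (use assms B in \<open>auto simp: borel_measurable_continuous_onI indicator_def intro: order_trans[OF _ abs_ge_self]\<close>)
qed

text \<open>The gradient is uniformly continuous, so the mean value inequality gives a Taylor remainder that is
  uniform in the base point.\<close>

lemma compact_C1_uniform_Taylor:
  assumes "compact_Ck (Suc 0) \<Omega> h" "e > 0"
  shows "\<exists>d>0. \<forall>x v. norm v < d \<longrightarrow> \<bar>h (x + v) - h x - gradient h x \<bullet> v\<bar> \<le> e * norm v"
proof -
  let ?K = "closure {x. h x \<noteq> 0}"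
  have C1: "Ck_on (Suc 0) UNIV h" and K: "compact ?K" using assms by (auto simp: compact_Ck_def)
  obtain d where d: "d > 0" "\<And>x v. norm v < d \<Longrightarrow> norm (gradient h (x + v) - gradient h x) < e"
    using compact_support_uniformly_continuous[OF Ck_on_continuous_gradient[OF C1] K _ assms(2)]
      gradient_zero_outside by blast
  have "\<bar>h (x + v) - h x - gradient h x \<bullet> v\<bar> \<le> e * norm v" if v: "norm v < d" for x v
  proof -
    have "norm (h (x + v) - h x - gradient h x \<bullet> (x + v - x)) \<le> norm (x + v - x) * e"
    proof (rule differentiable_bound_linearization[where S="ball x d" and f'="\<lambda>y w. gradient h y \<bullet> w"])
      show "x + t *\<^sub>R (x + v - x) \<in> ball x d" if "t \<in> {0..1}" for t
        using that v mult_left_le_one_le[of "norm v" t] by (auto simp: dist_norm)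
      show "(h has_derivative (\<lambda>w. gradient h y \<bullet> w)) (at y within ball x d)" for y
        using Ck_on_has_derivative[OF C1, of y] by (simp add: has_derivative_at_withinI)
      fix y assume y: "y \<in> ball x d"
      have "norm (gradient h y - gradient h x) < e" using d(2)[of "y - x" x] y by (simp add: dist_norm norm_minus_commute)
      then show "onorm ((\<lambda>w. gradient h y \<bullet> w) - (\<lambda>w. gradient h x \<bullet> w)) \<le> e"
      proof (intro onorm_bound)
        fix w
        assume *: "norm (gradient h y - gradient h x) < e"
        have "\<bar>(gradient h y - gradient h x) \<bullet> w\<bar> \<le> norm (gradient h y - gradient h x) * norm w"
          by (rule Cauchy_Schwarz_ineq2)
        also have "\<dots> \<le> e * norm w" using * by (intro mult_right_mono) auto
        finally show "norm (((\<lambda>w. gradient h y \<bullet> w) - (\<lambda>w. gradient h x \<bullet> w)) w) \<le> e * norm w"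
          by (simp add: inner_diff_left)
      qed (use assms(2) in simp)
    qed (use d in auto)
    then show ?thesis by (simp add: mult.commute)
  qed
  then show ?thesis using d(1) by blast
qed

lemma compact_Ck_compact: "compact_Ck k \<Omega> h \<Longrightarrow> compact (closure {x. h x \<noteq> 0})"
  unfolding compact_Ck_def by blast

lemma compact_Ck_continuous: "compact_Ck k \<Omega> h \<Longrightarrow> continuous_on UNIV h"
  unfolding compact_Ck_def by (blast dest: Ck_on_continuous)

lemma compact_Ck_integrable:
  assumes "compact_Ck k \<Omega> h" shows "integrable lborel h"
  by (rule compact_support_integrable[OF compact_Ck_continuous[OF assms] compact_Ck_compact[OF assms]
        compact_Ck_zero[OF assms]])

text \<open>The difference quotients converge uniformly and vanish outside a fixed compact set, so the
  integral of a derivative is a limit of differences of equal integrals.\<close>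

lemma integral_difference_quotient:
  assumes "compact_Ck (Suc 0) \<Omega> h" "continuous_on UNIV g"
  shows "((\<lambda>t. integral\<^sup>L lborel (\<lambda>x. (h (x + t *\<^sub>R axis i 1) - h x) / t * g x))
      \<longlongrightarrow> integral\<^sup>L lborel (\<lambda>x. partial_deriv i h x * g x)) (at 0)"
proof (rule tendstoI)
  fix e :: real assume e: "e > 0"
  let ?K = "closure {x. h x \<noteq> 0}"
  have C1: "Ck_on (Suc 0) UNIV h" and K: "compact ?K" using assms by (auto simp: compact_Ck_def)
  obtain R where R: "\<And>x. x \<in> ?K \<Longrightarrow> norm x \<le> R"
    using compact_imp_bounded[OF K] unfolding bounded_iff by blast
  let ?B = "cball (0::real^2) (R + 1)"
  have "bounded (g ` ?B)"
    by (intro compact_imp_bounded compact_continuous_image continuous_on_subset[OF assms(2)]) auto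
  then obtain G0 where "\<forall>y\<in>g ` ?B. norm y \<le> G0" unfolding bounded_iff by blast
  then have G0: "\<And>x. x \<in> ?B \<Longrightarrow> \<bar>g x\<bar> \<le> G0" by (simp only: ball_simps real_norm_def)
  define G where "G = max G0 1"
  have G: "\<bar>g x\<bar> \<le> G" if "x \<in> ?B" for x
    using G0[OF that] by (simp add: G_def)
  have Gpos: "G > 0" by (simp add: G_def)
  define m where "m = measure lborel ?B + 1"
  have m: "m > 0" by (simp add: m_def add_nonneg_pos)
  define e' where "e' = e / (2 * m * G)"
  have e': "e' > 0" using e m Gpos by (simp add: e'_def)
  obtain d where d: "d > 0" "\<And>x v. norm v < d \<Longrightarrow> \<bar>h (x + v) - h x - gradient h x \<bullet> v\<bar> \<le> e' * norm v"
    using compact_C1_uniform_Taylor[OF assms(1) e'] by blast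
  have "dist (integral\<^sup>L lborel (\<lambda>x. (h (x + t *\<^sub>R axis i 1) - h x) / t * g x))
     (integral\<^sup>L lborel (\<lambda>x. partial_deriv i h x * g x)) < e" if t: "t \<noteq> 0" "\<bar>t\<bar> < min d 1" for t
  proof -
    let ?v = "t *\<^sub>R axis i 1 :: real^2"
    let ?q = "\<lambda>x. (h (x + ?v) - h x) / t"
    have nv: "norm ?v = \<bar>t\<bar>" by simp
    have zq: "?q x = 0" and zp: "partial_deriv i h x = 0" if "x \<notin> ?B" for x
    proof -
      have "\<not> norm x \<le> R" "\<not> norm (x + ?v) \<le> R"
        using that t norm_triangle_ineq4[of "x + ?v" ?v] by (auto simp: nv)
      then have "x \<notin> ?K" "x + ?v \<notin> ?K" using R by auto
      then have "h x = 0" "h (x + ?v) = 0" "gradient h x = 0"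
        by (blast intro: compact_Ck_zero[OF assms(1)] gradient_zero_outside)+
      then show "?q x = 0" "partial_deriv i h x = 0"
        by (simp_all add: partial_deriv_eq_gradient)
    qed
    have ch: "continuous_on UNIV h" by (rule compact_Ck_continuous[OF assms(1)])
    have cp: "continuous_on UNIV (partial_deriv i h)" using C1 by simp
    have iq: "integrable lborel (\<lambda>x. ?q x * g x)" 
      by (rule compact_support_integrable[where K="?B"])
       (use t in \<open>auto simp: zq intro!: continuous_intros assms continuous_on_compose2[OF ch]\<close>)
    have ip: "integrable lborel (\<lambda>x. partial_deriv i h x * g x)"
      by (rule compact_support_integrable[where K="?B"])
       (auto simp: zp intro!: continuous_intros assms cp)
    have bd: "\<bar>?q x * g x - partial_deriv i h x * g x\<bar> \<le> indicator ?B x * (e' * G)" for x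
    proof (cases "x \<in> ?B")
      case True
      have "\<bar>h (x + ?v) - h x - gradient h x \<bullet> ?v\<bar> \<le> e' * \<bar>t\<bar>" using d(2)[of ?v x] t by (simp add: nv)
      moreover have "?q x - partial_deriv i h x = (h (x + ?v) - h x - gradient h x \<bullet> ?v) / t"
        using t by (simp add: partial_deriv_eq_gradient inner_axis field_simps)
      ultimately have "\<bar>?q x - partial_deriv i h x\<bar> \<le> e'" 
        using t by (simp add: abs_divide divide_le_eq)
      then have "\<bar>?q x - partial_deriv i h x\<bar> * \<bar>g x\<bar> \<le> e' * G"
        using G[OF True] e' by (intro mult_mono) auto
      then have "\<bar>?q x * g x - partial_deriv i h x * g x\<bar> \<le> e' * G"
        by (simp only: left_diff_distrib[symmetric] abs_mult)
      then show ?thesis using True by simp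
    qed (simp add: zq zp)
    have "\<bar>integral\<^sup>L lborel (\<lambda>x. ?q x * g x) - integral\<^sup>L lborel (\<lambda>x. partial_deriv i h x * g x)\<bar>
      = \<bar>integral\<^sup>L lborel (\<lambda>x. ?q x * g x - partial_deriv i h x * g x)\<bar>"
      using iq ip by simp
    also have "\<dots> \<le> integral\<^sup>L lborel (\<lambda>x. indicator ?B x * (e' * G))"
    proof (rule integral_abs_bound_integral)
      show "integrable lborel (\<lambda>x. indicator ?B x * (e' * G))"
        using emeasure_compact_finite[OF compact_cball[of "0::real^2" "R + 1"]]
        by (intro integrable_mult_left integrable_real_indicator) auto
    qed (use iq ip bd in auto)
    also have "\<dots> = measure lborel ?B * (e' * G)" by simp
    also have "\<dots> \<le> m * (e' * G)" using e' Gpos by (intro mult_right_mono) (auto simp: m_def)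
    also have "\<dots> = e / 2" using m Gpos by (simp add: e'_def)
    also have "\<dots> < e" using e by simp
    finally show ?thesis by (simp add: dist_real_def)
  qed
  then show "\<forall>\<^sub>F t in at 0. dist (integral\<^sup>L lborel (\<lambda>x. (h (x + t *\<^sub>R axis i 1) - h x) / t * g x))
     (integral\<^sup>L lborel (\<lambda>x. partial_deriv i h x * g x)) < e"
    unfolding eventually_at using d(1) by (intro exI[of _ "min d 1"]) auto
qed

text \<open>The integral of a difference quotient is \<open>0\<close> by translation invariance.\<close>

lemma integral_partial_deriv_zero:
  assumes "compact_Ck (Suc 0) \<Omega> h"
  shows "integral\<^sup>L lborel (partial_deriv i h) = 0"
proof -
  have int: "integrable lborel h" by (rule compact_Ck_integrable[OF assms])
  have "integral\<^sup>L lborel (\<lambda>x. (h (x + t *\<^sub>R axis i 1) - h x) / t) = 0" for t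
    using integrable_translate[OF int, of "t *\<^sub>R axis i 1"] int by simp
  then have "((\<lambda>t::real. 0) \<longlongrightarrow> integral\<^sup>L lborel (partial_deriv i h)) (at 0)"
    using integral_difference_quotient[OF assms, of "\<lambda>x. 1" i] by (simp only: mult_1_right continuous_on_const)
  then show ?thesis using tendsto_const tendsto_unique trivial_limit_at by blast
qed

lemma partial_deriv_mult:
  assumes "Ck_on (Suc 0) S f" "Ck_on (Suc 0) S g" "x \<in> S"
  shows "partial_deriv i (\<lambda>x. f x * g x) x = f x * partial_deriv i g x + partial_deriv i f x * g x"
  by (subst has_derivative_partial_deriv[OF has_derivative_mult[OF
            Ck_on_has_derivative[OF assms(1,3)] Ck_on_has_derivative[OF assms(2,3)]]])
      (simp add: partial_deriv_eq_gradient inner_axis)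

lemma compact_Ck_mult:
  assumes "compact_Ck k \<Omega> f" "Ck_on k UNIV g"
  shows "compact_Ck k \<Omega> (\<lambda>x. f x * g x)"
proof (rule compact_CkI)
  show "Ck_on k UNIV (\<lambda>x. f x * g x)"
    using assms by (intro Ck_on_mult) (auto simp: compact_Ck_def)
  show "f x * g x = 0" if "x \<notin> closure {x. f x \<noteq> 0}" for x
    using compact_Ck_zero[OF assms(1) that] by simp
  show "compact (closure {x. f x \<noteq> 0})" by (rule compact_Ck_compact[OF assms(1)])
  show "closure {x. f x \<noteq> 0} \<subseteq> \<Omega>" using assms(1) by (simp add: compact_Ck_def)
qed

lemma integration_by_parts_compact:
  assumes "compact_Ck (Suc 0) \<Omega> f" "Ck_on (Suc 0) UNIV g"
  shows "integral\<^sup>L lborel (\<lambda>x. f x * partial_deriv i g x) = - integral\<^sup>L lborel (\<lambda>x. partial_deriv i f x * g x)"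
proof -
  have C0: "continuous_on UNIV g" "continuous_on UNIV (partial_deriv i g)"
    using Ck_on_continuous[OF assms(2)] assms(2) by simp_all
  have i: "integrable lborel (\<lambda>x. f x * partial_deriv i g x)" "integrable lborel (\<lambda>x. partial_deriv i f x * g x)"
    using compact_Ck_integrable[OF compact_Ck_mult[OF compact_Ck_lower[OF assms(1)], of "partial_deriv i g"]]
      compact_Ck_integrable[OF compact_Ck_mult[OF compact_Ck_partial_deriv[OF assms(1)], of g]] C0
    by simp_all
  have "0 = integral\<^sup>L lborel (partial_deriv i (\<lambda>x. f x * g x))"
    using integral_partial_deriv_zero[OF compact_Ck_mult[OF assms]] by simp
  also have "\<dots> = integral\<^sup>L lborel (\<lambda>x. f x * partial_deriv i g x + partial_deriv i f x * g x)"
    using assms by (intro Bochner_Integration.integral_cong) (auto simp: partial_deriv_mult[of UNIV] compact_Ck_def simp del: Ck_on.simps)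
  also have "\<dots> = integral\<^sup>L lborel (\<lambda>x. f x * partial_deriv i g x) + integral\<^sup>L lborel (\<lambda>x. partial_deriv i f x * g x)"
    using i by simp
  finally show ?thesis by simp
qed

text \<open>This is the symmetry of the second derivatives in integrated form. The difference quotient in
  one direction commutes with the derivative in the other and moves to the second factor by a change of
  variables.\<close>

lemma integral_partial_derivs_swap:
  assumes "compact_Ck (Suc (Suc 0)) \<Omega> \<phi>" "compact_Ck (Suc (Suc 0)) \<Omega> \<psi>"
  shows "integral\<^sup>L lborel (\<lambda>x. partial_deriv i \<phi> x * partial_deriv j \<psi> x)
       = integral\<^sup>L lborel (\<lambda>x. partial_deriv j \<phi> x * partial_deriv i \<psi> x)"
proof -
  note low = compact_Ck_lower[OF assms(1)] compact_Ck_lower[OF assms(2)]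
  have C: "continuous_on UNIV \<phi>" "continuous_on UNIV \<psi>"
    "continuous_on UNIV (partial_deriv j \<phi>)" "continuous_on UNIV (partial_deriv j \<psi>)"
    using compact_Ck_continuous[OF low(1)] compact_Ck_continuous[OF low(2)]
      compact_Ck_continuous[OF compact_Ck_partial_deriv[OF low(1)]]
      compact_Ck_continuous[OF compact_Ck_partial_deriv[OF low(2)]] by auto
  have C1: "Ck_on (Suc 0) UNIV \<phi>" "Ck_on (Suc 0) UNIV \<psi>"
    using low by (auto simp: compact_Ck_def simp del: Ck_on.simps)
  let ?Q = "\<lambda>h t x. (h (x + t *\<^sub>R axis i 1) - h x) / t"
  have lim1: "((\<lambda>t. integral\<^sup>L lborel (\<lambda>x. ?Q \<phi> t x * partial_deriv j \<psi> x))
      \<longlongrightarrow> integral\<^sup>L lborel (\<lambda>x. partial_deriv i \<phi> x * partial_deriv j \<psi> x)) (at 0)"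
    by (rule integral_difference_quotient[OF low(1) C(4)])
  have "((\<lambda>t. integral\<^sup>L lborel (\<lambda>x. ?Q \<psi> t x * partial_deriv j \<phi> x))
      \<longlongrightarrow> integral\<^sup>L lborel (\<lambda>x. partial_deriv i \<psi> x * partial_deriv j \<phi> x)) (at 0)"
    by (rule integral_difference_quotient[OF low(2) C(3)])
  moreover have "filterlim uminus (at (0::real)) (at 0)"
    by (simp add: filterlim_def filtermap_at_minus)
  ultimately have lim2: "((\<lambda>t. integral\<^sup>L lborel (\<lambda>x. ?Q \<psi> (- t) x * partial_deriv j \<phi> x))
      \<longlongrightarrow> integral\<^sup>L lborel (\<lambda>x. partial_deriv i \<psi> x * partial_deriv j \<phi> x)) (at 0)"
    by (rule filterlim_compose)
  have eq: "integral\<^sup>L lborel (\<lambda>x. ?Q \<phi> t x * partial_deriv j \<psi> x)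
      = integral\<^sup>L lborel (\<lambda>x. ?Q \<psi> (- t) x * partial_deriv j \<phi> x)" if t: "t \<noteq> 0" for t
  proof -
    let ?v = "t *\<^sub>R axis i 1 :: real^2"
    have shift: "Ck_on (Suc 0) UNIV (\<lambda>x. \<phi> (x + ?v))"
      and pshift: "partial_deriv j (\<lambda>x. \<phi> (x + ?v)) x = partial_deriv j \<phi> (x + ?v)" for x
      using Ck_on_affine[OF C1(1), of ?v 1] partial_deriv_affine[OF C1(1), of j ?v 1 x]
      by (simp_all add: add.commute del: Ck_on.simps)
    have int: "integrable lborel (\<lambda>x. g x * f x)" if "compact_Ck k \<Omega> g" "continuous_on UNIV f" for k g f
      using compact_Ck_integrable[OF compact_Ck_mult[of 0 \<Omega> g f]] that Ck_on_continuous
      by (auto simp: compact_Ck_def)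
    have c': "continuous_on UNIV (\<lambda>x. \<phi> (x + ?v))" "continuous_on UNIV (\<lambda>x. partial_deriv j \<phi> (x + ?v))"
      "continuous_on UNIV (\<lambda>x. \<psi> (x - ?v))"
      by (auto intro!: continuous_intros continuous_on_compose2[OF C(1)] continuous_on_compose2[OF C(3)] 
          continuous_on_compose2[OF C(2)])
    note cj = compact_Ck_partial_deriv[OF low(1), of j] compact_Ck_partial_deriv[OF low(2), of j]
    have a: "integral\<^sup>L lborel (\<lambda>x. \<phi> (x + ?v) * partial_deriv j \<psi> x)
        = - integral\<^sup>L lborel (\<lambda>x. partial_deriv j \<phi> x * \<psi> (x - ?v))"
    proof -
      have "integral\<^sup>L lborel (\<lambda>x. \<psi> x * partial_deriv j \<phi> (x + ?v))
          = - integral\<^sup>L lborel (\<lambda>x. partial_deriv j \<psi> x * \<phi> (x + ?v))"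
        using integration_by_parts_compact[OF low(2) shift, of j] by (simp add: pshift)
      moreover have "integral\<^sup>L lborel (\<lambda>x. \<psi> x * partial_deriv j \<phi> (x + ?v))
          = integral\<^sup>L lborel (\<lambda>x. partial_deriv j \<phi> x * \<psi> (x - ?v))"
        using integrable_translate(2)[OF int[OF cj(1) c'(3)], of ?v] by (simp add: mult.commute)
      ultimately show ?thesis by (simp add: mult.commute)
    qed
    have b: "integral\<^sup>L lborel (\<lambda>x. \<phi> x * partial_deriv j \<psi> x)
        = - integral\<^sup>L lborel (\<lambda>x. partial_deriv j \<phi> x * \<psi> x)"
      by (rule integration_by_parts_compact[OF low(1) C1(2)])
    have "integral\<^sup>L lborel (\<lambda>x. ?Q \<phi> t x * partial_deriv j \<psi> x)
      = (integral\<^sup>L lborel (\<lambda>x. \<phi> (x + ?v) * partial_deriv j \<psi> x)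
        - integral\<^sup>L lborel (\<lambda>x. \<phi> x * partial_deriv j \<psi> x)) / t"
    proof -
      have "integral\<^sup>L lborel (\<lambda>x. ?Q \<phi> t x * partial_deriv j \<psi> x)
        = integral\<^sup>L lborel (\<lambda>x. (partial_deriv j \<psi> x * \<phi> (x + ?v) - \<phi> x * partial_deriv j \<psi> x) / t)"
        by (rule Bochner_Integration.integral_cong) (simp_all add: algebra_simps)
      then show ?thesis using int[OF cj(2) c'(1)] int[OF low(1) C(4)] by (simp add: mult.commute)
    qed
    also have "\<dots> = (integral\<^sup>L lborel (\<lambda>x. partial_deriv j \<phi> x * \<psi> (x - ?v))
        - integral\<^sup>L lborel (\<lambda>x. partial_deriv j \<phi> x * \<psi> x)) / (- t)"
      unfolding a b using t by (simp add: field_simps)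
    also have "\<dots> = integral\<^sup>L lborel (\<lambda>x. ?Q \<psi> (- t) x * partial_deriv j \<phi> x)"
    proof -
      have "integral\<^sup>L lborel (\<lambda>x. ?Q \<psi> (- t) x * partial_deriv j \<phi> x)
        = integral\<^sup>L lborel (\<lambda>x. (partial_deriv j \<phi> x * \<psi> (x - ?v) - partial_deriv j \<phi> x * \<psi> x) / (- t))"
        by (rule Bochner_Integration.integral_cong) (simp_all add: algebra_simps)
      then show ?thesis using int[OF cj(1) c'(3)] int[OF cj(1) C(2)] by auto
    qed
    finally show ?thesis .
  qed
  have "((\<lambda>t. integral\<^sup>L lborel (\<lambda>x. ?Q \<phi> t x * partial_deriv j \<psi> x))
      \<longlongrightarrow> integral\<^sup>L lborel (\<lambda>x. partial_deriv i \<psi> x * partial_deriv j \<phi> x)) (at 0)"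
    by (rule Lim_transform_eventually[OF lim2], rule eventually_mono[OF eventually_neq_at_within])
      (rule eq[symmetric])
  from tendsto_unique[OF _ lim1 this] show ?thesis by (simp add: mult.commute)
qed

text \<open>The convolution \<open>f * \<kappa>\<close>.\<close>

definition smoothing :: "(real^2 \<Rightarrow> real) \<Rightarrow> (real^2 \<Rightarrow> real) \<Rightarrow> real^2 \<Rightarrow> real" where
  "smoothing f \<kappa> x = integral\<^sup>L lebesgue (\<lambda>y. f y * \<kappa> (x - y))"

lemma integrable_mult_bounded:
  fixes f g :: "'a \<Rightarrow> real"
  assumes "integrable M f" "g \<in> borel_measurable M" "\<And>x. \<bar>g x\<bar> \<le> B"
  shows "integrable M (\<lambda>x. f x * g x)"
proof (rule Bochner_Integration.integrable_bound)
  show "integrable M (\<lambda>x. f x * B)" using assms by simp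
  have "0 \<le> B" using assms(3)[of undefined] by linarith
  then show "AE x in M. norm (f x * g x) \<le> norm (f x * B)"
    using assms(3) by (auto simp: abs_mult intro!: mult_left_mono)
qed (use assms in auto)

lemma continuous_lebesgue_measurable:
  fixes h :: "real^2 \<Rightarrow> real"
  assumes "continuous_on UNIV h" shows "h \<in> borel_measurable lebesgue"
  using borel_measurable_continuous_onI[OF assms] by (auto intro: measurable_completion)

lemma integrable_smoothing_integrand:
  assumes "integrable lebesgue f" "compact_Ck k \<Omega> \<kappa>"
  shows "integrable lebesgue (\<lambda>y. f y * \<kappa> (x - y))"
proof -
  note c = compact_Ck_continuous[OF assms(2)]
  obtain B where B: "\<And>x. norm (\<kappa> x) \<le> B"
    using compact_support_bounded[OF c compact_Ck_compact[OF assms(2)] compact_Ck_zero[OF assms(2)]] by blast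
  have "continuous_on UNIV (\<lambda>y. \<kappa> (x - y))"
    by (intro continuous_on_compose2[OF c] continuous_intros) auto
  then show ?thesis
    using B by (intro integrable_mult_bounded[where B=B] assms continuous_lebesgue_measurable) auto
qed

text \<open>The Taylor remainder of the kernel is uniform in the base point, so it can be integrated against \<open>f\<close>.\<close>

lemma smoothing_has_derivative:
  assumes f: "integrable lebesgue f" and \<kappa>: "compact_Ck (Suc 0) \<Omega> \<kappa>"
  shows "(smoothing f \<kappa> has_derivative (\<lambda>v. (\<chi> i. smoothing f (partial_deriv i \<kappa>) x) \<bullet> v)) (at x)"
  unfolding has_derivative_at_alt
proof (intro conjI allI impI)
  show "bounded_linear ((\<bullet>) (\<chi> i. smoothing f (partial_deriv i \<kappa>) x))"
    by (rule bounded_linear_inner_right)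
  fix e :: real assume e: "e > 0"
  define I where "I = integral\<^sup>L lebesgue (\<lambda>y. \<bar>f y\<bar>) + 1"
  have I: "I > 0" by (simp add: I_def add_nonneg_pos)
  obtain d where d: "d > 0" "\<And>x v. norm v < d \<Longrightarrow> \<bar>\<kappa> (x + v) - \<kappa> x - gradient \<kappa> x \<bullet> v\<bar> \<le> e / I * norm v"
    using compact_C1_uniform_Taylor[OF \<kappa>, of "e / I"] e I by auto
  have "norm (smoothing f \<kappa> z - smoothing f \<kappa> x - (\<chi> i. smoothing f (partial_deriv i \<kappa>) x) \<bullet> (z - x))
      \<le> e * norm (z - x)" if z: "norm (z - x) < d" for z
  proof -
    let ?v = "z - x"
    have i1: "integrable lebesgue (\<lambda>y. f y * \<kappa> (z - y))" "integrable lebesgue (\<lambda>y. f y * \<kappa> (x - y))"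
      by (intro integrable_smoothing_integrand[OF f \<kappa>])+
    have i2: "integrable lebesgue (\<lambda>y. f y * partial_deriv i \<kappa> (x - y))" for i
      by (rule integrable_smoothing_integrand[OF f compact_Ck_partial_deriv[OF \<kappa>]])
    have "(\<chi> i. smoothing f (partial_deriv i \<kappa>) x) \<bullet> ?v
        = integral\<^sup>L lebesgue (\<lambda>y. \<Sum>i\<in>UNIV. (f y * partial_deriv i \<kappa> (x - y)) * ?v $ i)"
      by (simp add: inner_vec_def smoothing_def i2)
    also have "\<dots> = integral\<^sup>L lebesgue (\<lambda>y. f y * (gradient \<kappa> (x - y) \<bullet> ?v))"
      by (simp add: inner_vec_def partial_deriv_eq_gradient sum_distrib_left mult.assoc)
    finally have g: "(\<chi> i. smoothing f (partial_deriv i \<kappa>) x) \<bullet> ?v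
        = integral\<^sup>L lebesgue (\<lambda>y. f y * (gradient \<kappa> (x - y) \<bullet> ?v))" .
    have i3: "integrable lebesgue (\<lambda>y. f y * (gradient \<kappa> (x - y) \<bullet> ?v))"
    proof -
      have "integrable lebesgue (\<lambda>y. \<Sum>i\<in>UNIV. (f y * partial_deriv i \<kappa> (x - y)) * ?v $ i)"
        using i2 by simp
      then show ?thesis
        by (simp add: inner_vec_def partial_deriv_eq_gradient sum_distrib_left mult.assoc)
    qed
    have "smoothing f \<kappa> z - smoothing f \<kappa> x - (\<chi> i. smoothing f (partial_deriv i \<kappa>) x) \<bullet> ?v
      = integral\<^sup>L lebesgue (\<lambda>y. f y * \<kappa> (z - y) - f y * \<kappa> (x - y) - f y * (gradient \<kappa> (x - y) \<bullet> ?v))"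
      unfolding g using i1 i3 by (simp add: smoothing_def)
    also have "norm \<dots> \<le> integral\<^sup>L lebesgue (\<lambda>y. \<bar>f y\<bar> * (e / I * norm ?v))"
      unfolding real_norm_def
    proof (rule integral_abs_bound_integral)
      fix y
      have "\<bar>\<kappa> (z - y) - \<kappa> (x - y) - gradient \<kappa> (x - y) \<bullet> ?v\<bar> \<le> e / I * norm ?v"
        using d(2)[OF z, of "x - y"] by simp
      then have "\<bar>f y\<bar> * \<bar>\<kappa> (z - y) - \<kappa> (x - y) - gradient \<kappa> (x - y) \<bullet> ?v\<bar> \<le> \<bar>f y\<bar> * (e / I * norm ?v)"
        by (rule mult_left_mono) simp
      then show "\<bar>f y * \<kappa> (z - y) - f y * \<kappa> (x - y) - f y * (gradient \<kappa> (x - y) \<bullet> ?v)\<bar>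
          \<le> \<bar>f y\<bar> * (e / I * norm ?v)"
        by (simp only: abs_mult[symmetric] right_diff_distrib)
    qed (use i1 i3 f in auto)
    also have "\<dots> = integral\<^sup>L lebesgue (\<lambda>y. \<bar>f y\<bar>) * (e / I * norm ?v)" by simp
    also have "\<dots> \<le> I * (e / I * norm ?v)"
      using e I by (intro mult_right_mono) (auto simp: I_def)
    also have "\<dots> = e * norm ?v" using I by simp
    finally show ?thesis .
  qed
  then show "\<exists>d>0. \<forall>z. norm (z - x) < d \<longrightarrow> norm (smoothing f \<kappa> z - smoothing f \<kappa> x
      - (\<chi> i. smoothing f (partial_deriv i \<kappa>) x) \<bullet> (z - x)) \<le> e * norm (z - x)"
    using d(1) by blast
qed

lemma partial_deriv_smoothing:
  assumes "integrable lebesgue f" "compact_Ck (Suc 0) \<Omega> \<kappa>"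
  shows "partial_deriv i (smoothing f \<kappa>) = smoothing f (partial_deriv i \<kappa>)"
  using gradient_eqI[OF smoothing_has_derivative[OF assms]]
  by (auto simp: partial_deriv_eq_gradient)

lemma Ck_on_smoothing:
  assumes "integrable lebesgue f" "\<And>k. compact_Ck k \<Omega> \<kappa>"
  shows "Ck_on k UNIV (smoothing f \<kappa>)"
  using assms(2)
proof (induction k arbitrary: \<kappa>)
  case 0
  have "smoothing f \<kappa> differentiable at x" for x
    using smoothing_has_derivative[OF assms(1) 0] by (auto simp: differentiable_def)
  then show ?case
    by (auto intro!: differentiable_imp_continuous_on simp: differentiable_on_def)
next
  case (Suc k)
  have "smoothing f \<kappa> differentiable at x" for x
    using smoothing_has_derivative[OF assms(1) Suc.prems] by (auto simp: differentiable_def)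
  moreover have "Ck_on k UNIV (smoothing f (partial_deriv i \<kappa>))" for i
    by (intro Suc.IH compact_Ck_partial_deriv Suc.prems)
  ultimately show ?case by (simp add: partial_deriv_smoothing[OF assms(1) Suc.prems])
qed

section \<open>Mollifiers\<close>

definition bump :: "real \<Rightarrow> real^2 \<Rightarrow> real" where
  "bump r x = bump_profile 0 (r\<^sup>2 - x \<bullet> x)"

definition mollifier :: "real \<Rightarrow> real^2 \<Rightarrow> real" where
  "mollifier r x = inverse (integral\<^sup>L lborel (bump r)) * bump r x"

lemma bump_nonneg: "bump r x \<ge> 0"
  by (simp add: bump_def bump_profile_def)

lemma bump_zero: "r > 0 \<Longrightarrow> norm x \<ge> r \<Longrightarrow> bump r x = 0"
  using power_mono[of r "norm x" 2] by (simp add: bump_def bump_profile_def power2_norm_eq_inner)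

lemma bump_pos: "norm x < r \<Longrightarrow> bump r x > 0"
  using power_strict_mono[of "norm x" r 2] by (simp add: bump_def bump_profile_def power2_norm_eq_inner)

lemma Ck_on_bump: "Ck_on k UNIV (bump r)"
proof -
  have "Ck_on k UNIV (\<lambda>x::real^2. r\<^sup>2 + (-1) * (x $ 1 * x $ 1 + x $ 2 * x $ 2))"
    by (intro Ck_on_add Ck_on_mult Ck_on_const Ck_on_component open_UNIV)
  moreover have "(\<lambda>x::real^2. r\<^sup>2 + (-1) * (x $ 1 * x $ 1 + x $ 2 * x $ 2)) = (\<lambda>x. r\<^sup>2 - x \<bullet> x)"
    by (rule ext) (simp add: inner_vec_def UNIV_2)
  ultimately have "Ck_on k UNIV (\<lambda>x. r\<^sup>2 - x \<bullet> x)" by (simp del: Ck_on.simps)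
  from Ck_on_bump_profile[OF open_UNIV this] show ?thesis by (simp add: bump_def[abs_def] del: Ck_on.simps)
qed

lemma compact_Ck_bump: "r > 0 \<Longrightarrow> compact_Ck k UNIV (bump r)"
  by (rule compact_CkI[OF Ck_on_bump compact_cball[of 0 r]]) (auto intro: bump_zero)

lemma integral_bump_pos:
  assumes "r > 0" shows "integral\<^sup>L lborel (bump r) > 0"
proof -
  have int: "integrable lborel (bump r)" by (rule compact_Ck_integrable[OF compact_Ck_bump[OF assms]])
  have "integral\<^sup>L lborel (bump r) \<noteq> 0"
  proof
    assume "integral\<^sup>L lborel (bump r) = 0"
    then have "AE x in lborel. bump r x = 0"
      using integral_nonneg_eq_0_iff_AE[OF int] bump_nonneg by simp
    then have "AE x in lborel. (x::real^2) \<notin> ball 0 r"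
      by eventually_elim (use bump_pos[of _ r] in force)
    then have "ball (0::real^2) r \<in> null_sets lborel" by (subst AE_iff_null_sets) auto
    then have "negligible (ball (0::real^2) r)"
      by (auto simp: negligible_iff_null_sets intro: null_sets_completionI)
    moreover have "ball (0::real^2) r \<noteq> {}" using assms by simp
    ultimately show False using open_not_negligible by blast
  qed
  then show ?thesis using bump_nonneg Bochner_Integration.integral_nonneg[of lborel "bump r"] by (simp add: less_le)
qed

lemma mollifier_nonneg: "mollifier r x \<ge> 0"
  using bump_nonneg by (simp add: mollifier_def)

lemma mollifier_zero: "r > 0 \<Longrightarrow> norm x \<ge> r \<Longrightarrow> mollifier r x = 0"
  using bump_zero by (simp add: mollifier_def)

lemma compact_Ck_mollifier:
  assumes "r > 0" shows "compact_Ck k UNIV (mollifier r)"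
  unfolding mollifier_def
  by (rule compact_CkI[OF _ compact_cball[of 0 r]])
    (use assms bump_zero in \<open>auto intro!: Ck_on_mult Ck_on_const Ck_on_bump\<close>)

lemma integrable_mollifier: "r > 0 \<Longrightarrow> integrable lborel (mollifier r)"
  by (rule compact_Ck_integrable[OF compact_Ck_mollifier])

lemma integral_mollifier: "r > 0 \<Longrightarrow> integral\<^sup>L lborel (mollifier r) = 1"
  using integral_bump_pos[of r] by (simp add: mollifier_def[abs_def])

lemma mollifier_measurable: "r > 0 \<Longrightarrow> mollifier r \<in> borel_measurable borel"
  by (intro borel_measurable_continuous_onI compact_Ck_continuous[OF compact_Ck_mollifier])

lemma reflected_kernel:
  fixes k :: "real^2 \<Rightarrow> real"
  assumes "k \<in> borel_measurable borel"
  shows "integral\<^sup>L lborel (\<lambda>y. k (x - y)) = integral\<^sup>L lborel k"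
    "integrable lborel (\<lambda>y. k (x - y)) \<longleftrightarrow> integrable lborel k"
  using lborel_isometry_integral[of "-1" k x] assms by simp_all

text \<open>A uniformly continuous function varies little over the support of a narrow mollifier.\<close>

lemma smoothing_uniform:
  assumes "compact_Ck k \<Omega> h" "e > 0"
  shows "\<exists>d>0. \<forall>r x. 0 < r \<and> r < d \<longrightarrow> \<bar>smoothing h (mollifier r) x - h x\<bar> \<le> e"
proof -
  obtain d where d: "d > 0" "\<And>x v. norm v < d \<Longrightarrow> norm (h (x + v) - h x) < e"
    using compact_support_uniformly_continuous[OF compact_Ck_continuous[OF assms(1)] compact_Ck_compact[OF assms(1)]
        compact_Ck_zero[OF assms(1)] assms(2)] by blast
  have "\<bar>smoothing h (mollifier r) x - h x\<bar> \<le> e" if r: "0 < r" "r < d" for r x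
  proof -
    let ?m = "\<lambda>y. mollifier r (x - y)"
    have im: "integrable lborel ?m" "integral\<^sup>L lborel ?m = 1"
      using reflected_kernel[OF mollifier_measurable[OF r(1)], of x] integrable_mollifier[OF r(1)] integral_mollifier[OF r(1)] by auto
    have mm: "?m \<in> borel_measurable borel" using im by (auto dest: borel_measurable_integrable)
    have hm: "h \<in> borel_measurable borel" by (intro borel_measurable_continuous_onI compact_Ck_continuous[OF assms(1)])
    have hL: "integrable lebesgue h" using compact_Ck_integrable[OF assms(1)] by (subst integrable_completion) auto
    have ih: "integrable lborel (\<lambda>y. h y * ?m y)"
      using integrable_smoothing_integrand[OF hL compact_Ck_mollifier[OF r(1)], of x]
      by (subst (asm) integrable_completion) (use mm hm in auto)
    have s: "smoothing h (mollifier r) x = integral\<^sup>L lborel (\<lambda>y. h y * ?m y)"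
      unfolding smoothing_def by (rule integral_completion) (use mm hm in auto)
    have "smoothing h (mollifier r) x - h x = integral\<^sup>L lborel (\<lambda>y. h y * ?m y - h x * ?m y)"
      unfolding s using im ih by simp
    also have "\<bar>\<dots>\<bar> \<le> integral\<^sup>L lborel (\<lambda>y. e * ?m y)"
    proof (rule integral_abs_bound_integral)
      fix y
      have "\<bar>h y - h x\<bar> * ?m y \<le> e * ?m y"
      proof (cases "norm (x - y) < r")
        case True
        then have "\<bar>h y - h x\<bar> \<le> e" using d(2)[of "y - x" x] r by (simp add: norm_minus_commute)
        then show ?thesis by (intro mult_right_mono mollifier_nonneg)
      qed (simp add: mollifier_zero r)
      then show "\<bar>h y * ?m y - h x * ?m y\<bar> \<le> e * ?m y"
        by (simp add: abs_mult mollifier_nonneg flip: left_diff_distrib)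
    qed (use im ih in auto)
    also have "\<dots> = e" using im by simp
    finally show ?thesis .
  qed
  then show ?thesis using d(1) by blast
qed

text \<open>The smoothed function is an average of translates by vectors shorter than \<open>r\<close>; Tonelli's theorem
  moves the average outside the norm.\<close>

lemma smoothing_L1_le_translation_gap:
  assumes F: "integrable lborel F" and r: "r > 0"
    and gap: "\<And>v. norm v < r \<Longrightarrow> translation_gap F v \<le> e" and e: "e \<ge> 0"
  shows "integrable lborel (\<lambda>x. smoothing F (mollifier r) x - F x)"
    "integral\<^sup>L lborel (\<lambda>x. \<bar>smoothing F (mollifier r) x - F x\<bar>) \<le> e"
proof -
  have Fm[measurable]: "F \<in> borel_measurable borel" using borel_measurable_integrable[OF F] by simp
  have FL: "integrable lebesgue F" using F by (subst integrable_completion) auto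
  let ?m = "mollifier r"
  have mm[measurable]: "?m \<in> borel_measurable borel" by (rule mollifier_measurable[OF r])
  have im: "integrable lborel ?m" "integral\<^sup>L lborel ?m = 1"
    using integrable_mollifier[OF r] integral_mollifier[OF r] by auto
  have sm[measurable]: "smoothing F ?m \<in> borel_measurable borel"
    using Ck_on_continuous[OF Ck_on_smoothing[OF FL compact_Ck_mollifier[OF r]]]
    by (rule borel_measurable_continuous_onI)
  have pt: "ennreal \<bar>smoothing F ?m x - F x\<bar> \<le> (\<integral>\<^sup>+y. ennreal (?m y * \<bar>F (x - y) - F x\<bar>) \<partial>lborel)" for x
  proof -
    have i0: "integrable lborel (\<lambda>y. F y * ?m (x - y))"
      using integrable_smoothing_integrand[OF FL compact_Ck_mollifier[OF r], of x]
      by (subst (asm) integrable_completion) auto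
    have "smoothing F ?m x = integral\<^sup>L lborel (\<lambda>y. F y * ?m (x - y))"
      unfolding smoothing_def by (rule integral_completion) auto
    also have "\<dots> = integral\<^sup>L lborel (\<lambda>y. F (x - y) * ?m y)"
      using reflected_kernel(1)[of "\<lambda>y. F y * ?m (x - y)" x] by simp
    finally have s: "smoothing F ?m x = integral\<^sup>L lborel (\<lambda>y. F (x - y) * ?m y)" .
    have i1: "integrable lborel (\<lambda>y. F (x - y) * ?m y)"
      using reflected_kernel(2)[of "\<lambda>y. F y * ?m (x - y)" x] i0 by simp
    have "smoothing F ?m x - F x = integral\<^sup>L lborel (\<lambda>y. F (x - y) * ?m y - F x * ?m y)"
      unfolding s using i1 im by simp
    moreover have "ennreal (norm (integral\<^sup>L lborel (\<lambda>y. F (x - y) * ?m y - F x * ?m y)))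
        \<le> (\<integral>\<^sup>+y. ennreal (norm (F (x - y) * ?m y - F x * ?m y)) \<partial>lborel)"
      by (rule integral_norm_bound_ennreal) (use i1 im in auto)
    moreover have "norm (F (x - y) * ?m y - F x * ?m y) = ?m y * \<bar>F (x - y) - F x\<bar>" for y
      using mollifier_nonneg[of r y] by (simp add: abs_mult flip: left_diff_distrib)
    ultimately show ?thesis by simp
  qed
  have "(\<integral>\<^sup>+x. ennreal \<bar>smoothing F ?m x - F x\<bar> \<partial>lborel)
      \<le> (\<integral>\<^sup>+x. (\<integral>\<^sup>+y. ennreal (?m y * \<bar>F (x - y) - F x\<bar>) \<partial>lborel) \<partial>lborel)"
    by (intro nn_integral_mono pt)
  also have "\<dots> = (\<integral>\<^sup>+y. (\<integral>\<^sup>+x. ennreal (?m y * \<bar>F (x - y) - F x\<bar>) \<partial>lborel) \<partial>lborel)"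
    by (rule lborel_pair.Fubini'[symmetric]) simp
  also have "\<dots> \<le> (\<integral>\<^sup>+y. ennreal (e * ?m y) \<partial>lborel)"
  proof (rule nn_integral_mono)
    fix y
    have i: "integrable lborel (\<lambda>x. ?m y * \<bar>F (x - y) - F x\<bar>)"
      using integrable_translate(1)[OF F, of "- y"] F by (intro integrable_mult_right) auto
    have "(\<integral>\<^sup>+x. ennreal (?m y * \<bar>F (x - y) - F x\<bar>) \<partial>lborel) = ennreal (?m y * translation_gap F (- y))"
      by (subst nn_integral_eq_integral[OF i]) (auto simp: mollifier_nonneg translation_gap_def)
    also have "\<dots> \<le> ennreal (e * ?m y)"
    proof (cases "norm y < r")
      case True
      then have "translation_gap F (- y) \<le> e" using gap[of "- y"] by simp
      then show ?thesis using mult_left_mono[OF _ mollifier_nonneg[of r y]]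
          by (metis ennreal_leI mult.commute)
    qed (simp add: mollifier_zero r)
    finally show "(\<integral>\<^sup>+x. ennreal (?m y * \<bar>F (x - y) - F x\<bar>) \<partial>lborel) \<le> ennreal (e * ?m y)" .
  qed
  also have "\<dots> = ennreal e"
    by (subst nn_integral_eq_integral) (use im e mollifier_nonneg in auto)
  finally have fin: "(\<integral>\<^sup>+x. ennreal (norm (smoothing F ?m x - F x)) \<partial>lborel) \<le> ennreal e" by simp
  show int: "integrable lborel (\<lambda>x. smoothing F ?m x - F x)"
    by (rule integrableI_bounded) (use fin le_less_trans[OF fin ennreal_less_top] in auto)
  have "ennreal (integral\<^sup>L lborel (\<lambda>x. \<bar>smoothing F ?m x - F x\<bar>)) \<le> ennreal e"
    using fin by (subst nn_integral_eq_integral[symmetric]) (use int in auto)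
  then show "integral\<^sup>L lborel (\<lambda>x. \<bar>smoothing F ?m x - F x\<bar>) \<le> e" using e by simp
qed

lemma lebesgue_borel_representative:
  assumes "integrable lebesgue (f :: 'a::euclidean_space \<Rightarrow> real)"
  obtains F where "integrable lborel F" "AE x in lebesgue. f x = F x"
proof -
  obtain F where F: "F \<in> borel_measurable lborel" "AE x in lborel. f x = F x"
    using completion_ex_borel_measurable_real[OF borel_measurable_integrable[OF assms]] by blast
  have ae: "AE x in lebesgue. f x = F x" using F(2) by (rule AE_completion)
  have "integrable lebesgue F"
    using assms ae F(1) by (subst integrable_cong_AE[symmetric]) (auto intro: measurable_completion)
  then have "integrable lborel F" using F(1) by (simp add: integrable_completion)
  with ae that show ?thesis by blast
qed

text \<open>Convolution sees only the equivalence class of \<open>f\<close>, so a Borel representative carries the estimate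
  over from the Borel case.\<close>

lemma smoothing_L1:
  assumes f: "integrable lebesgue f"
  shows "r > 0 \<Longrightarrow> integrable lebesgue (\<lambda>x. smoothing f (mollifier r) x - f x)"
    and "e > 0 \<Longrightarrow> \<exists>d>0. \<forall>r. 0 < r \<and> r < d \<longrightarrow>
      integral\<^sup>L lebesgue (\<lambda>x. \<bar>smoothing f (mollifier r) x - f x\<bar>) \<le> e"
proof -
  obtain F where F: "integrable lborel F" "AE x in lebesgue. f x = F x"
    using lebesgue_borel_representative[OF f] by blast
  have iF: "integrable lborel (\<lambda>x. smoothing F (mollifier r) x - F x)" if "r > 0" for r
    by (rule smoothing_L1_le_translation_gap(1)[OF F(1) that translation_gap_le_norm[OF F(1)]]) simp
  have transfer: "integrable lebesgue (\<lambda>x. smoothing f (mollifier r) x - f x)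
    \<and> integral\<^sup>L lebesgue (\<lambda>x. \<bar>smoothing f (mollifier r) x - f x\<bar>)
      = integral\<^sup>L lborel (\<lambda>x. \<bar>smoothing F (mollifier r) x - F x\<bar>)" if r: "r > 0" for r
  proof -
    have Fm: "F \<in> borel_measurable lebesgue" using borel_measurable_integrable[OF F(1)] by (auto intro: measurable_completion)
    have fm: "f \<in> borel_measurable lebesgue" by (rule borel_measurable_integrable[OF f])
    have sm: "smoothing f (mollifier r) \<in> borel_measurable lebesgue"
      using Ck_on_continuous[OF Ck_on_smoothing[OF f compact_Ck_mollifier[OF r]]]
      by (rule continuous_lebesgue_measurable)
    have eq: "smoothing f (mollifier r) x = smoothing F (mollifier r) x" for x
      unfolding smoothing_def
    proof (rule integral_cong_AE)
      show "(\<lambda>y. f y * mollifier r (x - y)) \<in> borel_measurable lebesgue"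
        by (rule borel_measurable_integrable[OF integrable_smoothing_integrand[OF f compact_Ck_mollifier[OF r]]])
      show "(\<lambda>y. F y * mollifier r (x - y)) \<in> borel_measurable lebesgue"
        using F(1) by (intro borel_measurable_integrable[OF integrable_smoothing_integrand[OF _ compact_Ck_mollifier[OF r]]])
          (auto simp: integrable_completion)
    qed (use F(2) in \<open>eventually_elim, simp\<close>)
    have ae: "AE x in lebesgue. smoothing F (mollifier r) x - F x = smoothing f (mollifier r) x - f x"
      using F(2) by eventually_elim (simp add: eq)
    have smF: "smoothing F (mollifier r) \<in> borel_measurable lebesgue" 
    proof -
      have "smoothing f (mollifier r) = smoothing F (mollifier r)" by (rule ext) (rule eq)
      with sm show ?thesis by simp
    qed
    have i: "integrable lebesgue (\<lambda>x. smoothing F (mollifier r) x - F x)"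
      using iF[OF r] by (subst integrable_completion) (auto dest: borel_measurable_integrable)
    have "integrable lebesgue (\<lambda>x. smoothing f (mollifier r) x - f x)"
      by (rule integrable_cong_AE_imp[OF i _ ae]) (use fm sm in auto)
    moreover have "integral\<^sup>L lebesgue (\<lambda>x. \<bar>smoothing f (mollifier r) x - f x\<bar>)
        = integral\<^sup>L lebesgue (\<lambda>x. \<bar>smoothing F (mollifier r) x - F x\<bar>)"
      by (rule integral_cong_AE) (use Fm fm sm smF ae in auto)
    moreover have "\<dots> = integral\<^sup>L lborel (\<lambda>x. \<bar>smoothing F (mollifier r) x - F x\<bar>)"
      using iF[OF r] by (intro integral_completion) (auto dest: borel_measurable_integrable)
    ultimately show ?thesis by simp
  qed
  show "r > 0 \<Longrightarrow> integrable lebesgue (\<lambda>x. smoothing f (mollifier r) x - f x)" using transfer by blast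
  assume e: "e > 0"
  have "\<forall>\<^sub>F v in at 0. translation_gap F v < e"
    using translation_gap_tendsto[OF F(1)] e by (rule order_tendstoD(2))
  then obtain d where d: "d > 0" "\<And>v. v \<noteq> 0 \<Longrightarrow> norm v < d \<Longrightarrow> translation_gap F v < e"
    unfolding eventually_at by (auto simp: dist_norm)
  have gap: "translation_gap F v \<le> e" if "norm v < d" for v
    using d(2)[of v] that e by (cases "v = 0") (auto simp: translation_gap_def)
  have "integral\<^sup>L lebesgue (\<lambda>x. \<bar>smoothing f (mollifier r) x - f x\<bar>) \<le> e" if r: "0 < r" "r < d" for r
  proof -
    have "translation_gap F v \<le> e" if "norm v < r" for v using gap that r by simp
    from smoothing_L1_le_translation_gap(2)[OF F(1) r(1) this] transfer[OF r(1)] e show ?thesis by simp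
  qed
  then show "\<exists>d>0. \<forall>r. 0 < r \<and> r < d \<longrightarrow>
      integral\<^sup>L lebesgue (\<lambda>x. \<bar>smoothing f (mollifier r) x - f x\<bar>) \<le> e"
    using d(1) by blast
qed

section \<open>Weak derivatives\<close>

lemma locally_integrable_iff:
  "locally_integrable \<Omega> f \<longleftrightarrow> (\<forall>K. compact K \<and> K \<subseteq> \<Omega> \<longrightarrow> integrable lebesgue (\<lambda>x. indicator K x * f x))"
  by (simp add: locally_integrable_def set_integrable_def)

lemma lebesgue_on_integrable_iff:
  fixes f :: "'a::euclidean_space \<Rightarrow> real"
  assumes "open \<Omega>"
  shows "integrable (lebesgue_on \<Omega>) f \<longleftrightarrow> integrable lebesgue (\<lambda>x. indicator \<Omega> x * f x)"
  using assms by (subst integrable_restrict_space) auto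

lemma lebesgue_on_integral_eq:
  fixes f :: "'a::euclidean_space \<Rightarrow> real"
  assumes "open \<Omega>"
  shows "integral\<^sup>L (lebesgue_on \<Omega>) f = integral\<^sup>L lebesgue (\<lambda>x. indicator \<Omega> x * f x)"
  using assms by (subst integral_restrict_space) auto

lemma AE_lebesgue_on_iff:
  assumes "open (\<Omega>::'a::euclidean_space set)"
  shows "(AE x in lebesgue_on \<Omega>. P x) \<longleftrightarrow> (AE x in lebesgue. x \<in> \<Omega> \<longrightarrow> P x)"
  using assms by (subst AE_restrict_space_iff) auto

lemma L2_inner_real: "L2_inner \<Omega> f g = integral\<^sup>L (lebesgue_on \<Omega>) (\<lambda>x. f x * (g x :: real))"
  by (simp add: L2_inner_def)

lemma L2_inner_commute: "L2_inner \<Omega> f g = L2_inner \<Omega> g f"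
  by (simp add: L2_inner_def inner_commute)

lemma L2_inner_vanishing_outside:
  assumes "open \<Omega>" "K \<subseteq> \<Omega>" "\<And>x. x \<notin> K \<Longrightarrow> h x = 0"
  shows "L2_inner \<Omega> f h = integral\<^sup>L lebesgue (\<lambda>x. (indicator K x * f x) * (h x :: real))"
  unfolding L2_inner_real lebesgue_on_integral_eq[OF assms(1)]
proof (rule Bochner_Integration.integral_cong[OF refl])
  fix x show "indicator \<Omega> x * (f x * h x) = indicator K x * f x * h x"
    using subsetD[OF assms(2), of x] assms(3)[of x] by (cases "x \<in> K") (auto simp: indicator_def)
qed

text \<open>Room around a compact subset in which smoothing at a small scale takes place.\<close>

lemma compact_cball_neighbourhood:
  assumes "compact K" "K \<subseteq> \<Omega>" "open \<Omega>"
  obtains e where "e > 0" "\<And>r. r < e \<Longrightarrow> (\<Union>x\<in>K. cball x r) \<subseteq> \<Omega>" "\<And>r. compact (\<Union>x\<in>K. cball x (r::real) :: (real^2) set)"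
proof -
  obtain e where e: "e > 0" "(\<Union>x\<in>K. ball x e) \<subseteq> \<Omega>"
    by (rule compact_subset_open_imp_ball_epsilon_subset[OF assms(1,3,2)])
  have "(\<Union>x\<in>K. cball x r) \<subseteq> \<Omega>" if "r < e" for r
    using e(2) cball_subset_ball_iff[of _ r _ e] that by (fastforce simp: subset_iff)
  then show ?thesis using that e(1) compact_minkowski_sum_cball[OF assms(1)] by blast
qed

lemma smoothing_mollifier_as_L2_inner:
  assumes "open \<Omega>" "A \<subseteq> \<Omega>" "cball x r \<subseteq> A" "\<And>y. norm y > r \<Longrightarrow> \<kappa> y = 0"
  shows "smoothing (\<lambda>y. indicator A y * f y) \<kappa> x = L2_inner \<Omega> f (\<lambda>y. \<kappa> (x - y))"
proof (subst L2_inner_vanishing_outside[OF assms(1,2)])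
  show "\<kappa> (x - y) = 0" if "y \<notin> A" for y
    using assms(3) that by (intro assms(4)) (force simp: dist_norm not_le[symmetric])
qed (simp add: smoothing_def)

lemma test_function_reflected_mollifier:
  assumes "r > 0" "cball x r \<subseteq> \<Omega>"
  shows "test_function \<Omega> (\<lambda>y. mollifier r (x - y))"
    and "partial_deriv i (\<lambda>y. mollifier r (x - y)) y = - partial_deriv i (mollifier r) (x - y)"
proof -
  note m = compact_Ck_mollifier[OF assms(1)]
  have "Ck_on k UNIV (\<lambda>y. mollifier r (x - y))" for k
    using Ck_on_affine[of k "mollifier r" x "-1"] m[of k] by (simp add: compact_Ck_def)
  then have "compact_Ck k \<Omega> (\<lambda>y. mollifier r (x - y))" for k
  proof (rule compact_CkI[OF _ compact_cball assms(2)])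
    show "mollifier r (x - y) = 0" if "y \<notin> cball x r" for y
      using that by (intro mollifier_zero assms) (simp add: dist_norm)
  qed
  then show "test_function \<Omega> (\<lambda>y. mollifier r (x - y))" by (simp add: test_function_iff)
  show "partial_deriv i (\<lambda>y. mollifier r (x - y)) y = - partial_deriv i (mollifier r) (x - y)"
    using partial_deriv_affine[of "mollifier r" i x "-1" y] m[of "Suc 0"] by (simp add: compact_Ck_def)
qed

lemma partial_deriv_mollifier_zero:
  assumes "r > 0" "norm y > r" shows "partial_deriv i (mollifier r) y = 0"
proof -
  have "closure {x. mollifier r x \<noteq> 0} \<subseteq> cball 0 r"
    by (intro closure_minimal) (use mollifier_zero[OF assms(1)] in \<open>force simp: not_le[symmetric]\<close>)+
  then have "y \<notin> closure {x. mollifier r x \<noteq> 0}" using assms by auto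
  from gradient_zero_outside[OF this] show ?thesis by (simp add: partial_deriv_eq_gradient)
qed

text \<open>At points whose \<open>r\<close>-ball lies in \<open>A\<close> the reflected mollifier is a test function, so the derivative
  that falls on the kernel may be moved to \<open>f\<close>.\<close>

lemma smoothing_weak_partial:
  assumes w: "has_weak_partial \<Omega> i f g" and "open \<Omega>" "A \<subseteq> \<Omega>" "cball x r \<subseteq> A" "r > 0"
    and int: "integrable lebesgue (\<lambda>x. indicator A x * f x)"
  shows "partial_deriv i (smoothing (\<lambda>x. indicator A x * f x) (mollifier r)) x
    = smoothing (\<lambda>x. indicator A x * g x) (mollifier r) x"
proof -
  have sub: "cball x r \<subseteq> \<Omega>" using assms by blast
  note t = test_function_reflected_mollifier[OF \<open>r > 0\<close> sub]
  have "partial_deriv i (smoothing (\<lambda>x. indicator A x * f x) (mollifier r)) x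
      = smoothing (\<lambda>x. indicator A x * f x) (partial_deriv i (mollifier r)) x"
    using partial_deriv_smoothing[OF int compact_Ck_mollifier[OF \<open>r > 0\<close>], of i] by simp
  also have "\<dots> = L2_inner \<Omega> f (\<lambda>y. partial_deriv i (mollifier r) (x - y))"
    by (rule smoothing_mollifier_as_L2_inner[OF assms(2-4) partial_deriv_mollifier_zero[OF \<open>r > 0\<close>]])
  also have "\<dots> = L2_inner \<Omega> f (\<lambda>y. - partial_deriv i (\<lambda>y. mollifier r (x - y)) y)"
    by (simp add: t(2))
  also have "\<dots> = - L2_inner \<Omega> f (partial_deriv i (\<lambda>y. mollifier r (x - y)))"
    by (simp add: L2_inner_def)
  also have "\<dots> = L2_inner \<Omega> g (\<lambda>y. mollifier r (x - y))"
    using w t(1) by (simp add: has_weak_partial_def)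
  also have "\<dots> = smoothing (\<lambda>x. indicator A x * g x) (mollifier r) x"
    by (rule smoothing_mollifier_as_L2_inner[OF assms(2-4), symmetric]) (simp add: mollifier_zero \<open>r > 0\<close>)
  finally show ?thesis .
qed

text \<open>Near a compact set the smoothed function is an integral against test functions, hence \<open>0\<close>, and it
  converges to \<open>f\<close> in the mean.\<close>

lemma fundamental_lemma_calculus_of_variations:
  assumes "open \<Omega>" and f: "locally_integrable \<Omega> f"
    and zero: "\<And>\<phi>. test_function \<Omega> \<phi> \<Longrightarrow> L2_inner \<Omega> f \<phi> = 0"
  shows "AE x in lebesgue_on \<Omega>. f x = 0"
proof -
  have compact: "AE x in lebesgue. x \<in> K \<longrightarrow> f x = 0" if K: "compact K" "K \<subseteq> \<Omega>" for K
  proof -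
    obtain e where e: "e > 0" "\<And>r. r < e \<Longrightarrow> (\<Union>x\<in>K. cball x r) \<subseteq> \<Omega>"
      "\<And>r. compact (\<Union>x\<in>K. cball x (r::real) :: (real^2) set)"
      using compact_cball_neighbourhood[OF K assms(1)] by blast
    define A where "A = (\<Union>x\<in>K. cball x (e / 2))"
    define F where "F = (\<lambda>x. indicator A x * f x)"
    have A: "compact A" "A \<subseteq> \<Omega>" using e(2)[of "e/2"] e(1,3) by (auto simp: A_def)
    have F: "integrable lebesgue F" using f A by (auto simp: F_def locally_integrable_iff)
    have Kl: "K \<in> sets lebesgue" using K(1) by (simp add: compact_imp_closed borel_closed)
    have FK: "integrable lebesgue (\<lambda>x. indicator K x * F x)"
      using integrable_mult_indicator[OF Kl F] by simp
    have "integral\<^sup>L lebesgue (\<lambda>x. \<bar>indicator K x * F x\<bar>) \<le> d" if "d > 0" for d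
    proof -
      obtain s where s: "s > 0" "\<And>r. 0 < r \<Longrightarrow> r < s \<Longrightarrow>
          integral\<^sup>L lebesgue (\<lambda>x. \<bar>smoothing F (mollifier r) x - F x\<bar>) \<le> d"
        using smoothing_L1(2)[OF F \<open>d > 0\<close>] by blast
      define r where "r = min s e / 2"
      have r: "0 < r" "r < s" "r \<le> e / 2" using s(1) e(1) by (auto simp: r_def)
      have "smoothing F (mollifier r) x = 0" if "x \<in> K" for x
      proof -
        have sub: "cball x r \<subseteq> A" using that r by (force simp: A_def)
        have "smoothing F (mollifier r) x = L2_inner \<Omega> f (\<lambda>y. mollifier r (x - y))"
          unfolding F_def by (rule smoothing_mollifier_as_L2_inner[OF assms(1) A(2) sub]) (simp add: mollifier_zero r)
        also have "\<dots> = 0"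
          using zero[OF test_function_reflected_mollifier(1)[OF r(1)]] sub A(2) by blast
        finally show ?thesis .
      qed
      then have "\<bar>indicator K x * F x\<bar> \<le> \<bar>smoothing F (mollifier r) x - F x\<bar>" for x
        by (auto simp: indicator_def)
      then have "integral\<^sup>L lebesgue (\<lambda>x. \<bar>indicator K x * F x\<bar>)
          \<le> integral\<^sup>L lebesgue (\<lambda>x. \<bar>smoothing F (mollifier r) x - F x\<bar>)"
        using smoothing_L1(1)[OF F r(1)] FK by (intro integral_mono) auto
      with s(2)[OF r(1,2)] show ?thesis by linarith
    qed
    then have "integral\<^sup>L lebesgue (\<lambda>x. \<bar>indicator K x * F x\<bar>) \<le> 0"
      by (meson dense_ge)
    then have "integral\<^sup>L lebesgue (\<lambda>x. \<bar>indicator K x * F x\<bar>) = 0"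
      by (simp add: order_antisym)
    then have "AE x in lebesgue. \<bar>indicator K x * F x\<bar> = 0"
      using FK by (subst integral_nonneg_eq_0_iff_AE[symmetric]) auto
    then show ?thesis
    proof eventually_elim
      case (elim x)
      have "x \<in> A" if "x \<in> K" using that e(1) by (auto simp: A_def intro!: bexI[of _ x])
      with elim show ?case by (auto simp: F_def indicator_def split: if_splits)
    qed
  qed
  obtain C where C: "\<And>n::nat. compact (C n)" "\<And>n. C n \<subseteq> \<Omega>" "\<Union>(range C) = \<Omega>"
    using open_Union_compact_subsets[OF assms(1)] by metis
  have "AE x in lebesgue. \<forall>n. x \<in> C n \<longrightarrow> f x = 0"
    unfolding AE_all_countable using compact[OF C(1,2)] by blast
  then have "AE x in lebesgue. x \<in> \<Omega> \<longrightarrow> f x = 0"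
    by eventually_elim (use C(3) in blast)
  then show ?thesis by (simp add: AE_lebesgue_on_iff[OF assms(1)])
qed

lemma locally_integrable_add:
  "locally_integrable \<Omega> f \<Longrightarrow> locally_integrable \<Omega> g \<Longrightarrow> locally_integrable \<Omega> (\<lambda>x. f x + g x)"
  by (simp add: locally_integrable_iff distrib_left)

lemma locally_integrable_scale: "locally_integrable \<Omega> f \<Longrightarrow> locally_integrable \<Omega> (\<lambda>x. c * f x)"
  by (simp add: locally_integrable_iff mult.left_commute)

lemma integrable_mult_compact_Ck:
  assumes "open \<Omega>" "locally_integrable \<Omega> f" "compact_Ck k \<Omega> h"
  shows "integrable (lebesgue_on \<Omega>) (\<lambda>x. f x * h x)"
proof -
  let ?K = "closure {x. h x \<noteq> 0}"
  have K: "compact ?K" "?K \<subseteq> \<Omega>" using assms(3) unfolding compact_Ck_def by blast+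
  obtain B where B: "\<And>x. norm (h x) \<le> B"
    using compact_support_bounded[OF compact_Ck_continuous[OF assms(3)] K(1) compact_Ck_zero[OF assms(3)]] by blast
  have "integrable lebesgue (\<lambda>x. indicator ?K x * f x)"
    using assms(2) K unfolding locally_integrable_iff by blast
  then have "integrable lebesgue (\<lambda>x. (indicator ?K x * f x) * h x)"
    by (rule integrable_mult_bounded[OF _ continuous_lebesgue_measurable[OF compact_Ck_continuous[OF assms(3)]]])
      (use B in auto)
  moreover have "indicator \<Omega> x * (f x * h x) = (indicator ?K x * f x) * h x" for x
  proof (cases "x \<in> ?K")
    case True
    then have "x \<in> \<Omega>" using K(2) by blast
    with True show ?thesis by simp
  next
    case False
    from compact_Ck_zero[OF assms(3) this] show ?thesis by simp
  qed
  ultimately show ?thesis unfolding lebesgue_on_integrable_iff[OF assms(1)] by presburger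
qed

lemma L2_inner_add_compact_Ck:
  assumes "open \<Omega>" "locally_integrable \<Omega> f" "locally_integrable \<Omega> g" "compact_Ck k \<Omega> h"
  shows "L2_inner \<Omega> (\<lambda>x. f x + c * g x) h = L2_inner \<Omega> f h + c * L2_inner \<Omega> g h"
  using integrable_mult_compact_Ck[OF assms(1,2,4)] integrable_mult_compact_Ck[OF assms(1,3,4)]
  by (simp add: L2_inner_real distrib_right mult.assoc)

lemma test_function_partial_deriv: "test_function \<Omega> \<phi> \<Longrightarrow> compact_Ck k \<Omega> (partial_deriv i \<phi>)"
  by (simp add: test_function_iff compact_Ck_partial_deriv)

lemma has_weak_partial_add:
  assumes "open \<Omega>" "has_weak_partial \<Omega> i f f'" "has_weak_partial \<Omega> i g g'"
  shows "has_weak_partial \<Omega> i (\<lambda>x. f x + c * g x) (\<lambda>x. f' x + c * g' x)"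
proof -
  have li: "locally_integrable \<Omega> f" "locally_integrable \<Omega> g" "locally_integrable \<Omega> f'" "locally_integrable \<Omega> g'"
    using assms by (auto simp: has_weak_partial_def)
  show ?thesis
    unfolding has_weak_partial_def
  proof (intro conjI allI impI locally_integrable_add locally_integrable_scale li)
    fix \<phi> assume t: "test_function \<Omega> \<phi>"
    have c: "compact_Ck 0 \<Omega> \<phi>" using t by (simp add: test_function_iff)
    show "L2_inner \<Omega> (\<lambda>x. f x + c * g x) (partial_deriv i \<phi>) = - L2_inner \<Omega> (\<lambda>x. f' x + c * g' x) \<phi>"
      unfolding L2_inner_add_compact_Ck[OF assms(1) li(1,2) test_function_partial_deriv[OF t, of 0]]
        L2_inner_add_compact_Ck[OF assms(1) li(3,4) c]
      using assms t by (simp add: has_weak_partial_def)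
  qed
qed

lemma has_weak_partial_unique:
  assumes "open \<Omega>" "has_weak_partial \<Omega> i f g" "has_weak_partial \<Omega> i f h"
  shows "AE x in lebesgue_on \<Omega>. g x = h x"
proof -
  have li: "locally_integrable \<Omega> g" "locally_integrable \<Omega> h" using assms by (auto simp: has_weak_partial_def)
  have "AE x in lebesgue_on \<Omega>. g x + (-1) * h x = 0"
  proof (rule fundamental_lemma_calculus_of_variations[OF assms(1)])
    show "locally_integrable \<Omega> (\<lambda>x. g x + (-1) * h x)"
      by (intro locally_integrable_add locally_integrable_scale li)
    fix \<phi> assume t: "test_function \<Omega> \<phi>"
    then have "L2_inner \<Omega> (\<lambda>x. g x + (-1) * h x) \<phi> = L2_inner \<Omega> g \<phi> + (-1) * L2_inner \<Omega> h \<phi>"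
      by (intro L2_inner_add_compact_Ck[OF assms(1) li, where k=0]) (simp add: test_function_iff)
    then show "L2_inner \<Omega> (\<lambda>x. g x + (-1) * h x) \<phi> = 0"
      using assms t by (simp add: has_weak_partial_def)
  qed
  then show ?thesis by eventually_elim simp
qed

lemma weak_partial_AE_eq:
  assumes "open \<Omega>" "has_weak_partial \<Omega> i f g"
  shows "has_weak_partial \<Omega> i f (weak_partial \<Omega> i f)" "AE x in lebesgue_on \<Omega>. weak_partial \<Omega> i f x = g x"
proof -
  show w: "has_weak_partial \<Omega> i f (weak_partial \<Omega> i f)"
    unfolding weak_partial_def by (rule someI[of "has_weak_partial \<Omega> i f", OF assms(2)])
  show "AE x in lebesgue_on \<Omega>. weak_partial \<Omega> i f x = g x"
    by (rule has_weak_partial_unique[OF assms(1) w assms(2)])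
qed

text \<open>Smoothing turns a \<open>C\<^sup>1\<close> function into test functions and commutes with differentiation; the smoothed
  function and its derivative converge uniformly.\<close>

lemma has_weak_partial_compact_C1:
  assumes "open \<Omega>" and w: "has_weak_partial \<Omega> i f g" and h: "compact_Ck (Suc 0) \<Omega> h"
  shows "L2_inner \<Omega> f (partial_deriv i h) = - L2_inner \<Omega> g h"
proof -
  let ?K = "closure {x. h x \<noteq> 0}"
  have K: "compact ?K" "?K \<subseteq> \<Omega>" using h unfolding compact_Ck_def by blast+
  obtain e where e: "e > 0" "\<And>r. r < e \<Longrightarrow> (\<Union>x\<in>?K. cball x r) \<subseteq> \<Omega>"
    "\<And>r. compact (\<Union>x\<in>?K. cball x (r::real) :: (real^2) set)"
    using compact_cball_neighbourhood[OF K assms(1)] by blast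
  define A where "A = (\<Union>x\<in>?K. cball x (e / 2))"
  have A: "compact A" "A \<subseteq> \<Omega>" using e(2)[of "e/2"] e(1,3) by (auto simp: A_def)
  have KA: "?K \<subseteq> A" using e(1) by (force simp: A_def)
  have li: "locally_integrable \<Omega> f" "locally_integrable \<Omega> g" using w by (auto simp: has_weak_partial_def)
  have iA: "integrable lebesgue (\<lambda>x. indicator A x * f x)" "integrable lebesgue (\<lambda>x. indicator A x * g x)"
    using li A by (auto simp: locally_integrable_iff)
  have hL: "integrable lebesgue h" "h \<in> borel_measurable lborel"
    using compact_Ck_integrable[OF h] by (auto simp: integrable_completion dest: borel_measurable_integrable)
  note dh = compact_Ck_partial_deriv[OF h, of i]
  define M where "M = integral\<^sup>L lebesgue (\<lambda>x. \<bar>indicator A x * f x\<bar>) + integral\<^sup>L lebesgue (\<lambda>x. \<bar>indicator A x * g x\<bar>)"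
  have close: "\<bar>L2_inner \<Omega> F k - L2_inner \<Omega> F k'\<bar> \<le> integral\<^sup>L lebesgue (\<lambda>x. \<bar>indicator A x * F x\<bar>) * d"
    if F: "locally_integrable \<Omega> F" and k: "continuous_on UNIV k" "continuous_on UNIV k'"
      and z: "\<And>x. x \<notin> A \<Longrightarrow> k x = 0" "\<And>x. x \<notin> A \<Longrightarrow> k' x = 0" and d: "\<And>x. \<bar>k x - k' x\<bar> \<le> d"
    for F k k' d
  proof -
    have iF: "integrable lebesgue (\<lambda>x. indicator A x * F x)" using F A by (auto simp: locally_integrable_iff)
    obtain B B' where B: "\<And>x. norm (k x) \<le> B" "\<And>x. norm (k' x) \<le> B'"
      using compact_support_bounded[OF k(1) A(1) z(1)] compact_support_bounded[OF k(2) A(1) z(2)] by blast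
    have i: "integrable lebesgue (\<lambda>x. (indicator A x * F x) * k x)" "integrable lebesgue (\<lambda>x. (indicator A x * F x) * k' x)"
      using integrable_mult_bounded[OF iF continuous_lebesgue_measurable[OF k(1)], of B]
        integrable_mult_bounded[OF iF continuous_lebesgue_measurable[OF k(2)], of B'] B by auto
    have "L2_inner \<Omega> F k - L2_inner \<Omega> F k' = integral\<^sup>L lebesgue (\<lambda>x. (indicator A x * F x) * k x - (indicator A x * F x) * k' x)"
      using i by (simp add: L2_inner_vanishing_outside[OF assms(1) A(2) z(1)] L2_inner_vanishing_outside[OF assms(1) A(2) z(2)])
    also have "\<bar>\<dots>\<bar> \<le> integral\<^sup>L lebesgue (\<lambda>x. \<bar>indicator A x * F x\<bar> * d)"
    proof (rule integral_abs_bound_integral)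
      fix x show "\<bar>(indicator A x * F x) * k x - (indicator A x * F x) * k' x\<bar> \<le> \<bar>indicator A x * F x\<bar> * d"
        unfolding right_diff_distrib[symmetric] abs_mult by (intro mult_left_mono d) auto
    qed (use i iF in auto)
    finally show ?thesis by simp
  qed
  have "\<bar>L2_inner \<Omega> f (partial_deriv i h) + L2_inner \<Omega> g h\<bar> \<le> d" if d: "d > 0" for d
  proof -
    define d' where "d' = d / (M + 1)"
    have M: "M \<ge> 0" by (simp add: M_def)
    have d': "d' > 0" using d M by (simp add: d'_def)
    obtain s1 where s1: "s1 > 0" "\<And>r x. 0 < r \<Longrightarrow> r < s1 \<Longrightarrow> \<bar>smoothing h (mollifier r) x - h x\<bar> \<le> d'"
      using smoothing_uniform[OF h d'] by blast
    obtain s2 where s2: "s2 > 0" "\<And>r x. 0 < r \<Longrightarrow> r < s2 \<Longrightarrow> \<bar>smoothing (partial_deriv i h) (mollifier r) x - partial_deriv i h x\<bar> \<le> d'"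
      using smoothing_uniform[OF dh d'] by blast
    define r where "r = min (min s1 s2) e / 2"
    have r: "0 < r" "r < s1" "r < s2" "r \<le> e / 2" using s1(1) s2(1) e(1) by (auto simp: r_def)
    let ?m = "mollifier r"
    let ?hr = "smoothing h ?m"
    have zero: "smoothing k ?m x = 0" if x: "x \<notin> A" and k: "\<And>y. y \<notin> ?K \<Longrightarrow> k y = 0" for k x
    proof -
      have z0: "k y * ?m (x - y) = 0" for y
      proof (cases "y \<in> ?K")
        case True
        then have "x \<notin> cball y (e / 2)" using x by (auto simp: A_def)
        then have "norm (x - y) \<ge> r" using r by (simp add: dist_norm norm_minus_commute)
        then show ?thesis using mollifier_zero[OF r(1)] by simp
      qed (simp add: k)
      show ?thesis by (simp only: smoothing_def z0 Bochner_Integration.integral_zero)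
    qed
    have t: "test_function \<Omega> ?hr"
      unfolding test_function_iff
      by (intro allI compact_CkI[OF _ A] Ck_on_smoothing[OF hL(1) compact_Ck_mollifier[OF r(1)]] zero)
        (assumption, rule compact_Ck_zero[OF h], assumption)
    have pd: "partial_deriv i ?hr x = smoothing (partial_deriv i h) ?m x" for x
    proof -
      note tm = test_function_reflected_mollifier[OF r(1), of x UNIV]
      have refl: "(\<lambda>y. k (x - y)) \<in> borel_measurable lborel" if "continuous_on UNIV k" for k :: "real^2 \<Rightarrow> real"
      proof -
        have "continuous_on UNIV (\<lambda>y. k (x - y))"
          by (rule continuous_on_compose2[OF that]) (auto intro: continuous_intros)
        then show ?thesis by (simp add: borel_measurable_continuous_onI)
      qed
      have mb: "(\<lambda>y. partial_deriv i ?m (x - y)) \<in> borel_measurable lborel" "(\<lambda>y. ?m (x - y)) \<in> borel_measurable lborel"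
        by (rule refl[OF compact_Ck_continuous[OF compact_Ck_partial_deriv[OF compact_Ck_mollifier[OF r(1)]]]])
          (rule refl[OF compact_Ck_continuous[OF compact_Ck_mollifier[OF r(1), of 0]]])
      have mh: "partial_deriv i h \<in> borel_measurable lborel"
        using compact_Ck_continuous[OF dh] by (simp add: borel_measurable_continuous_onI)
      have "partial_deriv i ?hr x = smoothing h (partial_deriv i ?m) x"
        using partial_deriv_smoothing[OF hL(1) compact_Ck_mollifier[OF r(1)], of i] by simp
      also have "\<dots> = integral\<^sup>L lborel (\<lambda>y. h y * partial_deriv i ?m (x - y))"
        unfolding smoothing_def by (rule integral_completion) (use hL mb in auto)
      also have "\<dots> = - integral\<^sup>L lborel (\<lambda>y. h y * partial_deriv i (\<lambda>y. ?m (x - y)) y)"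
        by (simp add: tm(2))
      also have "\<dots> = integral\<^sup>L lborel (\<lambda>y. partial_deriv i h y * ?m (x - y))"
        using integration_by_parts_compact[OF h, of "\<lambda>y. ?m (x - y)" i] tm(1)
        by (simp add: test_function_iff compact_Ck_def del: Ck_on.simps)
      also have "\<dots> = smoothing (partial_deriv i h) ?m x"
        unfolding smoothing_def by (rule integral_completion[symmetric]) (use mb mh in auto)
      finally show ?thesis .
    qed
    have zh: "h x = 0" "partial_deriv i h x = 0" if "x \<notin> A" for x
    proof -
      have "x \<notin> ?K" using that KA by blast
      then show "h x = 0" "partial_deriv i h x = 0"
        using compact_Ck_zero[OF h, of x] gradient_zero_outside[of x h] by (simp_all add: partial_deriv_eq_gradient)
    qed
    have zr: "?hr x = 0" "partial_deriv i ?hr x = 0" if "x \<notin> A" for x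
    proof -
      show "?hr x = 0" by (rule zero[OF that compact_Ck_zero[OF h]])
      have "partial_deriv i h y = 0" if "y \<notin> ?K" for y
        using gradient_zero_outside[OF that] by (simp add: partial_deriv_eq_gradient)
      then show "partial_deriv i ?hr x = 0" unfolding pd by (rule zero[OF that])
    qed
    have tc: "continuous_on UNIV ?hr" "continuous_on UNIV (partial_deriv i ?hr)"
      using t test_function_partial_deriv[OF t] by (auto simp: test_function_iff intro: compact_Ck_continuous)
    have "\<bar>L2_inner \<Omega> g ?hr - L2_inner \<Omega> g h\<bar> \<le> integral\<^sup>L lebesgue (\<lambda>x. \<bar>indicator A x * g x\<bar>) * d'"
      by (rule close[OF li(2) tc(1) compact_Ck_continuous[OF h] zr(1) zh(1) s1(2)[OF r(1,2)]])
    moreover have "\<bar>L2_inner \<Omega> f (partial_deriv i ?hr) - L2_inner \<Omega> f (partial_deriv i h)\<bar>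
        \<le> integral\<^sup>L lebesgue (\<lambda>x. \<bar>indicator A x * f x\<bar>) * d'"
      by (rule close[OF li(1) tc(2) compact_Ck_continuous[OF dh] zr(2) zh(2)])
        (use s2(2)[OF r(1,3)] in \<open>simp_all add: pd\<close>)
    moreover have "L2_inner \<Omega> f (partial_deriv i ?hr) = - L2_inner \<Omega> g ?hr"
      using w t by (simp add: has_weak_partial_def)
    ultimately have "\<bar>L2_inner \<Omega> f (partial_deriv i h) + L2_inner \<Omega> g h\<bar> \<le> M * d'"
      unfolding M_def distrib_right by linarith
    also have "\<dots> \<le> (M + 1) * d'" using d' by simp
    also have "\<dots> = d" using M by (simp add: d'_def)
    finally show ?thesis .
  qed
  then have "\<bar>L2_inner \<Omega> f (partial_deriv i h) + L2_inner \<Omega> g h\<bar> \<le> 0" by (meson dense_ge)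
  then show ?thesis by simp
qed

lemma L2_inner_compact_Ck:
  assumes "open \<Omega>" "continuous_on UNIV k" "compact_Ck n \<Omega> \<phi>"
  shows "L2_inner \<Omega> k \<phi> = integral\<^sup>L lborel (\<lambda>x. k x * \<phi> x)"
proof -
  let ?K = "closure {x. \<phi> x \<noteq> 0}"
  have K: "?K \<subseteq> \<Omega>" using assms(3) unfolding compact_Ck_def by blast
  have "L2_inner \<Omega> k \<phi> = integral\<^sup>L lebesgue (\<lambda>x. (indicator ?K x * k x) * \<phi> x)"
    by (rule L2_inner_vanishing_outside[OF assms(1) K compact_Ck_zero[OF assms(3)]])
  also have "\<dots> = integral\<^sup>L lebesgue (\<lambda>x. k x * \<phi> x)"
  proof (rule Bochner_Integration.integral_cong[OF refl])
    fix x show "(indicator ?K x * k x) * \<phi> x = k x * \<phi> x"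
      using compact_Ck_zero[OF assms(3), of x] by (cases "x \<in> ?K") simp_all
  qed
  also have "\<dots> = integral\<^sup>L lborel (\<lambda>x. k x * \<phi> x)"
    by (rule integral_completion)
      (use continuous_on_mult[OF assms(2) compact_Ck_continuous[OF assms(3)]]
        in \<open>simp add: borel_measurable_continuous_onI\<close>)
  finally show ?thesis .
qed

lemma has_weak_partial_C1:
  assumes "open \<Omega>" "Ck_on (Suc 0) UNIV f"
  shows "has_weak_partial \<Omega> i f (partial_deriv i f)"
proof -
  have li: "locally_integrable \<Omega> k" if "continuous_on UNIV k" for k
    unfolding locally_integrable_iff
  proof (intro allI impI)
    fix K assume K: "compact K \<and> K \<subseteq> \<Omega>"
    have "integrable lborel (\<lambda>x. indicator K x *\<^sub>R k x)"
      by (rule borel_integrable_compact) (use K that continuous_on_subset in auto)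
    then show "integrable lebesgue (\<lambda>x. indicator K x * k x)"
      by (subst integrable_completion) (auto dest: borel_measurable_integrable)
  qed
  have c: "continuous_on UNIV f" "continuous_on UNIV (partial_deriv i f)"
    using Ck_on_continuous[OF assms(2)] assms(2) by auto
  show ?thesis unfolding has_weak_partial_def
  proof (intro conjI allI impI li c)
    fix \<phi> assume t: "test_function \<Omega> \<phi>"
    have t1: "compact_Ck (Suc 0) \<Omega> \<phi>" using t by (simp add: test_function_iff)
    show "L2_inner \<Omega> f (partial_deriv i \<phi>) = - L2_inner \<Omega> (partial_deriv i f) \<phi>"
      unfolding L2_inner_compact_Ck[OF assms(1) c(1) test_function_partial_deriv[OF t, of 0]]
        L2_inner_compact_Ck[OF assms(1) c(2) t1]
      using integration_by_parts_compact[OF t1 assms(2), of i] by (simp add: mult.commute)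
  qed
qed

section \<open>Normals, strips and boundary cutoffs\<close>

lemma Ck1_compose:
  assumes "Ck_on (Suc 0) S f" "\<And>t. (g has_real_derivative g' t) (at t)" "continuous_on UNIV g'"
  shows "Ck_on (Suc 0) S (\<lambda>x. g (f x))"
    and "x \<in> S \<Longrightarrow> gradient (\<lambda>x. g (f x)) x = g' (f x) *\<^sub>R gradient f x"
proof -
  have D: "((\<lambda>x. g (f x)) has_derivative (\<lambda>v. (g' (f x) *\<^sub>R gradient f x) \<bullet> v)) (at x)" if "x \<in> S" for x
    using has_derivative_compose[OF Ck_on_has_derivative[OF assms(1) that]
        assms(2)[of "f x", unfolded has_field_derivative_def]] by (simp add: mult.commute)
  show "Ck_on (Suc 0) S (\<lambda>x. g (f x))"
    by (rule Ck1_I[OF D]) (auto intro!: continuous_intros continuous_on_compose2[OF assms(3)]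
        Ck_on_continuous[OF assms(1)] Ck_on_continuous_gradient[OF assms(1)])
  show "gradient (\<lambda>x. g (f x)) x = g' (f x) *\<^sub>R gradient f x" if "x \<in> S"
    by (rule gradient_eqI[OF D[OF that]])
qed

lemma gradient_mult:
  assumes "Ck_on (Suc 0) S f" "Ck_on (Suc 0) S g" "x \<in> S"
  shows "gradient (\<lambda>x. f x * g x) x = f x *\<^sub>R gradient g x + g x *\<^sub>R gradient f x"
  using partial_deriv_mult[OF assms] by (simp add: vec_eq_iff gradient_def mult.commute)

lemma gradient_cong_open:
  assumes "open S" "x \<in> S" "\<And>y. y \<in> S \<Longrightarrow> f y = g y"
  shows "gradient f x = gradient g x"
  unfolding gradient_def by (simp add: partial_deriv_cong_open(1)[OF assms])

text \<open>The square makes the kink at \<open>0\<close> continuously differentiable.\<close>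

definition ramp :: "real \<Rightarrow> real" where
  "ramp t = (max 0 t)\<^sup>2"

lemma ramp_derivative: "(ramp has_real_derivative 2 * max 0 t) (at t)"
proof -
  consider "t > 0" | "t < 0" | "t = 0" by linarith
  then show ?thesis
  proof cases
    case 1
    have "((\<lambda>t. t\<^sup>2) has_real_derivative 2 * max 0 t) (at t)"
      using 1 by (auto intro!: derivative_eq_intros)
    then show ?thesis
      by (rule has_field_derivative_transform_within_open[where S="{0<..}"]) (use 1 in \<open>auto simp: ramp_def\<close>)
  next
    case 2
    have "((\<lambda>t. 0) has_real_derivative 2 * max 0 t) (at t)" using 2 by simp
    then show ?thesis
      by (rule has_field_derivative_transform_within_open[where S="{..<0}"]) (use 2 in \<open>auto simp: ramp_def\<close>)
  next
    case 3
    have "((\<lambda>h. (ramp (0 + h) - ramp 0) / h) \<longlongrightarrow> 0) (at 0)"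
    proof (rule Lim_null_comparison)
      have "norm ((ramp (0 + h) - ramp 0) / h) \<le> \<bar>h\<bar>" for h
        by (cases "h > 0") (auto simp: ramp_def power2_eq_square max_def)
      then show "\<forall>\<^sub>F h in at 0. norm ((ramp (0 + h) - ramp 0) / h) \<le> \<bar>h\<bar>" by simp
      show "((\<lambda>h. \<bar>h\<bar>) \<longlongrightarrow> (0::real)) (at 0)" by (auto intro!: tendsto_eq_intros)
    qed
    then show ?thesis by (simp add: 3 DERIV_def)
  qed
qed

text \<open>A continuously differentiable transition from \<open>0\<close> on the negative axis to \<open>1\<close> beyond \<open>1\<close>, obtained by
  composing two ramps.\<close>

definition soft_step :: "real \<Rightarrow> real" where
  "soft_step t = 1 - ramp (1 - ramp t)"

definition soft_step_deriv :: "real \<Rightarrow> real" where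
  "soft_step_deriv t = 2 * max 0 (1 - ramp t) * (2 * max 0 t)"

lemma soft_step_has_derivative: "(soft_step has_real_derivative soft_step_deriv t) (at t)"
proof -
  have "((\<lambda>t. 1 - ramp (1 - ramp t)) has_real_derivative 0 - (2 * max 0 (1 - ramp t)) * (0 - 2 * max 0 t)) (at t)"
    by (intro DERIV_diff DERIV_const DERIV_chain2[OF ramp_derivative] ramp_derivative)
  then show ?thesis by (simp add: soft_step_def[abs_def] soft_step_deriv_def)
qed

lemma soft_step_bounds: "0 \<le> soft_step t" "soft_step t \<le> 1" "t \<le> 0 \<Longrightarrow> soft_step t = 0" "t \<ge> 1 \<Longrightarrow> soft_step t = 1"
proof -
  have r: "0 \<le> ramp t" for t by (simp add: ramp_def)
  have "ramp s \<le> 1" if "s \<le> 1" for s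
    using that power_le_one[of "max 0 s" 2] by (simp add: ramp_def)
  then show "0 \<le> soft_step t" "soft_step t \<le> 1" using r by (simp_all add: soft_step_def)
  show "t \<le> 0 \<Longrightarrow> soft_step t = 0" by (simp add: soft_step_def ramp_def)
  show "t \<ge> 1 \<Longrightarrow> soft_step t = 1"
    using one_le_power[of t 2] by (simp add: soft_step_def ramp_def)
qed

lemma soft_step_deriv_bounds: "0 \<le> soft_step_deriv t" "soft_step_deriv t \<le> 4" "t \<le> 0 \<Longrightarrow> soft_step_deriv t = 0"
proof -
  show "0 \<le> soft_step_deriv t" by (simp add: soft_step_deriv_def)
  show "t \<le> 0 \<Longrightarrow> soft_step_deriv t = 0" by (simp add: soft_step_deriv_def)
  show "soft_step_deriv t \<le> 4"
  proof (cases "0 < t \<and> t < 1")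
    case True
    then have "max 0 (1 - ramp t) * max 0 t \<le> 1 * 1"
      by (intro mult_mono) (auto simp: ramp_def)
    then show ?thesis by (simp add: soft_step_deriv_def)
  next
    case False
    then have "t \<le> 0 \<or> ramp t \<ge> 1" using one_le_power[of t 2] by (auto simp: ramp_def)
    then show ?thesis by (auto simp: soft_step_deriv_def)
  qed
qed

lemma continuous_soft_step_deriv: "continuous_on UNIV soft_step_deriv"
  unfolding soft_step_deriv_def[abs_def] ramp_def by (intro continuous_intros)

lemma directional_derivative_limit:
  fixes f :: "'a::real_normed_vector \<Rightarrow> real"
  assumes "(f has_derivative D) (at x)"
  shows "((\<lambda>t. (f (x + t *\<^sub>R v) - f x) / t) \<longlongrightarrow> D v) (at_right 0)"
proof -
  have 1: "((\<lambda>t. x + t *\<^sub>R v) has_derivative (\<lambda>t. t *\<^sub>R v)) (at 0)"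
    by (auto intro!: derivative_eq_intros)
  have "((\<lambda>t. f (x + t *\<^sub>R v)) has_derivative (\<lambda>t. D (t *\<^sub>R v))) (at 0)"
    using has_derivative_compose[OF 1, of f D] assms by simp
  then have "((\<lambda>t. f (x + t *\<^sub>R v)) has_real_derivative D v) (at 0)"
    using linear_scale[OF has_derivative_linear[OF assms]]
    by (simp add: has_field_derivative_def mult.commute[of _ "D v"])
  then have "((\<lambda>t. (f (x + t *\<^sub>R v) - f x) / t) \<longlongrightarrow> D v) (at 0)"
    by (simp add: DERIV_def)
  then show ?thesis by (rule filterlim_mono[OF _ order_refl at_le]) simp
qed

lemma local_defining_function_lower:
  assumes "local_defining_function (Suc k) \<Omega> x U \<rho>" "y \<in> U"
  shows "local_defining_function k \<Omega> y U \<rho>"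
  using assms Ck_on_lower[of k U \<rho>] unfolding local_defining_function_def by blast

lemma local_defining_function_zero:
  assumes "open \<Omega>" "x \<in> frontier \<Omega>" "local_defining_function k \<Omega> z U \<rho>" "x \<in> U"
  shows "\<rho> x = 0"
proof (rule ccontr)
  assume "\<rho> x \<noteq> 0"
  have U: "open U" "continuous_on U \<rho>" "\<And>y. y \<in> U \<Longrightarrow> y \<in> \<Omega> \<longleftrightarrow> \<rho> y < 0"
    using assms(3) Ck_on_continuous unfolding local_defining_function_def by blast+
  have "x \<notin> \<Omega>" using assms(1,2) by (simp add: frontier_def interior_open)
  then have pos: "\<rho> x > 0" using U(3)[OF assms(4)] \<open>\<rho> x \<noteq> 0\<close> by simp
  have "open (U \<inter> \<rho> -` {0<..})"
    by (rule continuous_open_preimage[OF U(2,1) open_greaterThan])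
  moreover have "x \<in> U \<inter> \<rho> -` {0<..}" using pos assms(4) by simp
  moreover have "x \<in> closure \<Omega>" using assms(2) by (simp add: frontier_def)
  ultimately have "(U \<inter> \<rho> -` {0<..}) \<inter> \<Omega> \<noteq> {}" using open_Int_closure_eq_empty by blast
  then show False using U(3) by fastforce
qed

text \<open>The normal is independent of the defining function. If two unit gradients \<open>a\<close> and \<open>b\<close> differed, then
  moving in the direction \<open>b - a\<close> would decrease the first defining function and increase the
  second, so the points reached would lie both inside and outside the domain.\<close>

lemma outward_normal_eq:
  assumes "open \<Omega>" "x \<in> frontier \<Omega>" and l: "local_defining_function (Suc 0) \<Omega> x U \<rho>"
  shows "outward_normal \<Omega> x = gradient \<rho> x /\<^sub>R norm (gradient \<rho> x)"
  unfolding outward_normal_def One_nat_def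
proof (rule the_equality)
  show "\<exists>U \<rho>'. local_defining_function (Suc 0) \<Omega> x U \<rho>' \<and>
      gradient \<rho> x /\<^sub>R norm (gradient \<rho> x) = gradient \<rho>' x /\<^sub>R norm (gradient \<rho>' x)"
    using l by blast
  fix \<eta> assume "\<exists>U \<rho>'. local_defining_function (Suc 0) \<Omega> x U \<rho>' \<and> \<eta> = gradient \<rho>' x /\<^sub>R norm (gradient \<rho>' x)"
  then obtain U' \<rho>' where l': "local_defining_function (Suc 0) \<Omega> x U' \<rho>'"
    and \<eta>: "\<eta> = gradient \<rho>' x /\<^sub>R norm (gradient \<rho>' x)" by blast
  have U: "open U" "x \<in> U" "Ck_on (Suc 0) U \<rho>" "gradient \<rho> x \<noteq> 0" "\<And>y. y \<in> U \<Longrightarrow> y \<in> \<Omega> \<longleftrightarrow> \<rho> y < 0"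
    using l unfolding local_defining_function_def by blast+
  have U': "open U'" "x \<in> U'" "Ck_on (Suc 0) U' \<rho>'" "gradient \<rho>' x \<noteq> 0" "\<And>y. y \<in> U' \<Longrightarrow> y \<in> \<Omega> \<longleftrightarrow> \<rho>' y < 0"
    using l' unfolding local_defining_function_def by blast+
  have z: "\<rho> x = 0" "\<rho>' x = 0"
    using local_defining_function_zero[OF assms(1,2) l U(2)] local_defining_function_zero[OF assms(1,2) l' U'(2)] by auto
  define a b where "a = gradient \<rho> x /\<^sub>R norm (gradient \<rho> x)" and "b = gradient \<rho>' x /\<^sub>R norm (gradient \<rho>' x)"
  have n: "norm a = 1" "norm b = 1" using U(4) U'(4) by (auto simp: a_def b_def)
  have "a = b"
  proof (rule ccontr)
    assume "a \<noteq> b"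
    then have ab: "a \<bullet> b < 1"
      using n norm_cauchy_schwarz[of a b] norm_cauchy_schwarz_eq[of a b] by force
    define v where "v = b - a"
    have "a \<bullet> v < 0" "b \<bullet> v > 0"
      using ab n by (auto simp: v_def inner_diff_right inner_commute power2_norm_eq_inner[symmetric])
    then have v: "gradient \<rho> x \<bullet> v < 0" "gradient \<rho>' x \<bullet> v > 0"
      using U(4) U'(4) by (auto simp: a_def b_def mult_less_0_iff zero_less_mult_iff divide_inverse)
    have "((\<lambda>t. x + t *\<^sub>R v) \<longlongrightarrow> x + 0 *\<^sub>R v) (at_right 0)" by (intro tendsto_intros)
    then have "\<forall>\<^sub>F t in at_right 0. x + t *\<^sub>R v \<in> U \<inter> U'"
      using U(1,2) U'(1,2) by (intro topological_tendstoD) auto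
    moreover have "\<forall>\<^sub>F t in at_right 0. (\<rho> (x + t *\<^sub>R v) - \<rho> x) / t < 0"
      using directional_derivative_limit[OF Ck_on_has_derivative[OF U(3,2)]] v(1) by (rule order_tendstoD(2))
    moreover have "\<forall>\<^sub>F t in at_right 0. (\<rho>' (x + t *\<^sub>R v) - \<rho>' x) / t > 0"
      using directional_derivative_limit[OF Ck_on_has_derivative[OF U'(3,2)]] v(2) by (rule order_tendstoD(1))
    moreover have "\<forall>\<^sub>F t in at_right (0::real). t > 0" by (rule eventually_at_right_less)
    ultimately have "\<forall>\<^sub>F t in at_right (0::real). False"
    proof eventually_elim
      case (elim t)
      then have "\<rho> (x + t *\<^sub>R v) < 0" "\<rho>' (x + t *\<^sub>R v) > 0"
        using z by (auto simp: divide_less_0_iff zero_less_divide_iff)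
      then show ?case using elim(1) U(5) U'(5) by fastforce
    qed
    then show False by simp
  qed
  then show "\<eta> = gradient \<rho> x /\<^sub>R norm (gradient \<rho> x)" by (simp add: \<eta> a_def b_def)
qed

text \<open>A strip between two level sets has many disjoint translates in the direction \<open>e\<close>, in which the
  function increases at least at the rate \<open>c\<close>, and all of them lie in a fixed ball. Counting them bounds
  the measure without straightening the level sets.\<close>

lemma measure_strip_le:
  fixes \<rho> :: "'a::euclidean_space \<Rightarrow> real"
  assumes D: "\<And>y. y \<in> ball x0 R' \<Longrightarrow> (\<rho> has_derivative (\<lambda>v. G y \<bullet> v)) (at y)"
    and G: "\<And>y. y \<in> ball x0 R' \<Longrightarrow> G y \<bullet> e \<ge> c" and "norm e = 1" "c > 0" "s > 0" "R + s < R'" "h > 0"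
    and S: "S \<in> lmeasurable" "\<And>y. y \<in> S \<Longrightarrow> y \<in> cball x0 R \<and> a \<le> \<rho> y \<and> \<rho> y \<le> a + h"
  shows "measure lebesgue S \<le> (2 * measure lebesgue (ball x0 R') / (c * s)) * h"
proof -
  have incr: "\<rho> y + c * t \<le> \<rho> (y + t *\<^sub>R e)" if "t > 0" "y \<in> ball x0 R'" "y + t *\<^sub>R e \<in> ball x0 R'" for y t
  proof -
    have inb: "y + z *\<^sub>R e \<in> ball x0 R'" if "0 \<le> z" "z \<le> t" for z
    proof -
      have "y + z *\<^sub>R e = (1 - z / t) *\<^sub>R y + (z / t) *\<^sub>R (y + t *\<^sub>R e)"
        using \<open>t > 0\<close> by (simp add: algebra_simps)
      also have "\<dots> \<in> ball x0 R'"
        using that \<open>t > 0\<close> \<open>y \<in> ball x0 R'\<close> \<open>y + t *\<^sub>R e \<in> ball x0 R'\<close>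
        by (intro convexD[OF convex_ball]) auto
      finally show ?thesis .
    qed
    have "\<exists>z>0. z < t \<and> \<rho> (y + t *\<^sub>R e) - \<rho> (y + 0 *\<^sub>R e) = (t - 0) * (G (y + z *\<^sub>R e) \<bullet> e)"
    proof (rule MVT2[OF \<open>t > 0\<close>])
      fix z assume z: "0 \<le> z" "z \<le> t"
      have 1: "((\<lambda>z. y + z *\<^sub>R e) has_derivative (\<lambda>z. z *\<^sub>R e)) (at z)"
        by (auto intro!: derivative_eq_intros)
      show "((\<lambda>z. \<rho> (y + z *\<^sub>R e)) has_real_derivative G (y + z *\<^sub>R e) \<bullet> e) (at z)"
        using has_derivative_compose[OF 1 D[OF inb[OF z]]]
        by (simp add: has_field_derivative_def mult.commute[of _ "G (y + z *\<^sub>R e) \<bullet> e"])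
    qed
    then obtain z where z: "0 < z" "z < t" "\<rho> (y + t *\<^sub>R e) - \<rho> y = t * (G (y + z *\<^sub>R e) \<bullet> e)" by auto
    have "t * c \<le> t * (G (y + z *\<^sub>R e) \<bullet> e)"
      using G[OF inb[of z]] z \<open>t > 0\<close> by (intro mult_left_mono) auto
    then show ?thesis using z(3) mult.commute[of c t] by linarith
  qed
  \<comment> \<open>a shift by \<open>\<tau> e\<close> raises the function by at least \<open>2h\<close>, more than the height of the strip\<close>
  define \<tau> where "\<tau> = 2 * h / c"
  have \<tau>: "\<tau> > 0" "c * \<tau> = 2 * h" using assms by (auto simp: \<tau>_def)
  define m where "m = nat \<lfloor>s / \<tau>\<rfloor>"
  have m: "real m \<le> s / \<tau>" "s / \<tau> \<le> real (Suc m)" using \<tau> assms(5) by (auto simp: m_def) linarith+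
  define T where "T = (\<lambda>j::nat. (+) ((real j * \<tau>) *\<^sub>R e) ` S)"
  have jt: "real j * \<tau> \<le> s" if "j \<le> m" for j
  proof -
    have "real j * \<tau> \<le> (s / \<tau>) * \<tau>" using that m(1) \<tau> by (intro mult_right_mono) auto
    then show ?thesis using \<tau> by simp
  qed
  have Tb: "T j \<subseteq> ball x0 R'" if "j \<le> m" for j
  proof
    fix y assume "y \<in> T j"
    then obtain p where p: "p \<in> S" "y = (real j * \<tau>) *\<^sub>R e + p" by (auto simp: T_def)
    have "dist x0 y \<le> dist x0 p + dist p y" by (rule dist_triangle)
    also have "dist p y = real j * \<tau>" using p \<tau> \<open>norm e = 1\<close> by (simp add: dist_norm)
    finally show "y \<in> ball x0 R'" using S(2)[OF p(1)] jt[OF that] \<open>R + s < R'\<close> by simp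
  qed
  have Sb: "y \<in> ball x0 R'" if "y \<in> S" for y using Tb[of 0] that by (auto simp: T_def)
  have disj: "T i \<inter> T j = {}" if "i < j" for i j
  proof (rule ccontr)
    assume "T i \<inter> T j \<noteq> {}"
    then obtain p p' where p: "p \<in> S" "p' \<in> S" "(real i * \<tau>) *\<^sub>R e + p = (real j * \<tau>) *\<^sub>R e + p'"
      by (auto simp: T_def)
    define t where "t = (real j - real i) * \<tau>"
    have t1: "t \<ge> \<tau>" using that \<tau> by (simp add: t_def)
    have "p = p' + t *\<^sub>R e" using p(3) by (simp add: t_def algebra_simps)
    then have "\<rho> p' + c * t \<le> \<rho> p" using incr[of t p'] Sb p t1 \<tau> by auto
    moreover have "c * \<tau> \<le> c * t" using t1 \<open>c > 0\<close> by simp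
    ultimately show False using S(2)[OF p(1)] S(2)[OF p(2)] \<tau> \<open>h > 0\<close> by simp
  qed
  have Tm: "T j \<in> lmeasurable" "measure lebesgue (T j) = measure lebesgue S" for j
    using S(1) by (auto simp: T_def measurable_translation measure_translation)
  have "measure lebesgue (\<Union>(T ` {..m})) = (\<Sum>j\<in>{..m}. measure lebesgue (T j))"
  proof (rule measure_negligible_finite_Union_image)
    show "pairwise (\<lambda>i j. negligible (T i \<inter> T j)) {..m}"
      using disj by (metis (no_types, lifting) Int_commute linorder_neqE_nat negligible_empty pairwiseI)
  qed (use Tm in auto)
  also have "\<dots> = real (Suc m) * measure lebesgue S" by (simp add: Tm)
  finally have "real (Suc m) * measure lebesgue S = measure lebesgue (\<Union>(T ` {..m}))" ..
  also have "\<dots> \<le> measure lebesgue (ball x0 R')"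
    by (rule measure_mono_fmeasurable) (use Tb Tm in \<open>auto intro: fmeasurableD\<close>)
  finally have *: "real (Suc m) * measure lebesgue S \<le> measure lebesgue (ball x0 R')" .
  have "(s / \<tau>) * measure lebesgue S \<le> real (Suc m) * measure lebesgue S"
    by (intro mult_right_mono m) simp
  with * have "(s / \<tau>) * measure lebesgue S \<le> measure lebesgue (ball x0 R')" by linarith
  then have "measure lebesgue S \<le> measure lebesgue (ball x0 R') * \<tau> / s"
    using \<tau> \<open>s > 0\<close> by (simp add: field_simps)
  then show ?thesis by (simp add: \<tau>_def field_simps)
qed

lemma integrable_lebesgue_on_continuous_closure:
  fixes f :: "'a::euclidean_space \<Rightarrow> real"
  assumes "open \<Omega>" "bounded \<Omega>" "continuous_on (closure \<Omega>) f"
  shows "integrable (lebesgue_on \<Omega>) f"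
proof -
  have "integrable lborel (\<lambda>x. indicator (closure \<Omega>) x *\<^sub>R f x)"
    by (rule borel_integrable_compact) (use assms in \<open>auto simp: compact_closure\<close>)
  then have "integrable lebesgue (\<lambda>x. indicator (closure \<Omega>) x * f x)"
    by (subst integrable_completion) (auto dest: borel_measurable_integrable)
  from integrable_mult_indicator[OF _ this, of \<Omega>]
  have "integrable lebesgue (\<lambda>x. indicator \<Omega> x * (indicator (closure \<Omega>) x * f x))"
    using assms(1) by simp
  moreover have "indicator \<Omega> x * (indicator (closure \<Omega>) x * f x) = indicator \<Omega> x * f x" for x
    using closure_subset[of \<Omega>] by (auto simp: indicator_def)
  ultimately show ?thesis unfolding lebesgue_on_integrable_iff[OF assms(1)] by simp
qed

text \<open>Cutoffs that vanish near \<open>S\<close>, tend to \<open>1\<close> in the domain, and whose gradients are negligible when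
  tested with the field \<open>w\<close>. The product rule makes such families multiply, which replaces a
  partition of unity.\<close>

definition boundary_cutoffs ::
  "(real^2) set \<Rightarrow> (real^2 \<Rightarrow> real^2) \<Rightarrow> (real^2) set \<Rightarrow> (nat \<Rightarrow> real^2 \<Rightarrow> real) \<Rightarrow> bool" where
  "boundary_cutoffs \<Omega> w S \<zeta> \<longleftrightarrow>
     (\<forall>k. Ck_on (Suc 0) UNIV (\<zeta> k)) \<and> (\<forall>k x. 0 \<le> \<zeta> k x \<and> \<zeta> k x \<le> 1) \<and>
     (\<forall>x\<in>\<Omega>. (\<lambda>k. \<zeta> k x) \<longlonglongrightarrow> 1) \<and>
     (\<forall>k. \<exists>V. open V \<and> S \<subseteq> V \<and> (\<forall>x\<in>V. \<zeta> k x = 0)) \<and>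
     (\<lambda>k. integral\<^sup>L (lebesgue_on \<Omega>) (\<lambda>x. \<bar>w x \<bullet> gradient (\<zeta> k) x\<bar>)) \<longlonglongrightarrow> 0"

lemma boundary_cutoffs_empty: "boundary_cutoffs \<Omega> w {} (\<lambda>k x. 1)"
proof -
  have "gradient (\<lambda>x. 1) x = 0" for x
    by (rule gradient_eqI) simp
  then show ?thesis
    by (auto simp add: boundary_cutoffs_def Ck_on_const simp del: Ck_on.simps intro!: exI[of _ "{}"])
qed

text \<open>Both factors are at most \<open>1\<close>, so the product rule bounds the integrals by the sum of the two given ones.\<close>

lemma boundary_cutoffs_mult:
  assumes "open \<Omega>" "bounded \<Omega>" "continuous_on (closure \<Omega>) w"
    and 1: "boundary_cutoffs \<Omega> w S \<zeta>" and 2: "boundary_cutoffs \<Omega> w S' \<zeta>'"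
  shows "boundary_cutoffs \<Omega> w (S \<union> S') (\<lambda>k x. \<zeta> k x * \<zeta>' k x)"
proof -
  have C: "Ck_on (Suc 0) UNIV (\<zeta> k)" "Ck_on (Suc 0) UNIV (\<zeta>' k)" for k
    using 1 2 by (auto simp: boundary_cutoffs_def)
  have b: "0 \<le> \<zeta> k x" "\<zeta> k x \<le> 1" "0 \<le> \<zeta>' k x" "\<zeta>' k x \<le> 1" for k x
    using 1 2 by (auto simp: boundary_cutoffs_def)
  have lim: "(\<lambda>k. \<zeta> k x) \<longlonglongrightarrow> 1" "(\<lambda>k. \<zeta>' k x) \<longlonglongrightarrow> 1" if "x \<in> \<Omega>" for x
    using 1 2 that by (auto simp: boundary_cutoffs_def)
  let ?I = "\<lambda>f. integral\<^sup>L (lebesgue_on \<Omega>) (\<lambda>x. \<bar>w x \<bullet> gradient f x\<bar>)"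
  have limI: "(\<lambda>k. ?I (\<zeta> k)) \<longlonglongrightarrow> 0" "(\<lambda>k. ?I (\<zeta>' k)) \<longlonglongrightarrow> 0"
    using 1 2 by (auto simp: boundary_cutoffs_def)
  have int: "integrable (lebesgue_on \<Omega>) (\<lambda>x. \<bar>w x \<bullet> gradient f x\<bar>)" if "Ck_on (Suc 0) UNIV f" for f
    by (intro integrable_lebesgue_on_continuous_closure assms(1,2) continuous_intros assms(3)
        continuous_on_subset[OF Ck_on_continuous_gradient[OF that]]) simp
  have C': "Ck_on (Suc 0) UNIV (\<lambda>x. \<zeta> k x * \<zeta>' k x)" for k
    by (rule Ck_on_mult[OF open_UNIV C])
  have le: "?I (\<lambda>x. \<zeta> k x * \<zeta>' k x) \<le> ?I (\<zeta>' k) + ?I (\<zeta> k)" for k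
  proof -
    have "\<bar>w x \<bullet> gradient (\<lambda>x. \<zeta> k x * \<zeta>' k x) x\<bar> \<le> \<bar>w x \<bullet> gradient (\<zeta>' k) x\<bar> + \<bar>w x \<bullet> gradient (\<zeta> k) x\<bar>" for x
    proof -
      have "\<bar>w x \<bullet> gradient (\<lambda>x. \<zeta> k x * \<zeta>' k x) x\<bar>
          \<le> \<zeta> k x * \<bar>w x \<bullet> gradient (\<zeta>' k) x\<bar> + \<zeta>' k x * \<bar>w x \<bullet> gradient (\<zeta> k) x\<bar>"
        using b[of k x] abs_triangle_ineq[of "\<zeta> k x * (w x \<bullet> gradient (\<zeta>' k) x)" "\<zeta>' k x * (w x \<bullet> gradient (\<zeta> k) x)"]
        by (simp add: gradient_mult[OF C] inner_add_right abs_mult)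
      also have "\<dots> \<le> 1 * \<bar>w x \<bullet> gradient (\<zeta>' k) x\<bar> + 1 * \<bar>w x \<bullet> gradient (\<zeta> k) x\<bar>"
        using b[of k x] by (intro add_mono mult_right_mono) auto
      finally show ?thesis by simp
    qed
    then have "?I (\<lambda>x. \<zeta> k x * \<zeta>' k x)
        \<le> integral\<^sup>L (lebesgue_on \<Omega>) (\<lambda>x. \<bar>w x \<bullet> gradient (\<zeta>' k) x\<bar> + \<bar>w x \<bullet> gradient (\<zeta> k) x\<bar>)"
      by (intro integral_mono int[OF C'] Bochner_Integration.integrable_add int C)
    then show ?thesis using int[OF C(1)] int[OF C(2)] by simp
  qed
  have "(\<lambda>k. ?I (\<zeta>' k) + ?I (\<zeta> k)) \<longlonglongrightarrow> 0"
    using tendsto_add[OF limI(2,1)] by simp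
  then have I0: "(\<lambda>k. ?I (\<lambda>x. \<zeta> k x * \<zeta>' k x)) \<longlonglongrightarrow> 0"
    by (rule Lim_null_comparison[rotated]) (simp add: le)
  have V: "\<exists>V. open V \<and> S \<union> S' \<subseteq> V \<and> (\<forall>x\<in>V. \<zeta> k x * \<zeta>' k x = 0)" for k
  proof -
    obtain V where "open V \<and> S \<subseteq> V \<and> (\<forall>x\<in>V. \<zeta> k x = 0)" using 1 unfolding boundary_cutoffs_def by blast
    moreover obtain V' where "open V' \<and> S' \<subseteq> V' \<and> (\<forall>x\<in>V'. \<zeta>' k x = 0)" using 2 unfolding boundary_cutoffs_def by blast
    ultimately show ?thesis by (intro exI[of _ "V \<union> V'"]) auto
  qed
  have "(\<lambda>k. \<zeta> k x * \<zeta>' k x) \<longlonglongrightarrow> 1" if "x \<in> \<Omega>" for x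
    using tendsto_mult[OF lim[OF that]] by simp
  moreover have "\<zeta> k x * \<zeta>' k x \<le> 1" for k x using b[of k x] by (simp add: mult_le_one)
  ultimately show ?thesis unfolding boundary_cutoffs_def using C' V I0 b by auto
qed

lemma boundary_cutoffs_subset: "boundary_cutoffs \<Omega> w S \<zeta> \<Longrightarrow> S' \<subseteq> S \<Longrightarrow> boundary_cutoffs \<Omega> w S' \<zeta>"
  unfolding boundary_cutoffs_def by (meson order_trans)

text \<open>Near a boundary point the cutoff is \<open>1 - b \<psi>(k \<rho>)\<close> with a bump \<open>b\<close> and a soft step \<open>\<psi>\<close>. Its gradient
  is supported, inside the domain, in the strip \<open>-2/k \<le> \<rho> \<le> 0\<close>, which has measure \<open>O(1/k)\<close>. The part with \<open>\<nabla>b\<close> is bounded, and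
  the part with \<open>k \<nabla>\<rho>\<close> is \<open>k\<close> times \<open>w \<cdot> \<nabla>\<rho>\<close>, which is uniformly small near the boundary because \<open>w\<close> is
  continuous and tangential there.\<close>

lemma local_boundary_cutoffs:
  assumes \<Omega>: "open \<Omega>" "bounded \<Omega>" and w: "continuous_on (closure \<Omega>) w"
    and normal: "\<And>x. x \<in> frontier \<Omega> \<Longrightarrow> w x \<bullet> outward_normal \<Omega> x = 0"
    and x0: "x0 \<in> frontier \<Omega>" and l: "local_defining_function (Suc 0) \<Omega> x0 U \<rho>"
  shows "\<exists>r>0. \<exists>\<zeta>. boundary_cutoffs \<Omega> w (frontier \<Omega> \<inter> ball x0 r) \<zeta>"
proof -
  have U: "open U" "x0 \<in> U" "Ck_on (Suc 0) U \<rho>" "\<And>y. y \<in> U \<Longrightarrow> gradient \<rho> y \<noteq> 0" "\<And>y. y \<in> U \<Longrightarrow> y \<in> \<Omega> \<longleftrightarrow> \<rho> y < 0"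
    using l unfolding local_defining_function_def by blast+
  have cr: "continuous_on U \<rho>" and cg: "continuous_on U (gradient \<rho>)"
    using Ck_on_continuous[OF U(3)] Ck_on_continuous_gradient[OF U(3)] by auto
  have tangent: "w y \<bullet> gradient \<rho> y = 0" if y: "y \<in> frontier \<Omega>" "y \<in> U" for y
  proof -
    have "local_defining_function (Suc 0) \<Omega> y U \<rho>"
      using l y(2) unfolding local_defining_function_def by blast
    from outward_normal_eq[OF \<Omega>(1) y(1) this] normal[OF y(1)] U(4)[OF y(2)] show ?thesis by simp
  qed
  define e where "e = gradient \<rho> x0 /\<^sub>R norm (gradient \<rho> x0)"
  define c where "c = norm (gradient \<rho> x0) / 2"
  have c: "c > 0" "norm e = 1" using U(4)[OF U(2)] by (auto simp: c_def e_def)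
  have "gradient \<rho> x0 \<bullet> e = 2 * c"
    using U(4)[OF U(2)] by (simp add: c_def e_def dot_square_norm power2_eq_square)
  then have gt: "gradient \<rho> x0 \<bullet> e > c" using c by simp
  have "open (U \<inter> (\<lambda>y. gradient \<rho> y \<bullet> e) -` {c<..})"
    by (intro continuous_open_preimage continuous_intros cg U(1) open_greaterThan)
  moreover have "x0 \<in> U \<inter> (\<lambda>y. gradient \<rho> y \<bullet> e) -` {c<..}" using gt U(2) by simp
  ultimately obtain R' where R': "R' > 0" "ball x0 R' \<subseteq> U \<inter> (\<lambda>y. gradient \<rho> y \<bullet> e) -` {c<..}"
    by (meson open_contains_ball)
  define r where "r = R' / 4"
  have r: "r > 0" "2 * r + r < R'" using R'(1) by (auto simp: r_def)
  define D where "D = cball x0 (2 * r)"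
  have DU: "D \<subseteq> U" "compact D" "closed D" 
  proof -
    have "D \<subseteq> ball x0 R'" using r by (auto simp: D_def)
    then show "D \<subseteq> U" using R'(2) by blast
  qed (simp_all add: D_def)
  \<comment> \<open>a bump that is 1 on the ball of radius \<open>r\<close> and 0 outside \<open>D\<close>\<close>
  define b where "b = (\<lambda>y. soft_step ((4 * r\<^sup>2 - (y - x0) \<bullet> (y - x0)) / (3 * r\<^sup>2)))"
  define gb where "gb = (\<lambda>y. soft_step_deriv ((4 * r\<^sup>2 - (y - x0) \<bullet> (y - x0)) / (3 * r\<^sup>2)) *\<^sub>R ((- 2 / (3 * r\<^sup>2)) *\<^sub>R (y - x0)))"
  have Db: "(b has_derivative (\<lambda>v. gb y \<bullet> v)) (at y)" for y
  proof -
    have "((\<lambda>y. (y - x0) \<bullet> (y - x0)) has_derivative (\<lambda>v. (y - x0) \<bullet> (v - 0) + (v - 0) \<bullet> (y - x0))) (at y)"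
      by (intro has_derivative_inner has_derivative_diff has_derivative_ident has_derivative_const)
    from has_derivative_mult_left[OF has_derivative_diff[OF has_derivative_const[of "4 * r\<^sup>2"] this], of "inverse (3 * r\<^sup>2)"]
    have "((\<lambda>y. (4 * r\<^sup>2 - (y - x0) \<bullet> (y - x0)) / (3 * r\<^sup>2)) has_derivative
        (\<lambda>v. ((- 2 / (3 * r\<^sup>2)) *\<^sub>R (y - x0)) \<bullet> v)) (at y)"
      by (simp only: divide_inverse inner_commute[of _ "y - x0"] inner_scaleR_left) (simp add: mult_ac)
    from has_derivative_compose[OF this soft_step_has_derivative[unfolded has_field_derivative_def]]
    show ?thesis by (simp add: b_def gb_def mult_ac)
  qed
  have Cgb: "continuous_on UNIV gb"
    unfolding gb_def by (intro continuous_intros continuous_on_compose2[OF continuous_soft_step_deriv]) (use r in auto)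
  have Cb: "Ck_on (Suc 0) UNIV b" "\<And>y. gradient b y = gb y"
    using Ck1_I[OF Db Cgb] gradient_eqI[OF Db] by auto
  have b0: "0 \<le> b y" "b y \<le> 1" for y by (simp_all add: b_def soft_step_bounds)
  have sq: "(y - x0) \<bullet> (y - x0) = (dist x0 y)\<^sup>2" for y by (metis dist_commute dist_norm dot_square_norm)
  have bD: "b y = 0" "gb y = 0" if "y \<notin> D" for y
  proof -
    have "(2 * r)\<^sup>2 \<le> (dist x0 y)\<^sup>2" using that r by (intro power_mono) (auto simp: D_def)
    then have "(4 * r\<^sup>2 - (y - x0) \<bullet> (y - x0)) / (3 * r\<^sup>2) \<le> 0"
      using r by (simp add: sq power_mult_distrib divide_le_0_iff)
    then show "b y = 0" "gb y = 0" by (simp_all add: b_def gb_def soft_step_bounds soft_step_deriv_bounds)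
  qed
  have b1: "b y = 1" if "y \<in> ball x0 r" for y
  proof -
    have "(dist x0 y)\<^sup>2 \<le> r\<^sup>2" using that by (intro power_mono) auto
    then have "(4 * r\<^sup>2 - (y - x0) \<bullet> (y - x0)) / (3 * r\<^sup>2) \<ge> 1"
      using r by (simp add: sq le_divide_eq)
    then show ?thesis by (simp add: b_def soft_step_bounds)
  qed
  define m where "m = (\<lambda>k::nat. real (Suc k))"
  have m: "m k > 0" for k by (simp add: m_def)
  define \<zeta> where "\<zeta> = (\<lambda>k y. if y \<in> U then 1 - b y * soft_step (m k * \<rho> y + 2) else 1)"
  define G where "G = (\<lambda>k y. if y \<in> D then - (soft_step (m k * \<rho> y + 2) *\<^sub>R gb y + (b y * (m k * soft_step_deriv (m k * \<rho> y + 2))) *\<^sub>R gradient \<rho> y) else 0)"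
  have D\<zeta>: "Ck_on (Suc 0) U (\<zeta> k)" "\<And>y. y \<in> U \<Longrightarrow> gradient (\<zeta> k) y = G k y" for k
  proof -
    have s: "((\<lambda>t. soft_step (m k * t + 2)) has_real_derivative m k * soft_step_deriv (m k * t + 2)) (at t)" for t
      by (rule DERIV_chain2[OF soft_step_has_derivative, THEN DERIV_cong]) (auto intro!: derivative_eq_intros)
    have cs: "continuous_on UNIV (\<lambda>t. m k * soft_step_deriv (m k * t + 2))"
      by (intro continuous_intros continuous_on_compose2[OF continuous_soft_step_deriv]) auto
    note K = Ck1_compose[OF U(3) s cs]
    have CbU: "Ck_on (Suc 0) U b" using Ck_on_subset[OF Cb(1)] by blast
    have P: "Ck_on (Suc 0) U (\<lambda>y. b y * soft_step (m k * \<rho> y + 2))" by (rule Ck_on_mult[OF U(1) CbU K(1)])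
    have "((\<lambda>y. 1 - b y * soft_step (m k * \<rho> y + 2)) has_derivative (\<lambda>v. G k y \<bullet> v)) (at y)" if y: "y \<in> U" for y
    proof -
      have "gradient (\<lambda>y. b y * soft_step (m k * \<rho> y + 2)) y = - G k y"
        using y bD[of y] by (simp add: gradient_mult[OF CbU K(1) y] K(2)[OF y] Cb(2) G_def)
      then have "((\<lambda>y. b y * soft_step (m k * \<rho> y + 2)) has_derivative (\<lambda>v. - G k y \<bullet> v)) (at y)"
        using Ck_on_has_derivative[OF P y] by simp
      from has_derivative_diff[OF has_derivative_const[of 1] this] show ?thesis by simp
    qed
    then have D: "(\<zeta> k has_derivative (\<lambda>v. G k y \<bullet> v)) (at y)" if y: "y \<in> U" for y
      by (rule has_derivative_transform_within_open[OF _ U(1) y]) (use y in \<open>auto simp: \<zeta>_def\<close>)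
    show "gradient (\<zeta> k) y = G k y" if "y \<in> U" for y by (rule gradient_eqI[OF D[OF that]])
    have "Ck_on (Suc 0) U (\<lambda>y. 1 + (-1) * (b y * soft_step (m k * \<rho> y + 2)))"
      by (intro Ck_on_add Ck_on_mult[OF U(1) Ck_on_const P] Ck_on_const U(1))
    then show "Ck_on (Suc 0) U (\<zeta> k)"
      by (rule Ck_on_congI[OF U(1)]) (simp add: \<zeta>_def)
  qed
  have \<zeta>1: "\<zeta> k y = 1" if "y \<notin> D" for k y using bD(1)[OF that] by (simp add: \<zeta>_def)
  have oD: "open (- D)" using DU(3) by auto
  have C\<zeta>': "Ck_on (Suc 0) (- D) (\<zeta> k)" for k
    by (rule Ck_on_congI[OF oD Ck_on_const[of _ _ 1]]) (simp add: \<zeta>1)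
  have C\<zeta>: "Ck_on (Suc 0) UNIV (\<zeta> k)" for k
  proof (rule Ck1_I)
    have UD: "y \<in> U \<or> y \<in> - D" for y using DU by auto
    show "(\<zeta> k has_derivative (\<lambda>v. gradient (\<zeta> k) y \<bullet> v)) (at y)" for y
      using UD[of y] Ck_on_has_derivative[OF D\<zeta>(1)] Ck_on_has_derivative[OF C\<zeta>'] by blast
    have "continuous_on (U \<union> - D) (gradient (\<zeta> k))"
      by (intro continuous_on_open_Un U(1) oD Ck_on_continuous_gradient[OF D\<zeta>(1)] Ck_on_continuous_gradient[OF C\<zeta>'])
    moreover have "U \<union> - D = UNIV" using DU by auto
    ultimately show "continuous_on UNIV (gradient (\<zeta> k))" by simp
  qed
  have G: "gradient (\<zeta> k) y = G k y" for k y
  proof (cases "y \<in> D")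
    case False
    have "gradient (\<zeta> k) y = gradient (\<lambda>x. 1) y"
      by (rule gradient_cong_open[OF oD]) (use False \<zeta>1 in auto)
    also have "\<dots> = 0" by (rule gradient_eqI) simp
    finally show ?thesis using False by (simp add: G_def)
  qed (use DU D\<zeta>(2) in auto)
  have bounds: "0 \<le> \<zeta> k y \<and> \<zeta> k y \<le> 1" for k y
    using b0[of y] soft_step_bounds[of "m k * \<rho> y + 2"] by (simp add: \<zeta>_def mult_le_one)
  have lim: "(\<lambda>k. \<zeta> k y) \<longlonglongrightarrow> 1" if y: "y \<in> \<Omega>" for y
  proof (cases "y \<in> U")
    case True
    then have neg: "\<rho> y < 0" using U(5) y by blast
    obtain K where K: "2 / (- \<rho> y) < real K" using reals_Archimedean2 by blast
    have "\<zeta> k y = 1" if "k \<ge> K" for k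
    proof -
      have "2 / (- \<rho> y) \<le> m k" using K that by (simp add: m_def)
      then have "m k * \<rho> y + 2 \<le> 0" using neg by (simp add: field_simps)
      then show ?thesis by (simp add: \<zeta>_def soft_step_bounds)
    qed
    then show ?thesis by (intro tendsto_eventually) (auto simp: eventually_sequentially)
  qed (simp add: \<zeta>_def)
  have V: "\<exists>V. open V \<and> frontier \<Omega> \<inter> ball x0 r \<subseteq> V \<and> (\<forall>y\<in>V. \<zeta> k y = 0)" for k
  proof (intro exI conjI ballI)
    let ?V = "(U \<inter> \<rho> -` {- 1 / m k<..}) \<inter> ball x0 r"
    show "open ?V" by (intro open_Int continuous_open_preimage cr U(1) open_greaterThan open_ball)
    show "frontier \<Omega> \<inter> ball x0 r \<subseteq> ?V"
    proof
      fix y assume y: "y \<in> frontier \<Omega> \<inter> ball x0 r"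
      then have "y \<in> U" using R' r by (auto simp: subset_iff)
      moreover have "\<rho> y = 0" using local_defining_function_zero[OF \<Omega>(1) _ l \<open>y \<in> U\<close>] y by blast
      ultimately show "y \<in> ?V" using y m[of k] by simp
    qed
    fix y assume y: "y \<in> ?V"
    then have "m k * \<rho> y + 2 \<ge> 1" using m[of k] by (simp add: field_simps)
    then show "\<zeta> k y = 0" using y b1 by (simp add: \<zeta>_def soft_step_bounds)
  qed
  \<comment> \<open>the strip carrying the gradients\<close>
  define C where "C = 2 * measure lebesgue (ball x0 R') / (c * r)"
  have C0: "C \<ge> 0" using c r by (simp add: C_def)
  define S where "S = (\<lambda>k. {y \<in> D. - 2 / m k \<le> \<rho> y \<and> \<rho> y \<le> 0})"
  have Sm: "S k \<in> lmeasurable" for k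
  proof -
    have "closed (D \<inter> \<rho> -` {- 2 / m k..0})"
      by (intro continuous_closed_preimage continuous_on_subset[OF cr DU(1)] DU(3) closed_atLeastAtMost)
    then have "compact (D \<inter> (D \<inter> \<rho> -` {- 2 / m k..0}))" using DU(2) by (rule compact_Int_closed[rotated])
    moreover have "D \<inter> (D \<inter> \<rho> -` {- 2 / m k..0}) = S k" by (auto simp: S_def)
    ultimately show ?thesis using lmeasurable_compact by metis
  qed
  have meas: "measure lebesgue (S k) \<le> C * (2 / m k)" for k
    unfolding C_def
  proof (rule measure_strip_le[where e=e and G="gradient \<rho>" and a="- 2 / m k"])
    show "(\<rho> has_derivative (\<lambda>v. gradient \<rho> y \<bullet> v)) (at y)" if "y \<in> ball x0 R'" for y
      using Ck_on_has_derivative[OF U(3)] R'(2) that by blast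
    show "c \<le> gradient \<rho> y \<bullet> e" if "y \<in> ball x0 R'" for y using R'(2) that by fastforce
    show "y \<in> cball x0 (2 * r) \<and> - 2 / m k \<le> \<rho> y \<and> \<rho> y \<le> - 2 / m k + 2 / m k" if "y \<in> S k" for y
      using that by (simp add: S_def D_def)
  qed (use c r m Sm in auto)
  have cDw: "continuous_on (closure \<Omega> \<inter> D) w" by (rule continuous_on_subset[OF w]) auto
  have cD: "compact (closure \<Omega> \<inter> D)" using \<Omega>(2) DU(3) by (intro compact_Int_closed) (auto simp: compact_closure)
  have "bounded ((\<lambda>y. w y \<bullet> gb y) ` (closure \<Omega> \<inter> D))"
    by (intro compact_imp_bounded compact_continuous_image cD continuous_intros cDw continuous_on_subset[OF Cgb]) simp
  then obtain B where "\<forall>z\<in>(\<lambda>y. w y \<bullet> gb y) ` (closure \<Omega> \<inter> D). norm z \<le> B" unfolding bounded_iff by blast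
  then have B: "\<bar>w y \<bullet> gb y\<bar> \<le> B" if "y \<in> closure \<Omega> \<inter> D" for y using that by (simp only: ball_simps real_norm_def)
  define B' where "B' = max B 0"
  have B': "B' \<ge> 0" "\<And>y. y \<in> closure \<Omega> \<inter> D \<Longrightarrow> \<bar>w y \<bullet> gb y\<bar> \<le> B'" using B by (auto simp: B'_def le_max_iff_disj)
  \<comment> \<open>by compactness: on the set where the component is at least \<open>\<epsilon>\<close>, the defining function stays away from \<open>0\<close>\<close>
  have small: "\<exists>d>0. \<forall>y\<in>\<Omega> \<inter> D. \<rho> y \<ge> - d \<longrightarrow> \<bar>w y \<bullet> gradient \<rho> y\<bar> \<le> \<epsilon>" if \<epsilon>: "\<epsilon> > 0" for \<epsilon>
  proof -
    let ?f = "\<lambda>y. \<bar>w y \<bullet> gradient \<rho> y\<bar>"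
    have cf: "continuous_on (closure \<Omega> \<inter> D) ?f"
      by (intro continuous_intros cDw continuous_on_subset[OF cg]) (use DU in auto)
    define Z where "Z = (closure \<Omega> \<inter> D) \<inter> ?f -` {\<epsilon>..}"
    have "closed Z" unfolding Z_def
      by (intro continuous_closed_preimage cf closed_atLeast closed_Int DU(3)) auto
    then have cZ: "compact Z"
      using compact_Int_closed[OF cD, of Z] by (simp add: Z_def Int_assoc[symmetric])
    have neg: "\<rho> y < 0" if "y \<in> Z" for y
    proof -
      have y: "y \<in> closure \<Omega>" "y \<in> U" "?f y \<ge> \<epsilon>" using that DU by (auto simp: Z_def)
      have "y \<notin> frontier \<Omega>" using tangent[of y] y \<epsilon> by auto
      then have "y \<in> \<Omega>" using y(1) \<Omega>(1) by (simp add: frontier_def interior_open)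
      then show ?thesis using U(5) y(2) by blast
    qed
    show ?thesis
    proof (cases "Z = {}")
      case True
      have "\<bar>w y \<bullet> gradient \<rho> y\<bar> \<le> \<epsilon>" if "y \<in> \<Omega> \<inter> D" for y
      proof -
        have "y \<in> closure \<Omega> \<inter> D" using that closure_subset by blast
        with True show ?thesis by (auto simp: Z_def)
      qed
      then show ?thesis by (intro exI[of _ 1]) auto
    next
      case False
      have "continuous_on Z \<rho>" by (rule continuous_on_subset[OF cr]) (use DU in \<open>auto simp: Z_def\<close>)
      then obtain z where z: "z \<in> Z" "\<And>y. y \<in> Z \<Longrightarrow> \<rho> y \<le> \<rho> z"
        using continuous_attains_sup[OF cZ False] by blast
      have "\<bar>w y \<bullet> gradient \<rho> y\<bar> \<le> \<epsilon>" if y: "y \<in> \<Omega> \<inter> D" "\<rho> y \<ge> \<rho> z / 2" for y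
      proof (rule ccontr)
        assume "\<not> \<bar>w y \<bullet> gradient \<rho> y\<bar> \<le> \<epsilon>"
        moreover have "y \<in> closure \<Omega> \<inter> D" using y closure_subset by blast
        ultimately have "y \<in> Z" by (simp add: Z_def)
        then show False using z(2)[of y] neg[OF z(1)] y(2) by simp
      qed
      then show ?thesis using neg[OF z(1)] by (intro exI[of _ "- \<rho> z / 2"]) auto
    qed
  qed
  let ?I = "\<lambda>k. integral\<^sup>L (lebesgue_on \<Omega>) (\<lambda>x. \<bar>w x \<bullet> gradient (\<zeta> k) x\<bar>)"
  have "?I \<longlonglongrightarrow> 0"
  proof (rule LIMSEQ_I)
    fix \<eta> :: real assume \<eta>: "\<eta> > 0"
    \<comment> \<open>the final bound is \<open>2 C B' / m k + 8 C \<epsilon>\<close>; each summand gets half of \<open>\<eta>\<close>\<close>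
    define \<epsilon> where "\<epsilon> = \<eta> / (16 * (C + 1))"
    have \<epsilon>: "\<epsilon> > 0" using \<eta> C0 by (simp add: \<epsilon>_def)
    obtain d where d: "d > 0" "\<And>y. y \<in> \<Omega> \<inter> D \<Longrightarrow> \<rho> y \<ge> - d \<Longrightarrow> \<bar>w y \<bullet> gradient \<rho> y\<bar> \<le> \<epsilon>"
      using small[OF \<epsilon>] by blast
    obtain K where K: "max (2 / d) (4 * (C + 1) * (B' + 1) / \<eta>) < real K" using reals_Archimedean2 by blast
    have "?I k < \<eta>" if k: "k \<ge> K" for k
    proof -
      have mk: "2 / d < m k" "4 * (C + 1) * (B' + 1) / \<eta> < m k" using K k by (auto simp: m_def)
      have pt: "\<bar>w y \<bullet> gradient (\<zeta> k) y\<bar> \<le> indicator (S k) y * (B' + 4 * m k * \<epsilon>)" if y: "y \<in> \<Omega>" for y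
      proof (cases "y \<in> D")
        case True
        have neg: "\<rho> y < 0" using U(5) y True DU by blast
        show ?thesis
        proof (cases "m k * \<rho> y + 2 \<le> 0")
          case True
          then show ?thesis using B' \<epsilon> m[of k] by (simp add: G G_def soft_step_bounds soft_step_deriv_bounds)
        next
          case False
          have yS: "y \<in> S k" using False True neg m[of k] by (simp add: S_def field_simps)
          have "- 2 / m k \<ge> - d" using mk(1) d(1) m[of k] by (simp add: field_simps)
          then have "\<rho> y \<ge> - d" using yS by (simp add: S_def)
          then have s: "\<bar>w y \<bullet> gradient \<rho> y\<bar> \<le> \<epsilon>" using d(2) y True by blast
          let ?s = "soft_step (m k * \<rho> y + 2)" and ?s' = "soft_step_deriv (m k * \<rho> y + 2)"
          have "\<bar>w y \<bullet> gradient (\<zeta> k) y\<bar> = \<bar>?s * (w y \<bullet> gb y) + (b y * (m k * ?s')) * (w y \<bullet> gradient \<rho> y)\<bar>"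
            using True by (simp only: G G_def if_True inner_minus_right inner_add_right inner_scaleR_right abs_minus_cancel)
          also have "\<dots> \<le> ?s * \<bar>w y \<bullet> gb y\<bar> + (b y * (m k * ?s')) * \<bar>w y \<bullet> gradient \<rho> y\<bar>"
            using abs_triangle_ineq[of "?s * (w y \<bullet> gb y)" "(b y * (m k * ?s')) * (w y \<bullet> gradient \<rho> y)"]
              b0[of y] m[of k] soft_step_bounds(1) soft_step_deriv_bounds(1) by (simp add: abs_mult)
          also have "\<dots> \<le> 1 * B' + (1 * (m k * 4)) * \<epsilon>"
            using b0[of y] m[of k] soft_step_bounds soft_step_deriv_bounds B' s \<epsilon> y True closure_subset[of \<Omega>]
            by (intro add_mono mult_mono) auto
          finally show ?thesis using yS by (simp add: mult.commute mult.left_commute)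
        qed
      qed (use G in \<open>simp add: G_def B'(1) \<epsilon> less_imp_le m\<close>)
      have iS: "integrable lebesgue (\<lambda>y. indicator (S k) y * (B' + 4 * m k * \<epsilon>))"
        using Sm[of k] by (intro integrable_mult_left integrable_real_indicator) (auto simp: fmeasurable_def)
      have iG: "integrable (lebesgue_on \<Omega>) (\<lambda>x. \<bar>w x \<bullet> gradient (\<zeta> k) x\<bar>)"
        by (intro integrable_lebesgue_on_continuous_closure \<Omega> continuous_intros w
            continuous_on_subset[OF Ck_on_continuous_gradient[OF C\<zeta>]]) simp
      have "?I k = integral\<^sup>L lebesgue (\<lambda>y. indicator \<Omega> y * \<bar>w y \<bullet> gradient (\<zeta> k) y\<bar>)"
        by (rule lebesgue_on_integral_eq[OF \<Omega>(1)])
      also have "\<dots> \<le> integral\<^sup>L lebesgue (\<lambda>y. indicator (S k) y * (B' + 4 * m k * \<epsilon>))"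
      proof (rule integral_mono[OF _ iS])
        show "integrable lebesgue (\<lambda>y. indicator \<Omega> y * \<bar>w y \<bullet> gradient (\<zeta> k) y\<bar>)"
          using iG by (simp add: lebesgue_on_integrable_iff[OF \<Omega>(1)])
        show "indicator \<Omega> y * \<bar>w y \<bullet> gradient (\<zeta> k) y\<bar> \<le> indicator (S k) y * (B' + 4 * m k * \<epsilon>)" for y
          using pt[of y] B' \<epsilon> m[of k] by (cases "y \<in> \<Omega>") (auto simp: indicator_def)
      qed
      also have "\<dots> = measure lebesgue (S k) * (B' + 4 * m k * \<epsilon>)" by simp
      also have "\<dots> \<le> C * (2 / m k) * (B' + 4 * m k * \<epsilon>)"
        using B' \<epsilon> m[of k] by (intro mult_right_mono meas) auto
      also have "\<dots> = 2 * C * B' / m k + 8 * C * \<epsilon>" using m[of k] by (simp add: field_simps)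
      also have "\<dots> < \<eta>"
      proof -
        have "2 * C * B' \<le> 2 * ((C + 1) * (B' + 1))" using C0 B' by (simp add: algebra_simps)
        moreover have "4 * ((C + 1) * (B' + 1)) < \<eta> * m k" using mk(2) \<eta> by (simp add: field_simps)
        ultimately have "2 * C * B' < (\<eta> / 2) * m k" by linarith
        then have 1: "2 * C * B' / m k < \<eta> / 2" using m[of k] by (simp add: divide_less_eq)
        have "8 * C * \<epsilon> \<le> 8 * (C + 1) * \<epsilon>" using \<epsilon> by simp
        also have "\<dots> = \<eta> / 2" using C0 by (simp add: \<epsilon>_def field_simps)
        finally show ?thesis using 1 by linarith
      qed
      finally show ?thesis .
    qed
    moreover have "?I k \<ge> 0" for k by simp
    ultimately show "\<exists>no. \<forall>k\<ge>no. norm (?I k - 0) < \<eta>" by (intro exI[of _ K]) simp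
  qed
  then have "boundary_cutoffs \<Omega> w (frontier \<Omega> \<inter> ball x0 r) \<zeta>"
    unfolding boundary_cutoffs_def using C\<zeta> bounds lim V by blast
  then show ?thesis using r(1) by blast
qed

text \<open>Finitely many of the local balls cover the compact boundary; the product of their cutoffs vanishes
  near all of it.\<close>

lemma boundary_cutoffs_exist:
  assumes \<Omega>: "open \<Omega>" "bounded \<Omega>" "Ck_boundary (Suc k) \<Omega>" and w: "continuous_on (closure \<Omega>) w"
    and normal: "\<And>x. x \<in> frontier \<Omega> \<Longrightarrow> w x \<bullet> outward_normal \<Omega> x = 0"
  shows "\<exists>\<zeta>. boundary_cutoffs \<Omega> w (frontier \<Omega>) \<zeta>"
proof -
  have low: "\<exists>U \<rho>. local_defining_function (Suc 0) \<Omega> x U \<rho>" if x: "x \<in> frontier \<Omega>" for x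
  proof -
    obtain U \<rho> where "local_defining_function (Suc k) \<Omega> x U \<rho>"
      using \<Omega>(3) x unfolding Ck_boundary_def by metis
    then have "local_defining_function (Suc 0) \<Omega> x U \<rho>"
    proof (induction k)
      case (Suc j)
      have "x \<in> U" using Suc.prems by (simp add: local_defining_function_def)
      from Suc.IH[OF local_defining_function_lower[OF Suc.prems this]] show ?case .
    qed
    then show ?thesis by (intro exI)
  qed
  have "\<exists>r. \<forall>x\<in>frontier \<Omega>. r x > 0 \<and> (\<exists>\<zeta>. boundary_cutoffs \<Omega> w (frontier \<Omega> \<inter> ball x (r x)) \<zeta>)"
  proof (rule bchoice, rule ballI)
    fix x assume x: "x \<in> frontier \<Omega>"
    obtain U \<rho> where "local_defining_function (Suc 0) \<Omega> x U \<rho>" using low[OF x] by metis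
    from local_boundary_cutoffs[OF \<Omega>(1,2) w normal x this]
    show "\<exists>r>0. \<exists>\<zeta>. boundary_cutoffs \<Omega> w (frontier \<Omega> \<inter> ball x r) \<zeta>" by blast
  qed
  then obtain r where r: "\<And>x. x \<in> frontier \<Omega> \<Longrightarrow> r x > 0"
    "\<And>x. x \<in> frontier \<Omega> \<Longrightarrow> \<exists>\<zeta>. boundary_cutoffs \<Omega> w (frontier \<Omega> \<inter> ball x (r x)) \<zeta>" by blast
  have "compact (frontier \<Omega>)" using \<Omega>(2) by (rule compact_frontier_bounded)
  then obtain F where F: "F \<subseteq> frontier \<Omega>" "finite F" "frontier \<Omega> \<subseteq> (\<Union>x\<in>F. ball x (r x))"
    by (rule compactE_image[where f="\<lambda>x. ball x (r x)" and C="frontier \<Omega>"]) (use r(1) in force)+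
  have "\<exists>\<zeta>. boundary_cutoffs \<Omega> w (\<Union>x\<in>F. frontier \<Omega> \<inter> ball x (r x)) \<zeta>"
    using F(2,1)
  proof (induction F rule: finite_induct)
    case empty
    then show ?case using boundary_cutoffs_empty by auto
  next
    case (insert x F)
    then obtain \<zeta> where 1: "boundary_cutoffs \<Omega> w (\<Union>x\<in>F. frontier \<Omega> \<inter> ball x (r x)) \<zeta>" by auto
    have "x \<in> frontier \<Omega>" using insert by blast
    then obtain \<zeta>' where 2: "boundary_cutoffs \<Omega> w (frontier \<Omega> \<inter> ball x (r x)) \<zeta>'" using r(2) by blast
    show ?case unfolding UN_insert
      by (intro exI[of _ "\<lambda>k x. \<zeta>' k x * \<zeta> k x"] boundary_cutoffs_mult \<Omega> w 1 2)
  qed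
  then obtain \<zeta> where \<zeta>: "boundary_cutoffs \<Omega> w (\<Union>x\<in>F. frontier \<Omega> \<inter> ball x (r x)) \<zeta>" by blast
  have "frontier \<Omega> \<subseteq> (\<Union>x\<in>F. frontier \<Omega> \<inter> ball x (r x))" using F(3) by blast
  from boundary_cutoffs_subset[OF \<zeta> this] show ?thesis by blast
qed

section \<open>Square integrable functions and first order Sobolev spaces\<close>

text \<open>Lebesgue measure is complete, so of two functions equal almost everywhere both or neither are measurable.\<close>

lemma lebesgue_cong_AE:
  fixes f g :: "'a::euclidean_space \<Rightarrow> real"
  assumes "AE x in lebesgue. f x = g x"
  shows "integrable lebesgue f \<longleftrightarrow> integrable lebesgue g" "integral\<^sup>L lebesgue f = integral\<^sup>L lebesgue g"
proof -
  have sym: "AE x in lebesgue. g x = f x" using assms by eventually_elim simp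
  have m: "f \<in> borel_measurable lebesgue \<longleftrightarrow> g \<in> borel_measurable lebesgue"
    using borel_measurable_AE[OF _ assms] borel_measurable_AE[OF _ sym] by blast
  show 1: "integrable lebesgue f \<longleftrightarrow> integrable lebesgue g"
    using integrable_cong_AE_imp[OF _ _ assms] integrable_cong_AE_imp[OF _ _ sym] m borel_measurable_integrable by metis
  show "integral\<^sup>L lebesgue f = integral\<^sup>L lebesgue g"
  proof (cases "f \<in> borel_measurable lebesgue")
    case True
    then show ?thesis using m assms by (intro integral_cong_AE) auto
  next
    case False
    then have "\<not> integrable lebesgue f" "\<not> integrable lebesgue g" using m by auto
    then show ?thesis by (simp add: not_integrable_integral_eq)
  qed
qed

lemma lebesgue_on_cong_AE:
  fixes f g :: "'a::euclidean_space \<Rightarrow> real"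
  assumes "open \<Omega>" "AE x in lebesgue_on \<Omega>. f x = g x"
  shows "integrable (lebesgue_on \<Omega>) f \<longleftrightarrow> integrable (lebesgue_on \<Omega>) g"
    "integral\<^sup>L (lebesgue_on \<Omega>) f = integral\<^sup>L (lebesgue_on \<Omega>) g"
proof -
  have "AE x in lebesgue. indicator \<Omega> x * f x = indicator \<Omega> x * g x"
    using assms(2)[unfolded AE_lebesgue_on_iff[OF assms(1)]] by eventually_elim (auto simp: indicator_def)
  from lebesgue_cong_AE[OF this] show "integrable (lebesgue_on \<Omega>) f \<longleftrightarrow> integrable (lebesgue_on \<Omega>) g"
    "integral\<^sup>L (lebesgue_on \<Omega>) f = integral\<^sup>L (lebesgue_on \<Omega>) g"
    by (simp_all add: lebesgue_on_integrable_iff[OF assms(1)] lebesgue_on_integral_eq[OF assms(1)])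
qed

lemma lebesgue_on_measurable_AE:
  fixes f g :: "'a::euclidean_space \<Rightarrow> 'b::euclidean_space"
  assumes "open \<Omega>" "AE x in lebesgue_on \<Omega>. f x = g x" "f \<in> borel_measurable (lebesgue_on \<Omega>)"
  shows "g \<in> borel_measurable (lebesgue_on \<Omega>)"
proof -
  have \<Omega>: "\<Omega> \<inter> space lebesgue \<in> sets lebesgue" using assms(1) by simp
  have f: "(\<lambda>x. indicator \<Omega> x *\<^sub>R f x) \<in> borel_measurable lebesgue"
    using assms(3) borel_measurable_restrict_space_iff[OF \<Omega>, of f] by simp
  have "AE x in lebesgue. indicator \<Omega> x *\<^sub>R f x = indicator \<Omega> x *\<^sub>R g x"
    using assms(2)[unfolded AE_lebesgue_on_iff[OF assms(1)]] by eventually_elim (auto simp: indicator_def)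
  from borel_measurable_AE[OF f this] show ?thesis
    using borel_measurable_restrict_space_iff[OF \<Omega>, of g] by simp
qed

lemma L2_cong_AE:
  assumes "open \<Omega>" "AE x in lebesgue_on \<Omega>. f x = g x" "f \<in> L2 \<Omega>"
  shows "g \<in> L2 \<Omega>"
proof -
  have "AE x in lebesgue_on \<Omega>. (norm (f x))\<^sup>2 = (norm (g x))\<^sup>2"
    using assms(2) by eventually_elim simp
  from lebesgue_on_cong_AE(1)[OF assms(1) this] lebesgue_on_measurable_AE[OF assms(1,2)] assms(3)
  show ?thesis by (simp add: L2_def)
qed

lemma L2_inner_cong_AE:
  assumes "open \<Omega>" "AE x in lebesgue_on \<Omega>. f x = f' x" "AE x in lebesgue_on \<Omega>. g x = g' x"
  shows "L2_inner \<Omega> f g = L2_inner \<Omega> f' g'"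
  unfolding L2_inner_def
  by (rule lebesgue_on_cong_AE(2)[OF assms(1)]) (use assms(2,3) in eventually_elim, simp)

lemma L2_inner_integrable:
  assumes "f \<in> L2 \<Omega>" "g \<in> L2 \<Omega>"
  shows "integrable (lebesgue_on \<Omega>) (\<lambda>x. f x \<bullet> g x)"
proof (rule Bochner_Integration.integrable_bound)
  show "integrable (lebesgue_on \<Omega>) (\<lambda>x. (norm (f x))\<^sup>2 + (norm (g x))\<^sup>2)" using assms by (auto simp: L2_def)
  show "(\<lambda>x. f x \<bullet> g x) \<in> borel_measurable (lebesgue_on \<Omega>)" using assms by (auto simp: L2_def)
  have "\<bar>f x \<bullet> g x\<bar> \<le> (norm (f x))\<^sup>2 + (norm (g x))\<^sup>2" for x
  proof -
    have "\<bar>f x \<bullet> g x\<bar> \<le> norm (f x) * norm (g x)" by (rule Cauchy_Schwarz_ineq2)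
    also have "\<dots> \<le> 2 * norm (f x) * norm (g x)" by simp
    also have "\<dots> \<le> (norm (f x))\<^sup>2 + (norm (g x))\<^sup>2" by (rule sum_squares_bound)
    finally show ?thesis .
  qed
  then show "AE x in lebesgue_on \<Omega>. norm (f x \<bullet> g x) \<le> norm ((norm (f x))\<^sup>2 + (norm (g x))\<^sup>2)" by simp
qed

lemma L2_add_scaleR:
  assumes "f \<in> L2 \<Omega>" "g \<in> L2 \<Omega>"
  shows "(\<lambda>x. f x + c *\<^sub>R g x) \<in> L2 \<Omega>"
proof -
  have "(norm (f x + c *\<^sub>R g x))\<^sup>2 = (norm (f x))\<^sup>2 + 2 * c * (f x \<bullet> g x) + c\<^sup>2 * (norm (g x))\<^sup>2" for x
    unfolding power2_norm_eq_inner
    by (simp add: inner_add_left inner_add_right inner_commute power2_eq_square algebra_simps)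
  then show ?thesis
    using assms L2_inner_integrable[OF assms] by (auto simp: L2_def)
qed

lemma L2_inner_add_scaleR:
  assumes "f \<in> L2 \<Omega>" "g \<in> L2 \<Omega>" "h \<in> L2 \<Omega>"
  shows "L2_inner \<Omega> (\<lambda>x. f x + c *\<^sub>R g x) h = L2_inner \<Omega> f h + c * L2_inner \<Omega> g h"
  using L2_inner_integrable[OF assms(1,3)] L2_inner_integrable[OF assms(2,3)]
  by (simp add: L2_inner_def inner_add_left)

lemma L2_norm_power2: "(L2_norm \<Omega> f)\<^sup>2 = L2_inner \<Omega> f f"
  by (simp add: L2_norm_def L2_inner_def)

lemma L2_inner_self_nonneg: "0 \<le> L2_inner \<Omega> f f"
  by (simp add: L2_inner_def)

lemma integrable_bounded_lebesgue_on:
  assumes "open \<Omega>" "bounded (\<Omega> :: 'a::euclidean_space set)"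
  shows "integrable (lebesgue_on \<Omega>) (\<lambda>x. c :: real)"
  by (rule integrable_lebesgue_on_continuous_closure[OF assms]) simp

lemma L2_imp_integrable:
  fixes f :: "real^2 \<Rightarrow> real"
  assumes "open \<Omega>" "bounded \<Omega>" "f \<in> L2 \<Omega>"
  shows "integrable (lebesgue_on \<Omega>) f"
proof -
  have "(\<lambda>x. 1 :: real) \<in> L2 \<Omega>" using integrable_bounded_lebesgue_on[OF assms(1,2)] by (simp add: L2_def)
  from L2_inner_integrable[OF assms(3) this] show ?thesis by simp
qed

lemma locally_integrable_L2:
  assumes "open \<Omega>" "bounded \<Omega>" "f \<in> L2 \<Omega>"
  shows "locally_integrable \<Omega> f"
  unfolding locally_integrable_iff
proof (intro allI impI)
  fix K assume K: "compact K \<and> K \<subseteq> \<Omega>"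
  then have "integrable lebesgue (\<lambda>x. indicator K x *\<^sub>R (indicator \<Omega> x * f x))"
    using L2_imp_integrable[OF assms] unfolding lebesgue_on_integrable_iff[OF assms(1)]
    by (intro integrable_mult_indicator) (auto simp: compact_imp_closed borel_closed)
  moreover have "indicator K x *\<^sub>R (indicator \<Omega> x * f x) = indicator K x * f x" for x
    using K by (auto simp: indicator_def)
  ultimately show "integrable lebesgue (\<lambda>x. indicator K x * f x)" by (simp only:)
qed

lemma locally_integrable_cong_AE:
  assumes "open \<Omega>" "AE x in lebesgue_on \<Omega>. f x = g x" "locally_integrable \<Omega> f"
  shows "locally_integrable \<Omega> g"
  unfolding locally_integrable_iff
proof (intro allI impI)
  fix K assume K: "compact K \<and> K \<subseteq> \<Omega>"
  have "AE x in lebesgue. indicator K x * f x = indicator K x * g x"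
    using assms(2)[unfolded AE_lebesgue_on_iff[OF assms(1)]] by eventually_elim (use K in \<open>auto simp: indicator_def\<close>)
  from lebesgue_cong_AE(1)[OF this] show "integrable lebesgue (\<lambda>x. indicator K x * g x)"
    using assms(3) K by (simp add: locally_integrable_iff)
qed

lemma has_weak_partial_cong_AE:
  assumes "open \<Omega>" "AE x in lebesgue_on \<Omega>. f x = f' x" "AE x in lebesgue_on \<Omega>. g x = g' x" "has_weak_partial \<Omega> i f g"
  shows "has_weak_partial \<Omega> i f' g'"
proof -
  have "L2_inner \<Omega> f h = L2_inner \<Omega> f' h" "L2_inner \<Omega> g h = L2_inner \<Omega> g' h" for h :: "real^2 \<Rightarrow> real"
    using assms by (auto intro!: L2_inner_cong_AE)
  then show ?thesis
    using assms locally_integrable_cong_AE[OF assms(1)] unfolding has_weak_partial_def by metis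
qed

lemma sobolev_1:
  assumes "open \<Omega>" "f \<in> sobolev \<Omega> 1"
  shows "f \<in> L2 \<Omega>" "has_weak_partial \<Omega> i f (weak_partial \<Omega> i f)" "weak_partial \<Omega> i f \<in> L2 \<Omega>"
proof -
  show "f \<in> L2 \<Omega>" using assms(2) by simp
  obtain g where g: "g \<in> L2 \<Omega>" "has_weak_partial \<Omega> i f g" using assms(2) by auto
  note w = weak_partial_AE_eq[OF assms(1) g(2)]
  show "has_weak_partial \<Omega> i f (weak_partial \<Omega> i f)" by (rule w)
  have "AE x in lebesgue_on \<Omega>. g x = weak_partial \<Omega> i f x" using w(2) by eventually_elim simp
  from L2_cong_AE[OF assms(1) this g(1)] show "weak_partial \<Omega> i f \<in> L2 \<Omega>" .
qed

lemma sobolev_1I: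
  assumes "f \<in> L2 \<Omega>" "\<And>i. has_weak_partial \<Omega> i f (g i)" "\<And>i. g i \<in> L2 \<Omega>"
  shows "f \<in> sobolev \<Omega> 1"
  using assms by auto

lemma sobolev_1_cong_AE:
  assumes "open \<Omega>" "AE x in lebesgue_on \<Omega>. f x = g x" "f \<in> sobolev \<Omega> 1"
  shows "g \<in> sobolev \<Omega> 1"
proof (rule sobolev_1I)
  show "g \<in> L2 \<Omega>" by (rule L2_cong_AE[OF assms(1,2) sobolev_1(1)[OF assms(1,3)]])
  show "has_weak_partial \<Omega> i g (weak_partial \<Omega> i f)" for i
    by (rule has_weak_partial_cong_AE[OF assms(1,2) _ sobolev_1(2)[OF assms(1,3)]]) simp
  show "weak_partial \<Omega> i f \<in> L2 \<Omega>" for i by (rule sobolev_1(3)[OF assms(1,3)])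
qed

lemma sobolev_2:
  assumes "open \<Omega>" "f \<in> sobolev \<Omega> 2"
  shows "f \<in> sobolev \<Omega> 1" "weak_partial \<Omega> i f \<in> sobolev \<Omega> 1"
proof -
  have *: "f \<in> L2 \<Omega>" "\<exists>g\<in>sobolev \<Omega> 1. has_weak_partial \<Omega> i f g" for i
    using assms(2) by (auto simp: numeral_2_eq_2)
  show "f \<in> sobolev \<Omega> 1" using * by auto
  obtain g where g: "g \<in> sobolev \<Omega> 1" "has_weak_partial \<Omega> i f g" using *(2) by blast
  have "AE x in lebesgue_on \<Omega>. g x = weak_partial \<Omega> i f x" using weak_partial_AE_eq(2)[OF assms(1) g(2)] by eventually_elim simp
  from sobolev_1_cong_AE[OF assms(1) this g(1)] show "weak_partial \<Omega> i f \<in> sobolev \<Omega> 1" .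
qed

lemma sobolev_1_add:
  assumes "open \<Omega>" "f \<in> sobolev \<Omega> 1" "g \<in> sobolev \<Omega> 1"
  shows "(\<lambda>x. f x + c * g x) \<in> sobolev \<Omega> 1"
    "AE x in lebesgue_on \<Omega>. weak_partial \<Omega> i (\<lambda>x. f x + c * g x) x = weak_partial \<Omega> i f x + c * weak_partial \<Omega> i g x"
proof -
  note f = sobolev_1[OF assms(1,2)] and g = sobolev_1[OF assms(1,3)]
  have w: "has_weak_partial \<Omega> i (\<lambda>x. f x + c * g x) (\<lambda>x. weak_partial \<Omega> i f x + c * weak_partial \<Omega> i g x)" for i
    by (rule has_weak_partial_add[OF assms(1) f(2) g(2)])
  show "(\<lambda>x. f x + c * g x) \<in> sobolev \<Omega> 1"
  proof (rule sobolev_1I[OF _ w])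
    show "(\<lambda>x. f x + c * g x) \<in> L2 \<Omega>" using L2_add_scaleR[OF f(1) g(1), of c] by simp
    show "(\<lambda>x. weak_partial \<Omega> i f x + c * weak_partial \<Omega> i g x) \<in> L2 \<Omega>" for i
      using L2_add_scaleR[OF f(3) g(3), of i c] by simp
  qed
  show "AE x in lebesgue_on \<Omega>. weak_partial \<Omega> i (\<lambda>x. f x + c * g x) x = weak_partial \<Omega> i f x + c * weak_partial \<Omega> i g x"
    by (rule weak_partial_AE_eq(2)[OF assms(1) w])
qed

lemma borel_measurable_vec_componentwise:
  fixes f :: "'a \<Rightarrow> 'b::euclidean_space ^ 'n"
  assumes "\<And>i. (\<lambda>x. f x $ i) \<in> borel_measurable M"
  shows "f \<in> borel_measurable M"
  by (subst borel_measurable_euclidean_space)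
    (use assms in \<open>auto simp: Basis_vec_def inner_axis\<close>)

lemma weak_grad_L2:
  assumes "open \<Omega>" "f \<in> sobolev \<Omega> 1" shows "weak_grad \<Omega> f \<in> L2 \<Omega>"
proof -
  note L = sobolev_1(3)[OF assms]
  have m: "weak_grad \<Omega> f \<in> borel_measurable (lebesgue_on \<Omega>)"
    by (rule borel_measurable_vec_componentwise) (use L in \<open>auto simp: L2_def weak_grad_def\<close>)
  have "(norm (weak_grad \<Omega> f x))\<^sup>2 = (\<Sum>i\<in>UNIV. (norm (weak_partial \<Omega> i f x))\<^sup>2)" for x
    by (simp add: norm_eq_sqrt_inner inner_vec_def weak_grad_def power2_eq_square sum_nonneg)
  then show ?thesis using m L by (simp add: L2_def)
qed

text \<open>The situation met after smoothing: one factor converges almost everywhere and stays bounded, the other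
  converges in the mean.\<close>

lemma integral_product_limit:
  fixes g :: "nat \<Rightarrow> 'a \<Rightarrow> real"
  assumes A: "\<And>k. A k \<in> borel_measurable M" "\<And>k. AE x in M. \<bar>A k x\<bar> \<le> B" "A' \<in> borel_measurable M"
    "AE x in M. (\<lambda>k. A k x) \<longlonglongrightarrow> A' x" "B \<ge> 0"
    and g: "\<And>k. integrable M (g k)" "integrable M g'" "(\<lambda>k. integral\<^sup>L M (\<lambda>x. \<bar>g k x - g' x\<bar>)) \<longlonglongrightarrow> 0"
  shows "(\<lambda>k. integral\<^sup>L M (\<lambda>x. A k x * g k x)) \<longlonglongrightarrow> integral\<^sup>L M (\<lambda>x. A' x * g' x)"
    and "\<And>k. integrable M (\<lambda>x. A k x * g k x)"
proof -
  have int: "integrable M (\<lambda>x. A k x * h x)" if "integrable M h" for h :: "'a \<Rightarrow> real" and k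
  proof (rule Bochner_Integration.integrable_bound)
    show "integrable M (\<lambda>x. B * h x)" using that by simp
    show "AE x in M. norm (A k x * h x) \<le> norm (B * h x)"
      using A(2)[of k] by eventually_elim (use A(5) in \<open>auto simp: abs_mult intro: mult_right_mono\<close>)
  qed (use A that in auto)
  show "\<And>k. integrable M (\<lambda>x. A k x * g k x)" by (rule int[OF g(1)])
  have "(\<lambda>k. integral\<^sup>L M (\<lambda>x. A k x * (g k x - g' x))) \<longlonglongrightarrow> 0"
  proof (rule Lim_null_comparison)
    have "norm (integral\<^sup>L M (\<lambda>x. A k x * (g k x - g' x))) \<le> B * integral\<^sup>L M (\<lambda>x. \<bar>g k x - g' x\<bar>)" for k
    proof -
      have "norm (integral\<^sup>L M (\<lambda>x. A k x * (g k x - g' x))) \<le> integral\<^sup>L M (\<lambda>x. norm (A k x * (g k x - g' x)))"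
        by (rule integral_norm_bound)
      also have "\<dots> \<le> integral\<^sup>L M (\<lambda>x. B * \<bar>g k x - g' x\<bar>)"
      proof (rule integral_mono_AE)
        show "integrable M (\<lambda>x. norm (A k x * (g k x - g' x)))" by (intro integrable_norm int) (use g in auto)
        show "integrable M (\<lambda>x. B * \<bar>g k x - g' x\<bar>)" using g by auto
        show "AE x in M. norm (A k x * (g k x - g' x)) \<le> B * \<bar>g k x - g' x\<bar>"
          using A(2)[of k] by eventually_elim (auto simp: abs_mult intro: mult_right_mono)
      qed
      finally show ?thesis by simp
    qed
    then show "\<forall>\<^sub>F k in sequentially. norm (integral\<^sup>L M (\<lambda>x. A k x * (g k x - g' x))) \<le> B * integral\<^sup>L M (\<lambda>x. \<bar>g k x - g' x\<bar>)"
      by simp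
    show "(\<lambda>k. B * integral\<^sup>L M (\<lambda>x. \<bar>g k x - g' x\<bar>)) \<longlonglongrightarrow> 0" using tendsto_mult_right_zero[OF g(3)] by simp
  qed
  moreover have "(\<lambda>k. integral\<^sup>L M (\<lambda>x. A k x * g' x)) \<longlonglongrightarrow> integral\<^sup>L M (\<lambda>x. A' x * g' x)"
  proof (rule integral_dominated_convergence[where w="\<lambda>x. B * \<bar>g' x\<bar>"])
    show "AE x in M. (\<lambda>k. A k x * g' x) \<longlonglongrightarrow> A' x * g' x"
      using A(4) by eventually_elim (intro tendsto_intros)
    show "AE x in M. norm (A k x * g' x) \<le> B * \<bar>g' x\<bar>" for k
      using A(2)[of k] by eventually_elim (auto simp: abs_mult intro: mult_right_mono)
  qed (use A g in auto)
  ultimately have "(\<lambda>k. integral\<^sup>L M (\<lambda>x. A k x * (g k x - g' x)) + integral\<^sup>L M (\<lambda>x. A k x * g' x))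
      \<longlonglongrightarrow> 0 + integral\<^sup>L M (\<lambda>x. A' x * g' x)" by (rule tendsto_add)
  moreover have "integral\<^sup>L M (\<lambda>x. A k x * (g k x - g' x)) + integral\<^sup>L M (\<lambda>x. A k x * g' x) = integral\<^sup>L M (\<lambda>x. A k x * g k x)" for k
  proof -
    have "integral\<^sup>L M (\<lambda>x. A k x * (g k x - g' x)) + integral\<^sup>L M (\<lambda>x. A k x * g' x)
      = integral\<^sup>L M (\<lambda>x. A k x * (g k x - g' x) + A k x * g' x)"
      by (rule Bochner_Integration.integral_add[symmetric]) (use g in \<open>auto intro!: int\<close>)
    then show ?thesis by (simp add: algebra_simps)
  qed
  ultimately show "(\<lambda>k. integral\<^sup>L M (\<lambda>x. A k x * g k x)) \<longlonglongrightarrow> integral\<^sup>L M (\<lambda>x. A' x * g' x)" by simp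
qed

section \<open>Tangential solenoidal fields are orthogonal to gradients\<close>

text \<open>This is the product rule for \<open>div (\<theta> \<beta>(H) w)\<close> with \<open>w\<close> solenoidal. It holds for the
  smoothed functions in place of \<open>H\<close>, since then \<open>\<theta> \<beta>(H)\<close> is an admissible test function, and it
  survives the limit because \<open>\<beta>\<close> and its derivative are bounded.\<close>

lemma weighted_divergence_identity:
  assumes \<Omega>: "open \<Omega>" "bounded \<Omega>" and H: "H \<in> sobolev \<Omega> 1" and w: "continuous_on (closure \<Omega>) w"
    and div: "\<And>h. compact_Ck (Suc 0) \<Omega> h \<Longrightarrow> integral\<^sup>L (lebesgue_on \<Omega>) (\<lambda>x. w x \<bullet> gradient h x) = 0"
    and \<theta>: "compact_Ck (Suc 0) \<Omega> \<theta>"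
    and \<beta>: "\<And>t. (\<beta> has_real_derivative \<beta>' t) (at t)" "continuous_on UNIV \<beta>'"
      "\<And>t. \<bar>\<beta> t\<bar> \<le> M" "\<And>t. \<bar>\<beta>' t\<bar> \<le> 1"
  shows "integral\<^sup>L (lebesgue_on \<Omega>) (\<lambda>x. (\<theta> x * \<beta>' (H x)) * (w x \<bullet> weak_grad \<Omega> H x))
    = - integral\<^sup>L (lebesgue_on \<Omega>) (\<lambda>x. \<beta> (H x) * (w x \<bullet> gradient \<theta> x))"
proof -
  let ?K = "closure {x. \<theta> x \<noteq> 0}" and ?L = "lebesgue_on \<Omega>"
  have K: "compact ?K" "?K \<subseteq> \<Omega>" using \<theta> unfolding compact_Ck_def by blast+
  obtain e where e: "e > 0" "\<And>r. r < e \<Longrightarrow> (\<Union>x\<in>?K. cball x r) \<subseteq> \<Omega>"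
    using compact_cball_neighbourhood[OF K \<Omega>(1)] by metis
  define F where "F = (\<lambda>x. indicator \<Omega> x * H x)"
  define G where "G = (\<lambda>i x. indicator \<Omega> x * weak_partial \<Omega> i H x)"
  note HL = sobolev_1[OF \<Omega>(1) H]
  have iH: "integrable ?L H" and iG: "integrable ?L (weak_partial \<Omega> i H)" for i
    using L2_imp_integrable[OF \<Omega>] HL(1,3) by auto
  have F: "integrable lebesgue F" and G: "integrable lebesgue (G i)" for i
    using iH iG by (simp_all add: F_def G_def lebesgue_on_integrable_iff[OF \<Omega>(1)])
  define r where "r = (\<lambda>k. e / 2 * inverse (real (Suc k)))"
  have r: "0 < r k" "r k < e" for k
  proof -
    have "e / 2 * inverse (real (Suc k)) \<le> e / 2 * 1"
      using e(1) by (intro mult_left_mono) (auto simp: inverse_le_1_iff)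
    then show "0 < r k" "r k < e" using e(1) by (auto simp: r_def)
  qed
  have r0: "r \<longlonglongrightarrow> 0"
    unfolding r_def using tendsto_mult_right_zero[OF LIMSEQ_inverse_real_of_nat] by blast
  have L1: "(\<lambda>k. integral\<^sup>L lebesgue (\<lambda>x. \<bar>smoothing h (mollifier (r k)) x - h x\<bar>)) \<longlonglongrightarrow> 0"
    if h: "integrable lebesgue h" for h
  proof (rule tendstoI)
    fix d :: real assume d: "d > 0"
    obtain c where c: "c > 0" "\<And>r. 0 < r \<Longrightarrow> r < c \<Longrightarrow>
        integral\<^sup>L lebesgue (\<lambda>x. \<bar>smoothing h (mollifier r) x - h x\<bar>) \<le> d / 2"
      using smoothing_L1(2)[OF h, of "d / 2"] d by auto
    have "\<forall>\<^sub>F k in sequentially. r k < c" using r0 c(1) by (rule order_tendstoD(2))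
    then show "\<forall>\<^sub>F k in sequentially.
        dist (integral\<^sup>L lebesgue (\<lambda>x. \<bar>smoothing h (mollifier (r k)) x - h x\<bar>)) 0 < d"
    proof eventually_elim
      case (elim k)
      have "0 \<le> integral\<^sup>L lebesgue (\<lambda>x. \<bar>smoothing h (mollifier (r k)) x - h x\<bar>)" by simp
      with c(2)[OF r(1) elim] d show ?case by (simp add: dist_real_def)
    qed
  qed
  define f where "f = (\<lambda>k. smoothing F (mollifier (r k)))"
  define g where "g = (\<lambda>i k. smoothing (G i) (mollifier (r k)))"
  have "(\<lambda>k. integral\<^sup>L lebesgue (\<lambda>x. norm (f k x - F x))) \<longlonglongrightarrow> 0"
    using L1[OF F] by (simp add: f_def)
  from tendsto_L1_AE_subseq[OF _ this]
  obtain s :: "nat \<Rightarrow> nat" where s: "strict_mono s" "AE x in lebesgue. (\<lambda>k. f (s k) x - F x) \<longlonglongrightarrow> 0"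
    using smoothing_L1(1)[OF F r(1)] unfolding f_def by blast
  have aeF: "AE x in ?L. (\<lambda>k. f (s k) x) \<longlonglongrightarrow> H x"
    unfolding AE_lebesgue_on_iff[OF \<Omega>(1)] using s(2)
    by eventually_elim (auto simp: F_def LIM_zero_iff)
  have Cf: "Ck_on n UNIV (f k)" for n k
    unfolding f_def by (rule Ck_on_smoothing[OF F compact_Ck_mollifier[OF r(1)]])
  have Cg: "Ck_on n UNIV (g i k)" for n k i
    unfolding g_def by (rule Ck_on_smoothing[OF G compact_Ck_mollifier[OF r(1)]])
  have Cchi: "Ck_on (Suc 0) UNIV \<theta>" using \<theta> by (simp add: compact_Ck_def del: Ck_on.simps)
  have pf: "\<theta> x * partial_deriv i (f k) x = \<theta> x * g i k x" for x i k
  proof (cases "x \<in> ?K")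
    case True
    have sub: "cball x (r k) \<subseteq> \<Omega>" using e(2)[OF r(2), of k] True by blast
    have "partial_deriv i (f k) x = g i k x"
      unfolding f_def g_def F_def G_def
      by (rule smoothing_weak_partial[OF HL(2) \<Omega>(1) order_refl sub r(1)]) (use F in \<open>simp add: F_def\<close>)
    then show ?thesis by simp
  next
    case False
    from compact_Ck_zero[OF \<theta> this] show ?thesis by simp
  qed
  note B1 = Ck1_compose[OF Cf \<beta>(1,2)]
  have id: "(\<Sum>i\<in>UNIV. integral\<^sup>L ?L (\<lambda>x. (\<theta> x * \<beta>' (f k x) * w x $ i) * g i k x))
      + integral\<^sup>L ?L (\<lambda>x. \<beta> (f k x) * (w x \<bullet> gradient \<theta> x)) = 0" for k
  proof -
    have c\<beta>: "continuous_on UNIV \<beta>"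
      using \<beta>(1) by (meson DERIV_continuous_on has_field_derivative_at_within)
    have cs: "continuous_on S (f k)" "continuous_on S (g i k)" "continuous_on S \<theta>" "continuous_on S (gradient \<theta>)" for i S
      using Ck_on_continuous[OF Cf[of 0]] Ck_on_continuous[OF Cg[of 0]] Ck_on_continuous[OF Cchi]
        Ck_on_continuous_gradient[OF Cchi] continuous_on_subset by blast+
    have i1: "integrable ?L (\<lambda>x. (\<theta> x * \<beta>' (f k x) * w x $ i) * g i k x)" for i
      by (intro integrable_lebesgue_on_continuous_closure \<Omega> continuous_intros cs w
          continuous_on_compose2[OF \<beta>(2) cs(1)]) auto
    have i2: "integrable ?L (\<lambda>x. \<beta> (f k x) * (w x \<bullet> gradient \<theta> x))"
      by (intro integrable_lebesgue_on_continuous_closure \<Omega> continuous_intros cs w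
          continuous_on_compose2[OF c\<beta> cs(1)]) auto
    have "w x \<bullet> gradient (\<lambda>x. \<theta> x * \<beta> (f k x)) x
        = (\<Sum>i\<in>UNIV. (\<theta> x * \<beta>' (f k x) * w x $ i) * g i k x) + \<beta> (f k x) * (w x \<bullet> gradient \<theta> x)" for x
    proof -
      have "\<theta> x * (w x \<bullet> gradient (f k) x) = (\<Sum>i\<in>UNIV. w x $ i * (\<theta> x * partial_deriv i (f k) x))"
        by (simp add: inner_vec_def partial_deriv_eq_gradient sum_distrib_left algebra_simps)
      also have "\<dots> = (\<Sum>i\<in>UNIV. w x $ i * (\<theta> x * g i k x))" by (simp only: pf)
      finally have "\<beta>' (f k x) * (\<theta> x * (w x \<bullet> gradient (f k) x)) = (\<Sum>i\<in>UNIV. (\<theta> x * \<beta>' (f k x) * w x $ i) * g i k x)"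
        by (simp add: sum_distrib_left algebra_simps)
      then show ?thesis
        by (simp add: gradient_mult[OF Cchi B1(1)] B1(2) inner_add_right algebra_simps)
    qed
    then have "integral\<^sup>L ?L (\<lambda>x. (\<Sum>i\<in>UNIV. (\<theta> x * \<beta>' (f k x) * w x $ i) * g i k x) + \<beta> (f k x) * (w x \<bullet> gradient \<theta> x)) = 0"
      using div[OF compact_Ck_mult[OF \<theta> B1(1)], of k] by (simp only:)
    moreover have "integral\<^sup>L ?L (\<lambda>x. (\<Sum>i\<in>UNIV. (\<theta> x * \<beta>' (f k x) * w x $ i) * g i k x) + \<beta> (f k x) * (w x \<bullet> gradient \<theta> x))
      = integral\<^sup>L ?L (\<lambda>x. \<Sum>i\<in>UNIV. (\<theta> x * \<beta>' (f k x) * w x $ i) * g i k x) + integral\<^sup>L ?L (\<lambda>x. \<beta> (f k x) * (w x \<bullet> gradient \<theta> x))"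
      by (rule Bochner_Integration.integral_add) (use i1 i2 in auto)
    moreover have "integral\<^sup>L ?L (\<lambda>x. \<Sum>i\<in>UNIV. (\<theta> x * \<beta>' (f k x) * w x $ i) * g i k x)
      = (\<Sum>i\<in>UNIV. integral\<^sup>L ?L (\<lambda>x. (\<theta> x * \<beta>' (f k x) * w x $ i) * g i k x))"
      by (rule Bochner_Integration.integral_sum) (rule i1)
    ultimately show "(\<Sum>i\<in>UNIV. integral\<^sup>L ?L (\<lambda>x. (\<theta> x * \<beta>' (f k x) * w x $ i) * g i k x))
      + integral\<^sup>L ?L (\<lambda>x. \<beta> (f k x) * (w x \<bullet> gradient \<theta> x)) = 0" by (simp only:)
  qed
  have c\<beta>: "continuous_on UNIV \<beta>"
    using \<beta>(1) by (meson DERIV_continuous_on has_field_derivative_at_within)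
  have cm: "h \<in> borel_measurable ?L" if "continuous_on \<Omega> h" for h :: "real^2 \<Rightarrow> real"
    using that \<Omega>(1) by (intro continuous_imp_measurable_on_sets_lebesgue) auto
  have w\<Omega>: "continuous_on \<Omega> w" using w closure_subset continuous_on_subset by blast
  have cs: "continuous_on \<Omega> (f k)" "continuous_on \<Omega> \<theta>" "continuous_on \<Omega> (gradient \<theta>)" for k
    using Ck_on_continuous[OF Cf[of 0]] Ck_on_continuous[OF Cchi]
        Ck_on_continuous_gradient[OF Cchi] continuous_on_subset by blast+
  have Hm: "H \<in> borel_measurable ?L" using iH by (rule borel_measurable_integrable)
  have \<beta>m: "\<beta> \<in> borel_measurable borel" "\<beta>' \<in> borel_measurable borel"
    using c\<beta> \<beta>(2) by (auto intro: borel_measurable_continuous_onI)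
  have "bounded (w ` closure \<Omega>)"
    using \<Omega>(2) by (intro compact_imp_bounded compact_continuous_image w) (simp add: compact_closure)
  then obtain W where W0: "\<forall>y\<in>w ` closure \<Omega>. norm y \<le> W" unfolding bounded_iff by blast
  have W: "norm (w x) \<le> W" if "x \<in> \<Omega>" for x using W0 that closure_subset by blast
  obtain X where X: "\<And>x. norm (\<theta> x) \<le> X"
    using compact_support_bounded[OF compact_Ck_continuous[OF \<theta>] K(1) compact_Ck_zero[OF \<theta>]] by blast
  have X0: "X \<ge> 0" using X[of 0] norm_ge_zero order_trans by blast
  have M0: "M \<ge> 0" using \<beta>(3)[of 0] by linarith
  have aeO: "AE x in ?L. x \<in> \<Omega>" unfolding AE_lebesgue_on_iff[OF \<Omega>(1)] by simp
  have bound: "\<bar>\<theta> x * \<beta>' t * w x $ i\<bar> \<le> X * \<bar>W\<bar>" if "x \<in> \<Omega>" for x t i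
  proof -
    have wi: "\<bar>w x $ i\<bar> \<le> \<bar>W\<bar>" using component_le_norm_cart[of "w x" i] W[OF that] by linarith
    have "\<bar>\<theta> x\<bar> * \<bar>\<beta>' t\<bar> \<le> X * 1"
      using X[of x] \<beta>(4) X0 by (intro mult_mono) auto
    from mult_mono[OF this wi] show ?thesis using X0 by (simp add: abs_mult)
  qed
  have lim1: "(\<lambda>k. integral\<^sup>L ?L (\<lambda>x. (\<theta> x * \<beta>' (f (s k) x) * w x $ i) * g i (s k) x))
     \<longlonglongrightarrow> integral\<^sup>L ?L (\<lambda>x. (\<theta> x * \<beta>' (H x) * w x $ i) * weak_partial \<Omega> i H x)" for i
  proof (rule integral_product_limit(1)[where B="X * \<bar>W\<bar>"])
    show "(\<lambda>x. \<theta> x * \<beta>' (f (s k) x) * w x $ i) \<in> borel_measurable ?L" for k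
      by (intro cm continuous_intros cs w\<Omega> continuous_on_compose2[OF \<beta>(2) cs(1)]) auto
    show "AE x in ?L. \<bar>\<theta> x * \<beta>' (f (s k) x) * w x $ i\<bar> \<le> X * \<bar>W\<bar>" for k
      using aeO
      by eventually_elim (rule bound)
    show "(\<lambda>x. \<theta> x * \<beta>' (H x) * w x $ i) \<in> borel_measurable ?L"
      using measurable_compose[OF Hm \<beta>m(2)] cm[OF cs(2)] cm[of "\<lambda>x. w x $ i"] w\<Omega>
      by (intro borel_measurable_times) (auto intro: continuous_intros)
    show "AE x in ?L. (\<lambda>k. \<theta> x * \<beta>' (f (s k) x) * w x $ i) \<longlonglongrightarrow> \<theta> x * \<beta>' (H x) * w x $ i"
      using aeF
    proof eventually_elim
      case (elim x)
      have "(\<lambda>k. \<beta>' (f (s k) x)) \<longlonglongrightarrow> \<beta>' (H x)"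
        using continuous_on_tendsto_compose[OF \<beta>(2) elim] by simp
      then show ?case by (intro tendsto_intros)
    qed
    have gi: "integrable lebesgue (g i k)" for k
      using Bochner_Integration.integrable_add[OF smoothing_L1(1)[OF G r(1)] G, of i k i] by (simp add: g_def)
    show "integrable ?L (g i (s k))" for k
      unfolding lebesgue_on_integrable_iff[OF \<Omega>(1)]
      using integrable_mult_indicator[OF _ gi[of "s k"], of \<Omega>] \<Omega>(1) by simp
    show "(\<lambda>k. integral\<^sup>L ?L (\<lambda>x. \<bar>g i (s k) x - weak_partial \<Omega> i H x\<bar>)) \<longlonglongrightarrow> 0"
    proof (rule Lim_null_comparison)
      have "norm (integral\<^sup>L ?L (\<lambda>x. \<bar>g i k x - weak_partial \<Omega> i H x\<bar>))
          \<le> integral\<^sup>L lebesgue (\<lambda>x. \<bar>g i k x - G i x\<bar>)" for k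
      proof -
        have "integral\<^sup>L ?L (\<lambda>x. \<bar>g i k x - weak_partial \<Omega> i H x\<bar>)
            = integral\<^sup>L lebesgue (\<lambda>x. indicator \<Omega> x * \<bar>g i k x - G i x\<bar>)"
          unfolding lebesgue_on_integral_eq[OF \<Omega>(1)]
          by (rule Bochner_Integration.integral_cong) (auto simp: G_def indicator_def)
        also have "\<dots> \<le> integral\<^sup>L lebesgue (\<lambda>x. \<bar>g i k x - G i x\<bar>)"
        proof (rule integral_mono)
          show a: "integrable lebesgue (\<lambda>x. \<bar>g i k x - G i x\<bar>)"
            using smoothing_L1(1)[OF G r(1)] by (simp add: g_def)
          from integrable_mult_indicator[OF _ a, of \<Omega>] \<Omega>(1)
          show "integrable lebesgue (\<lambda>x. indicator \<Omega> x * \<bar>g i k x - G i x\<bar>)" by simp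
        qed (auto simp: indicator_def)
        finally show ?thesis by simp
      qed
      then show "\<forall>\<^sub>F k in sequentially. norm (integral\<^sup>L ?L (\<lambda>x. \<bar>g i (s k) x - weak_partial \<Omega> i H x\<bar>))
          \<le> integral\<^sup>L lebesgue (\<lambda>x. \<bar>g i (s k) x - G i x\<bar>)"
        by simp
      show "(\<lambda>k. integral\<^sup>L lebesgue (\<lambda>x. \<bar>g i (s k) x - G i x\<bar>)) \<longlonglongrightarrow> 0"
        using LIMSEQ_subseq_LIMSEQ[OF L1[OF G] s(1)] by (simp add: o_def g_def)
    qed
  qed (use iG X0 in auto)
  have lim2: "(\<lambda>k. integral\<^sup>L ?L (\<lambda>x. \<beta> (f (s k) x) * (w x \<bullet> gradient \<theta> x)))
     \<longlonglongrightarrow> integral\<^sup>L ?L (\<lambda>x. \<beta> (H x) * (w x \<bullet> gradient \<theta> x))"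
  proof (rule integral_product_limit(1)[where B="M" and g="\<lambda>k x. w x \<bullet> gradient \<theta> x"])
    show "(\<lambda>x. \<beta> (f (s k) x)) \<in> borel_measurable ?L" for k
      by (intro cm continuous_on_compose2[OF c\<beta> cs(1)]) auto
    show "(\<lambda>x. \<beta> (H x)) \<in> borel_measurable ?L" by (rule measurable_compose[OF Hm \<beta>m(1)])
    show "AE x in ?L. (\<lambda>k. \<beta> (f (s k) x)) \<longlonglongrightarrow> \<beta> (H x)"
      using aeF by eventually_elim (use continuous_on_tendsto_compose[OF c\<beta>] in simp)
    show "integrable ?L (\<lambda>x. w x \<bullet> gradient \<theta> x)" for k :: nat
      by (intro integrable_lebesgue_on_continuous_closure \<Omega> continuous_intros w
          continuous_on_subset[OF Ck_on_continuous_gradient[OF Cchi]]) simp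
    then show "integrable ?L (\<lambda>x. w x \<bullet> gradient \<theta> x)" .
  qed (use \<beta>(3) M0 in auto)
  have "(\<lambda>k. (\<Sum>i\<in>UNIV. integral\<^sup>L ?L (\<lambda>x. (\<theta> x * \<beta>' (f (s k) x) * w x $ i) * g i (s k) x))
      + integral\<^sup>L ?L (\<lambda>x. \<beta> (f (s k) x) * (w x \<bullet> gradient \<theta> x)))
    \<longlonglongrightarrow> (\<Sum>i\<in>UNIV. integral\<^sup>L ?L (\<lambda>x. (\<theta> x * \<beta>' (H x) * w x $ i) * weak_partial \<Omega> i H x))
      + integral\<^sup>L ?L (\<lambda>x. \<beta> (H x) * (w x \<bullet> gradient \<theta> x))"
    by (intro tendsto_add tendsto_sum lim1 lim2)
  then have "(\<Sum>i\<in>UNIV. integral\<^sup>L ?L (\<lambda>x. (\<theta> x * \<beta>' (H x) * w x $ i) * weak_partial \<Omega> i H x))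
      + integral\<^sup>L ?L (\<lambda>x. \<beta> (H x) * (w x \<bullet> gradient \<theta> x)) = 0"
    unfolding id by (rule LIMSEQ_unique[OF _ tendsto_const])
  moreover have "(\<Sum>i\<in>UNIV. integral\<^sup>L ?L (\<lambda>x. (\<theta> x * \<beta>' (H x) * w x $ i) * weak_partial \<Omega> i H x))
    = integral\<^sup>L ?L (\<lambda>x. (\<theta> x * \<beta>' (H x)) * (w x \<bullet> weak_grad \<Omega> H x))"
  proof -
    have "integrable ?L (\<lambda>x. (\<theta> x * \<beta>' (H x) * w x $ i) * weak_partial \<Omega> i H x)" for i
    proof (rule Bochner_Integration.integrable_bound)
      show "integrable ?L (\<lambda>x. (X * \<bar>W\<bar>) * weak_partial \<Omega> i H x)" using iG by simp
      show "(\<lambda>x. (\<theta> x * \<beta>' (H x) * w x $ i) * weak_partial \<Omega> i H x) \<in> borel_measurable ?L"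
        using measurable_compose[OF Hm \<beta>m(2)] cm[OF cs(2)] cm[of "\<lambda>x. w x $ i"] w\<Omega> borel_measurable_integrable[OF iG]
        by (intro borel_measurable_times) (auto intro: continuous_intros)
      show "AE x in ?L. norm ((\<theta> x * \<beta>' (H x) * w x $ i) * weak_partial \<Omega> i H x) \<le> norm ((X * \<bar>W\<bar>) * weak_partial \<Omega> i H x)"
        using aeO
      proof eventually_elim
        case (elim x)
        have "\<bar>\<theta> x * \<beta>' (H x) * w x $ i\<bar> \<le> X * \<bar>W\<bar>" by (rule bound[OF elim])
        then have "\<bar>\<theta> x * \<beta>' (H x) * w x $ i\<bar> * \<bar>weak_partial \<Omega> i H x\<bar> \<le> X * \<bar>W\<bar> * \<bar>weak_partial \<Omega> i H x\<bar>"
          by (rule mult_right_mono) simp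
        then show ?case using X0 by (simp add: abs_mult)
      qed
    qed
    then have "(\<Sum>i\<in>UNIV. integral\<^sup>L ?L (\<lambda>x. (\<theta> x * \<beta>' (H x) * w x $ i) * weak_partial \<Omega> i H x))
      = integral\<^sup>L ?L (\<lambda>x. \<Sum>i\<in>UNIV. (\<theta> x * \<beta>' (H x) * w x $ i) * weak_partial \<Omega> i H x)"
      by (subst Bochner_Integration.integral_sum) auto
    also have "\<dots> = integral\<^sup>L ?L (\<lambda>x. (\<theta> x * \<beta>' (H x)) * (w x \<bullet> weak_grad \<Omega> H x))"
      by (simp add: inner_vec_def weak_grad_def sum_distrib_left mult.assoc)
    finally show ?thesis .
  qed
  ultimately show ?thesis by linarith
qed

text \<open>With \<open>\<theta>\<close> running through the boundary cutoffs, the right-hand side of the preceding identity is at most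
  \<open>sup \<bar>\<beta>\<bar>\<close> times an integral that tends to \<open>0\<close>. This needs \<open>\<beta>\<close> bounded, whence the choice
  \<open>\<beta>(t) = M arctan (t/M)\<close>, whose derivative tends to \<open>1\<close> as \<open>M\<close> grows.\<close>

lemma tangential_solenoidal_orthogonal:
  assumes \<Omega>: "open \<Omega>" "bounded \<Omega>" "Ck_boundary (Suc n) \<Omega>" and H: "H \<in> sobolev \<Omega> 1" and w: "continuous_on (closure \<Omega>) w"
    and normal: "\<And>x. x \<in> frontier \<Omega> \<Longrightarrow> w x \<bullet> outward_normal \<Omega> x = 0"
    and div: "\<And>h. compact_Ck (Suc 0) \<Omega> h \<Longrightarrow> integral\<^sup>L (lebesgue_on \<Omega>) (\<lambda>x. w x \<bullet> gradient h x) = 0"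
  shows "integral\<^sup>L (lebesgue_on \<Omega>) (\<lambda>x. w x \<bullet> weak_grad \<Omega> H x) = 0"
proof -
  let ?L = "lebesgue_on \<Omega>"
  obtain \<zeta> where \<zeta>: "boundary_cutoffs \<Omega> w (frontier \<Omega>) \<zeta>"
    using boundary_cutoffs_exist[OF \<Omega> w normal] by blast
  have \<zeta>b: "0 \<le> \<zeta> k x" "\<zeta> k x \<le> 1" and \<zeta>l: "x \<in> \<Omega> \<Longrightarrow> (\<lambda>k. \<zeta> k x) \<longlonglongrightarrow> 1" and \<zeta>C: "Ck_on (Suc 0) UNIV (\<zeta> k)"
    and \<zeta>I: "(\<lambda>k. integral\<^sup>L ?L (\<lambda>x. \<bar>w x \<bullet> gradient (\<zeta> k) x\<bar>)) \<longlonglongrightarrow> 0" for k x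
    using \<zeta> unfolding boundary_cutoffs_def by blast+
  define \<theta> where "\<theta> = (\<lambda>k x. if x \<in> \<Omega> then \<zeta> k x else 0)"
  have \<theta>: "compact_Ck (Suc 0) \<Omega> (\<theta> k)" for k
  proof -
    obtain V where V: "open V" "frontier \<Omega> \<subseteq> V" "\<And>x. x \<in> V \<Longrightarrow> \<zeta> k x = 0"
      using \<zeta> unfolding boundary_cutoffs_def by blast
    have cl: "closure \<Omega> = \<Omega> \<union> frontier \<Omega>" using \<Omega>(1) by (auto simp: frontier_def interior_open dest: subsetD[OF closure_subset])
    \<comment> \<open>near the boundary and outside the domain the extended cutoff vanishes, so the extension by \<open>0\<close> is \<open>C\<^sup>1\<close>\<close>
    define V' where "V' = V \<union> - closure \<Omega>"
    have oV': "open V'" using V(1) by (auto simp: V'_def)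
    have zV': "\<theta> k x = 0" if "x \<in> V'" for x
      using that V(3)[of x] closure_subset[of \<Omega>] by (auto simp: V'_def \<theta>_def)
    have UN: "x \<in> \<Omega> \<or> x \<in> V'" for x using cl V(2) by (auto simp: V'_def)
    have C1: "Ck_on (Suc 0) \<Omega> (\<theta> k)"
      by (rule Ck_on_congI[OF \<Omega>(1) Ck_on_subset[OF \<zeta>C[of k]]]) (auto simp: \<theta>_def)
    have C2: "Ck_on (Suc 0) V' (\<theta> k)"
      by (rule Ck_on_congI[OF oV' Ck_on_const[of _ _ 0]]) (rule zV')
    have "Ck_on (Suc 0) UNIV (\<theta> k)"
    proof (rule Ck1_I)
      show "(\<theta> k has_derivative (\<lambda>v. gradient (\<theta> k) y \<bullet> v)) (at y)" for y
        using UN[of y] Ck_on_has_derivative[OF C1] Ck_on_has_derivative[OF C2] by blast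
      have "continuous_on (\<Omega> \<union> V') (gradient (\<theta> k))"
        by (intro continuous_on_open_Un \<Omega>(1) oV' Ck_on_continuous_gradient[OF C1] Ck_on_continuous_gradient[OF C2])
      moreover have "\<Omega> \<union> V' = UNIV" using UN by auto
      ultimately show "continuous_on UNIV (gradient (\<theta> k))" by simp
    qed
    then show ?thesis
    proof (rule compact_CkI)
      have "compact (closure \<Omega> \<inter> - V')" using \<Omega>(2) oV' by (intro compact_Int_closed) (auto simp: compact_closure)
      then show "compact (- V')" by (simp add: V'_def Int_absorb1 le_infI2 inf.absorb2)
      show "- V' \<subseteq> \<Omega>" using UN by auto
      show "\<theta> k x = 0" if "x \<notin> - V'" for x using zV' that by simp
    qed
  qed
  have g\<theta>: "gradient (\<theta> k) x = gradient (\<zeta> k) x" if "x \<in> \<Omega>" for k x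
    by (rule gradient_cong_open[OF \<Omega>(1) that]) (simp add: \<theta>_def)
  note HL = sobolev_1[OF \<Omega>(1) H]
  have iH: "integrable ?L H" and iG: "integrable ?L (weak_partial \<Omega> i H)" for i
    using L2_imp_integrable[OF \<Omega>(1,2)] HL(1,3) by auto
  have Hm: "H \<in> borel_measurable ?L" using iH by (rule borel_measurable_integrable)
  have aeO: "AE x in ?L. x \<in> \<Omega>" unfolding AE_lebesgue_on_iff[OF \<Omega>(1)] by simp
  have w\<Omega>: "continuous_on \<Omega> w" using w closure_subset continuous_on_subset by blast
  have cm: "h \<in> borel_measurable ?L" if "continuous_on \<Omega> h" for h :: "real^2 \<Rightarrow> real"
    using that \<Omega>(1) by (intro continuous_imp_measurable_on_sets_lebesgue) auto
  have "bounded (w ` closure \<Omega>)"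
    using \<Omega>(2) by (intro compact_imp_bounded compact_continuous_image w) (simp add: compact_closure)
  then obtain W where W0: "\<forall>y\<in>w ` closure \<Omega>. norm y \<le> W" unfolding bounded_iff by blast
  have W: "norm (w x) \<le> W" if "x \<in> \<Omega>" for x using W0 that closure_subset by blast
  define Q where "Q = (\<lambda>x. w x \<bullet> weak_grad \<Omega> H x)"
  have iQ: "integrable ?L Q"
  proof -
    have "integrable ?L (\<lambda>x. w x $ i * weak_partial \<Omega> i H x)" for i
    proof (rule Bochner_Integration.integrable_bound)
      show "integrable ?L (\<lambda>x. W * weak_partial \<Omega> i H x)" using iG by simp
      show "(\<lambda>x. w x $ i * weak_partial \<Omega> i H x) \<in> borel_measurable ?L"
        using cm[of "\<lambda>x. w x $ i"] w\<Omega> borel_measurable_integrable[OF iG]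
        by (intro borel_measurable_times) (auto intro: continuous_intros)
      show "AE x in ?L. norm (w x $ i * weak_partial \<Omega> i H x) \<le> norm (W * weak_partial \<Omega> i H x)"
        using aeO
      proof eventually_elim
        case (elim x)
        have "\<bar>w x $ i\<bar> \<le> \<bar>W\<bar>" using component_le_norm_cart[of "w x" i] W[OF elim] by linarith
        then show ?case by (simp add: abs_mult mult_right_mono)
      qed
    qed
    then show ?thesis by (simp add: Q_def[abs_def] inner_vec_def weak_grad_def)
  qed
  have trunc: "integral\<^sup>L ?L (\<lambda>x. (1 / (1 + (H x / M)\<^sup>2)) * Q x) = 0" if M: "M > 0" for M
  proof -
    define \<beta> where "\<beta> = (\<lambda>t. M * arctan (t / M))"
    define \<beta>' where "\<beta>' = (\<lambda>t. 1 / (1 + (t / M)\<^sup>2))"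
    have \<beta>1: "(\<beta> has_real_derivative \<beta>' t) (at t)" for t
    proof -
      have "((\<lambda>t. t / M) has_real_derivative 1 / M) (at t)" using M by (auto intro!: derivative_eq_intros)
      from DERIV_cmult[OF DERIV_chain2[OF DERIV_arctan this], of M] show ?thesis
        using M by (simp add: \<beta>_def \<beta>'_def inverse_eq_divide)
    qed
    have pos: "1 + (t / M)\<^sup>2 > 0" for t by (simp add: add_pos_nonneg)
    have \<beta>2: "continuous_on UNIV \<beta>'"
      unfolding \<beta>'_def using pos by (intro continuous_intros) (auto simp: less_imp_neq[symmetric] M)
    have \<beta>3: "\<bar>\<beta> t\<bar> \<le> M * (pi / 2)" for t
    proof -
      have "\<bar>arctan (t / M)\<bar> \<le> pi / 2" using arctan_bounded[of "t / M"] by linarith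
      then show ?thesis using M by (simp add: \<beta>_def abs_mult mult_left_mono)
    qed
    have \<beta>4: "\<bar>\<beta>' t\<bar> \<le> 1" for t using pos[of t] by (simp add: \<beta>'_def)
    have \<beta>m: "\<beta> \<in> borel_measurable borel" "\<beta>' \<in> borel_measurable borel"
      using \<beta>2 DERIV_continuous_on[of UNIV \<beta> \<beta>'] \<beta>1 by (auto intro!: borel_measurable_continuous_onI)
    have "(\<lambda>k. integral\<^sup>L ?L (\<lambda>x. (\<theta> k x * \<beta>' (H x)) * Q x)) \<longlonglongrightarrow> integral\<^sup>L ?L (\<lambda>x. (1 * \<beta>' (H x)) * Q x)"
    proof (rule integral_dominated_convergence[where w="\<lambda>x. \<bar>Q x\<bar>"])
      have \<beta>Hm: "(\<lambda>x. \<beta>' (H x)) \<in> borel_measurable ?L" by (rule measurable_compose[OF Hm \<beta>m(2)])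
      then show "(\<lambda>x. 1 * \<beta>' (H x) * Q x) \<in> borel_measurable ?L" using iQ by auto
      have "\<theta> k \<in> borel_measurable ?L" for k
        using compact_Ck_continuous[OF \<theta>] continuous_on_subset by (intro cm) blast
      then show "(\<lambda>x. (\<theta> k x * \<beta>' (H x)) * Q x) \<in> borel_measurable ?L" for k using \<beta>Hm iQ by auto
      show "integrable ?L (\<lambda>x. \<bar>Q x\<bar>)" using iQ by simp
      show "AE x in ?L. (\<lambda>k. (\<theta> k x * \<beta>' (H x)) * Q x) \<longlonglongrightarrow> (1 * \<beta>' (H x)) * Q x"
        using aeO
      proof eventually_elim
        case (elim x)
        then have "(\<lambda>k. \<theta> k x) \<longlonglongrightarrow> 1" using \<zeta>l[OF elim] by (simp add: \<theta>_def)
        then show ?case by (intro tendsto_intros)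
      qed
      show "AE x in ?L. norm ((\<theta> k x * \<beta>' (H x)) * Q x) \<le> \<bar>Q x\<bar>" for k
      proof (intro AE_I2)
        fix x
        have "\<bar>\<theta> k x\<bar> * \<bar>\<beta>' (H x)\<bar> \<le> 1 * 1"
          using \<zeta>b[of k x] \<beta>4[of "H x"] by (intro mult_mono) (auto simp: \<theta>_def)
        then have "\<bar>\<theta> k x\<bar> * \<bar>\<beta>' (H x)\<bar> * \<bar>Q x\<bar> \<le> 1 * \<bar>Q x\<bar>" by (intro mult_right_mono) auto
        then show "norm ((\<theta> k x * \<beta>' (H x)) * Q x) \<le> \<bar>Q x\<bar>" by (simp add: abs_mult)
      qed
    qed
    moreover have "(\<lambda>k. integral\<^sup>L ?L (\<lambda>x. (\<theta> k x * \<beta>' (H x)) * Q x)) \<longlonglongrightarrow> 0"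
    proof (rule Lim_null_comparison)
      have "norm (integral\<^sup>L ?L (\<lambda>x. (\<theta> k x * \<beta>' (H x)) * Q x)) \<le> M * (pi / 2) * integral\<^sup>L ?L (\<lambda>x. \<bar>w x \<bullet> gradient (\<zeta> k) x\<bar>)" for k
      proof -
        have i: "integrable ?L (\<lambda>x. \<bar>w x \<bullet> gradient (\<zeta> k) x\<bar>)" 
          by (intro integrable_lebesgue_on_continuous_closure \<Omega> continuous_intros w
              continuous_on_subset[OF Ck_on_continuous_gradient[OF \<zeta>C]]) simp
        have "integral\<^sup>L ?L (\<lambda>x. (\<theta> k x * \<beta>' (H x)) * Q x) = - integral\<^sup>L ?L (\<lambda>x. \<beta> (H x) * (w x \<bullet> gradient (\<theta> k) x))"
          unfolding Q_def by (rule weighted_divergence_identity[OF \<Omega>(1,2) H w div \<theta> \<beta>1 \<beta>2 \<beta>3 \<beta>4])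
        also have "norm \<dots> = norm (integral\<^sup>L ?L (\<lambda>x. \<beta> (H x) * (w x \<bullet> gradient (\<theta> k) x)))" by simp
        also have "\<dots> = norm (integral\<^sup>L ?L (\<lambda>x. \<beta> (H x) * (w x \<bullet> gradient (\<zeta> k) x)))"
          by (rule arg_cong[where f=norm], rule lebesgue_on_cong_AE(2)[OF \<Omega>(1)])
            (use aeO in \<open>eventually_elim, simp add: g\<theta>\<close>)
        also have "\<dots> \<le> integral\<^sup>L ?L (\<lambda>x. norm (\<beta> (H x) * (w x \<bullet> gradient (\<zeta> k) x)))" by (rule integral_norm_bound)
        also have "\<dots> \<le> integral\<^sup>L ?L (\<lambda>x. M * (pi / 2) * \<bar>w x \<bullet> gradient (\<zeta> k) x\<bar>)"
        proof (rule integral_mono_AE')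
          have "norm (\<beta> (H x) * (w x \<bullet> gradient (\<zeta> k) x)) \<le> M * (pi / 2) * \<bar>w x \<bullet> gradient (\<zeta> k) x\<bar>" for x
            unfolding real_norm_def abs_mult by (rule mult_right_mono[OF \<beta>3]) simp
          then show "AE x in ?L. norm (\<beta> (H x) * (w x \<bullet> gradient (\<zeta> k) x)) \<le> M * (pi / 2) * \<bar>w x \<bullet> gradient (\<zeta> k) x\<bar>"
            by (rule AE_I2)
        qed (use i M in auto)
        also have "\<dots> = M * (pi / 2) * integral\<^sup>L ?L (\<lambda>x. \<bar>w x \<bullet> gradient (\<zeta> k) x\<bar>)" by simp
        finally show ?thesis .
      qed
      then show "\<forall>\<^sub>F k in sequentially. norm (integral\<^sup>L ?L (\<lambda>x. (\<theta> k x * \<beta>' (H x)) * Q x)) \<le> M * (pi / 2) * integral\<^sup>L ?L (\<lambda>x. \<bar>w x \<bullet> gradient (\<zeta> k) x\<bar>)"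
        by simp
      show "(\<lambda>k. M * (pi / 2) * integral\<^sup>L ?L (\<lambda>x. \<bar>w x \<bullet> gradient (\<zeta> k) x\<bar>)) \<longlonglongrightarrow> 0"
        using tendsto_mult_right_zero[OF \<zeta>I] by simp
    qed
    ultimately have "integral\<^sup>L ?L (\<lambda>x. (1 * \<beta>' (H x)) * Q x) = 0" by (rule LIMSEQ_unique)
    then show ?thesis by (simp add: \<beta>'_def)
  qed
  have "(\<lambda>n. integral\<^sup>L ?L (\<lambda>x. (1 / (1 + (H x / real (Suc n))\<^sup>2)) * Q x)) \<longlonglongrightarrow> integral\<^sup>L ?L Q"
  proof (rule integral_dominated_convergence[where w="\<lambda>x. \<bar>Q x\<bar>"])
    show "(\<lambda>x. (1 / (1 + (H x / real (Suc n))\<^sup>2)) * Q x) \<in> borel_measurable ?L" for n using Hm iQ by auto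
    show "AE x in ?L. (\<lambda>n. (1 / (1 + (H x / real (Suc n))\<^sup>2)) * Q x) \<longlonglongrightarrow> Q x"
    proof (intro AE_I2)
      fix x
      have "(\<lambda>n. H x * inverse (real (Suc n))) \<longlonglongrightarrow> H x * 0" by (intro tendsto_intros LIMSEQ_inverse_real_of_nat)
      then have "(\<lambda>n. H x / real (Suc n)) \<longlonglongrightarrow> 0" by (simp add: divide_inverse)
      then have "(\<lambda>n. (1 / (1 + (H x / real (Suc n))\<^sup>2)) * Q x) \<longlonglongrightarrow> (1 / (1 + 0\<^sup>2)) * Q x"
        by (intro tendsto_intros) auto
      then show "(\<lambda>n. (1 / (1 + (H x / real (Suc n))\<^sup>2)) * Q x) \<longlonglongrightarrow> Q x" by simp
    qed
    show "AE x in ?L. norm ((1 / (1 + (H x / real (Suc n))\<^sup>2)) * Q x) \<le> \<bar>Q x\<bar>" for n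
    proof (intro AE_I2)
      fix x
      have "\<bar>1 / (1 + (H x / real (Suc n))\<^sup>2)\<bar> \<le> 1" by (simp add: divide_le_eq add_pos_nonneg)
      from mult_right_mono[OF this, of "\<bar>Q x\<bar>"]
      show "norm ((1 / (1 + (H x / real (Suc n))\<^sup>2)) * Q x) \<le> \<bar>Q x\<bar>" by (simp only: real_norm_def abs_mult) simp
    qed
  qed (use iQ in auto)
  then have "(\<lambda>n::nat. 0) \<longlonglongrightarrow> integral\<^sup>L ?L Q" using trunc by simp
  then show ?thesis unfolding Q_def by (rule LIMSEQ_unique[OF _ tendsto_const])
qed

lemma normal_trace_orthogonal:
  assumes \<Omega>: "open \<Omega>" "bounded \<Omega>" "Ck_boundary (Suc n) \<Omega>" and H: "H \<in> sobolev \<Omega> 1"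
    and u: "u \<in> vec_sobolev \<Omega> 1" "AE x in lebesgue_on \<Omega>. weak_div \<Omega> u x = 0" "zero_normal_trace \<Omega> u"
  shows "L2_inner \<Omega> u (weak_grad \<Omega> H) = 0"
proof -
  let ?L = "lebesgue_on \<Omega>"
  obtain w where w: "continuous_on (closure \<Omega>) w" "AE x in ?L. w x = u x" "\<And>x. x \<in> frontier \<Omega> \<Longrightarrow> w x \<bullet> outward_normal \<Omega> x = 0"
    using u(3) unfolding zero_normal_trace_def by blast
  have ui: "(\<lambda>x. u x $ i) \<in> sobolev \<Omega> 1" for i using u(1) by (simp add: vec_sobolev_def)
  note U = sobolev_1[OF \<Omega>(1) ui]
  have div: "integral\<^sup>L ?L (\<lambda>x. w x \<bullet> gradient h x) = 0" if h: "compact_Ck (Suc 0) \<Omega> h" for h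
  proof -
    note dh = compact_Ck_partial_deriv[OF h]
    have i1: "integrable ?L (\<lambda>x. u x $ i * partial_deriv i h x)" for i
      by (rule integrable_mult_compact_Ck[OF \<Omega>(1) locally_integrable_L2[OF \<Omega>(1,2) U(1)] dh])
    have i2: "integrable ?L (\<lambda>x. weak_partial \<Omega> i (\<lambda>x. u x $ i) x * h x)" for i
      by (rule integrable_mult_compact_Ck[OF \<Omega>(1) locally_integrable_L2[OF \<Omega>(1,2) U(3)] h])
    have "integral\<^sup>L ?L (\<lambda>x. w x \<bullet> gradient h x) = integral\<^sup>L ?L (\<lambda>x. \<Sum>i\<in>UNIV. u x $ i * partial_deriv i h x)"
      by (rule lebesgue_on_cong_AE(2)[OF \<Omega>(1)])
        (use w(2) in \<open>eventually_elim, simp add: inner_vec_def partial_deriv_eq_gradient\<close>)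
    also have "\<dots> = (\<Sum>i\<in>UNIV. L2_inner \<Omega> (\<lambda>x. u x $ i) (partial_deriv i h))"
      by (subst Bochner_Integration.integral_sum) (simp_all add: i1 L2_inner_real)
    also have "\<dots> = (\<Sum>i\<in>UNIV. - L2_inner \<Omega> (weak_partial \<Omega> i (\<lambda>x. u x $ i)) h)"
      by (simp add: has_weak_partial_compact_C1[OF \<Omega>(1) U(2) h])
    also have "\<dots> = - integral\<^sup>L ?L (\<lambda>x. \<Sum>i\<in>UNIV. weak_partial \<Omega> i (\<lambda>x. u x $ i) x * h x)"
      by (subst Bochner_Integration.integral_sum) (simp_all add: i2 L2_inner_real sum_negf)
    also have "integral\<^sup>L ?L (\<lambda>x. \<Sum>i\<in>UNIV. weak_partial \<Omega> i (\<lambda>x. u x $ i) x * h x) = integral\<^sup>L ?L (\<lambda>x. 0)"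
      by (rule lebesgue_on_cong_AE(2)[OF \<Omega>(1)])
        (use u(2) in \<open>eventually_elim, simp add: weak_div_def flip: sum_distrib_right\<close>)
    finally show ?thesis by simp
  qed
  have "L2_inner \<Omega> u (weak_grad \<Omega> H) = integral\<^sup>L ?L (\<lambda>x. w x \<bullet> weak_grad \<Omega> H x)"
    unfolding L2_inner_def by (rule lebesgue_on_cong_AE(2)[OF \<Omega>(1)]) (use w(2) in \<open>eventually_elim, simp\<close>)
  also have "\<dots> = 0" by (rule tangential_solenoidal_orthogonal[OF \<Omega> H w(1,3) div])
  finally show ?thesis .
qed

section \<open>Functions vanishing on the boundary\<close>

lemma L2_inner_Cauchy_Schwarz:
  assumes "f \<in> L2 \<Omega>" "g \<in> L2 \<Omega>"
  shows "\<bar>L2_inner \<Omega> f g\<bar> \<le> L2_norm \<Omega> f * L2_norm \<Omega> g"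
proof -
  let ?A = "L2_inner \<Omega> f f" and ?B = "L2_inner \<Omega> f g" and ?C = "L2_inner \<Omega> g g"
  have quad: "0 \<le> ?A + 2 * t * ?B + t\<^sup>2 * ?C" for t
  proof -
    have h: "(\<lambda>x. f x + t *\<^sub>R g x) \<in> L2 \<Omega>" by (rule L2_add_scaleR[OF assms])
    have "0 \<le> L2_inner \<Omega> (\<lambda>x. f x + t *\<^sub>R g x) (\<lambda>x. f x + t *\<^sub>R g x)" by (rule L2_inner_self_nonneg)
    also have "\<dots> = ?A + 2 * t * ?B + t\<^sup>2 * ?C"
      using L2_inner_add_scaleR[OF assms h, of t] L2_inner_add_scaleR[OF assms assms(1), of t]
        L2_inner_add_scaleR[OF assms assms(2), of t]
      by (simp add: L2_inner_commute[of _ f "\<lambda>x. f x + t *\<^sub>R g x"] L2_inner_commute[of _ g "\<lambda>x. f x + t *\<^sub>R g x"]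
          L2_inner_commute[of _ g f] algebra_simps power2_eq_square)
    finally show ?thesis .
  qed
  have "?B\<^sup>2 \<le> ?A * ?C"
  proof (cases "?C = 0")
    case True
    have "?B = 0"
    proof (rule ccontr)
      assume B: "?B \<noteq> 0"
      have "2 * (- (?A + 1) / (2 * ?B)) * ?B = - (?A + 1)" using B by simp
      then show False using quad[of "- (?A + 1) / (2 * ?B)"] True by simp
    qed
    then show ?thesis using True by simp
  next
    case False
    then have C: "?C > 0" using L2_inner_self_nonneg[of \<Omega> g] by linarith
    have "?A + 2 * (- ?B / ?C) * ?B + (- ?B / ?C)\<^sup>2 * ?C = ?A - ?B\<^sup>2 / ?C"
      using C by (simp add: field_simps power2_eq_square)
    then have "?B\<^sup>2 / ?C \<le> ?A" using quad[of "- ?B / ?C"] by simp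
    then show ?thesis using C by (simp add: divide_le_eq)
  qed
  then have "sqrt (?B\<^sup>2) \<le> sqrt (?A * ?C)" by (rule real_sqrt_le_mono)
  then show ?thesis by (simp add: L2_norm_def real_sqrt_mult)
qed

lemma L2_norm_nonneg: "0 \<le> L2_norm \<Omega> f"
  by (simp add: L2_norm_def L2_inner_self_nonneg)

lemma L2_inner_tendsto:
  fixes a b :: "real^2 \<Rightarrow> real"
  assumes L: "\<And>k. A k \<in> L2 \<Omega>" "\<And>k. B k \<in> L2 \<Omega>" "a \<in> L2 \<Omega>" "b \<in> L2 \<Omega>"
    and lim: "(\<lambda>k. L2_norm \<Omega> (\<lambda>x. A k x + (-1) * a x)) \<longlonglongrightarrow> 0" "(\<lambda>k. L2_norm \<Omega> (\<lambda>x. B k x + (-1) * b x)) \<longlonglongrightarrow> 0"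
  shows "(\<lambda>k. L2_inner \<Omega> (A k) (B k)) \<longlonglongrightarrow> L2_inner \<Omega> a b"
proof -
  let ?I = "L2_inner \<Omega>" and ?N = "L2_norm \<Omega>"
  let ?dA = "\<lambda>k x. A k x + (-1) * a x" and ?dB = "\<lambda>k x. B k x + (-1) * b x"
  have d: "?dA k \<in> L2 \<Omega>" "?dB k \<in> L2 \<Omega>" for k
    using L2_add_scaleR[OF L(1,3), of k "-1"] L2_add_scaleR[OF L(2,4), of k "-1"] by simp_all
  have split: "?I (A k) (B k) - ?I a b = ?I (?dA k) (?dB k) + ?I (?dA k) b + ?I a (?dB k)" for k
  proof -
    have 1: "?I (?dA k) h = ?I (A k) h - ?I a h" if "h \<in> L2 \<Omega>" for h
      using L2_inner_add_scaleR[OF L(1,3) that, of k "-1"] by simp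
    have 2: "?I h (?dB k) = ?I h (B k) - ?I h b" if "h \<in> L2 \<Omega>" for h
      using L2_inner_add_scaleR[OF L(2,4) that, of k "-1"] by (simp add: L2_inner_commute[of _ h])
    show ?thesis using 1[OF L(4)] 2[OF d(1)] 1[OF L(2)[of k]] 2[OF L(3)] 1[OF L(4)] by simp
  qed
  have "(\<lambda>k. ?I (A k) (B k) - ?I a b) \<longlonglongrightarrow> 0"
  proof (rule Lim_null_comparison)
    have "norm (?I (A k) (B k) - ?I a b) \<le> ?N (?dA k) * ?N (?dB k) + ?N (?dA k) * ?N b + ?N a * ?N (?dB k)" for k
      unfolding split using L2_inner_Cauchy_Schwarz[OF d(1) d(2), of k k] L2_inner_Cauchy_Schwarz[OF d(1)[of k] L(4)]
        L2_inner_Cauchy_Schwarz[OF L(3) d(2)[of k]] by (simp only: real_norm_def)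
    then show "\<forall>\<^sub>F k in sequentially. norm (?I (A k) (B k) - ?I a b) \<le> ?N (?dA k) * ?N (?dB k) + ?N (?dA k) * ?N b + ?N a * ?N (?dB k)"
      by simp
    have "(\<lambda>k. ?N (?dA k) * ?N (?dB k) + ?N (?dA k) * ?N b + ?N a * ?N (?dB k)) \<longlonglongrightarrow> 0 * 0 + 0 * ?N b + ?N a * 0"
      by (intro tendsto_intros lim)
    then show "(\<lambda>k. ?N (?dA k) * ?N (?dB k) + ?N (?dA k) * ?N b + ?N a * ?N (?dB k)) \<longlonglongrightarrow> 0" by simp
  qed
  then show ?thesis by (simp add: LIM_zero_iff)
qed

lemma compact_Ck_L2:
  assumes "open \<Omega>" "compact_Ck k \<Omega> \<phi>"
  shows "\<phi> \<in> L2 \<Omega>"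
proof -
  have c: "continuous_on UNIV \<phi>" by (rule compact_Ck_continuous[OF assms(2)])
  then have m: "\<phi> \<in> borel_measurable (lebesgue_on \<Omega>)"
    using assms(1) by (intro continuous_imp_measurable_on_sets_lebesgue continuous_on_subset[OF c]) auto
  have "compact_Ck 0 \<Omega> (\<lambda>x. \<phi> x * \<phi> x)"
  proof (rule compact_Ck_mult)
    show "compact_Ck 0 \<Omega> \<phi>" using assms(2) c unfolding compact_Ck_def by simp
  qed (use c in simp)
  then have "integrable lborel (\<lambda>x. \<phi> x * \<phi> x)" by (rule compact_Ck_integrable)
  then have "integrable lebesgue (\<lambda>x. \<phi> x * \<phi> x)" by (subst integrable_completion) (auto dest: borel_measurable_integrable)
  from integrable_mult_indicator[OF _ this, of \<Omega>] assms(1)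
  have "integrable (lebesgue_on \<Omega>) (\<lambda>x. \<phi> x * \<phi> x)" by (simp add: lebesgue_on_integrable_iff)
  with m show ?thesis by (simp add: L2_def power2_eq_square)
qed

lemma test_function_sobolev:
  assumes "open \<Omega>" "test_function \<Omega> \<phi>"
  shows "\<phi> \<in> sobolev \<Omega> 1" "AE x in lebesgue_on \<Omega>. weak_partial \<Omega> i \<phi> x = partial_deriv i \<phi> x" "partial_deriv i \<phi> \<in> L2 \<Omega>"
proof -
  have c: "compact_Ck k \<Omega> \<phi>" for k using assms(2) by (simp add: test_function_iff)
  have w: "has_weak_partial \<Omega> i \<phi> (partial_deriv i \<phi>)" for i
    using c[of "Suc 0"] by (intro has_weak_partial_C1 assms(1)) (simp add: compact_Ck_def)
  have L: "partial_deriv i \<phi> \<in> L2 \<Omega>" for i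
    by (rule compact_Ck_L2[OF assms(1) test_function_partial_deriv[OF assms(2), of 0]])
  show "\<phi> \<in> sobolev \<Omega> 1" by (rule sobolev_1I[OF compact_Ck_L2[OF assms(1) c[of 0]] w L])
  show "AE x in lebesgue_on \<Omega>. weak_partial \<Omega> i \<phi> x = partial_deriv i \<phi> x"
    by (rule weak_partial_AE_eq(2)[OF assms(1) w])
  show "partial_deriv i \<phi> \<in> L2 \<Omega>" by (rule L)
qed

lemma L2_inner_vec:
  assumes "\<And>i. (\<lambda>x. v x $ i) \<in> L2 \<Omega>" "\<And>i. (\<lambda>x. w x $ i) \<in> L2 \<Omega>"
  shows "L2_inner \<Omega> v w = (\<Sum>i\<in>UNIV. L2_inner \<Omega> (\<lambda>x. v x $ i) (\<lambda>x. w x $ i))"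
proof -
  have "integrable (lebesgue_on \<Omega>) (\<lambda>x. v x $ i \<bullet> w x $ i)" for i
    by (rule L2_inner_integrable[OF assms])
  then show ?thesis by (simp add: L2_inner_def inner_vec_def)
qed

lemma vec_L2:
  fixes v :: "real^2 \<Rightarrow> 'b::euclidean_space ^ 'n"
  assumes "\<And>i. (\<lambda>x. v x $ i) \<in> L2 \<Omega>"
  shows "v \<in> L2 \<Omega>"
proof -
  have "v \<in> borel_measurable (lebesgue_on \<Omega>)"
    by (rule borel_measurable_vec_componentwise) (use assms in \<open>auto simp: L2_def\<close>)
  moreover have "(norm (v x))\<^sup>2 = (\<Sum>i\<in>UNIV. (norm (v x $ i))\<^sup>2)" for x
    unfolding power2_norm_eq_inner by (simp add: inner_vec_def)
  ultimately show ?thesis using assms by (simp add: L2_def)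
qed

lemma L2_norm_le_H1_norm:
  assumes "open \<Omega>" "f \<in> sobolev \<Omega> 1"
  shows "L2_norm \<Omega> f \<le> H1_norm \<Omega> f" "L2_norm \<Omega> (weak_partial \<Omega> i f) \<le> H1_norm \<Omega> f"
proof -
  have "(L2_norm \<Omega> f)\<^sup>2 \<le> (L2_norm \<Omega> f)\<^sup>2 + (L2_norm \<Omega> (weak_grad \<Omega> f))\<^sup>2" by simp
  then show "L2_norm \<Omega> f \<le> H1_norm \<Omega> f" unfolding H1_norm_def by (rule real_le_rsqrt)
  have c: "(\<lambda>x. weak_grad \<Omega> f x $ i) \<in> L2 \<Omega>" for i
    using sobolev_1(3)[OF assms] by (simp add: weak_grad_def)
  have "(L2_norm \<Omega> (weak_partial \<Omega> i f))\<^sup>2 \<le> (\<Sum>i\<in>UNIV. (L2_norm \<Omega> (weak_partial \<Omega> i f))\<^sup>2)"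
    by (rule member_le_sum) auto
  also have "\<dots> = (L2_norm \<Omega> (weak_grad \<Omega> f))\<^sup>2"
    using L2_inner_vec[OF c c] by (simp add: L2_norm_power2 weak_grad_def[abs_def])
  also have "\<dots> \<le> (L2_norm \<Omega> f)\<^sup>2 + (L2_norm \<Omega> (weak_grad \<Omega> f))\<^sup>2" by simp
  finally show "L2_norm \<Omega> (weak_partial \<Omega> i f) \<le> H1_norm \<Omega> f" unfolding H1_norm_def by (rule real_le_rsqrt)
qed

lemma L2_norm_cong_AE:
  assumes "open \<Omega>" "AE x in lebesgue_on \<Omega>. f x = g x" shows "L2_norm \<Omega> f = L2_norm \<Omega> g"
  unfolding L2_norm_def using L2_inner_cong_AE[OF assms assms(2)] by simp

lemma L2_norm_minus_commute: 
  fixes a b :: "real^2 \<Rightarrow> real"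
  shows "L2_norm \<Omega> (\<lambda>x. a x + (-1) * b x) = L2_norm \<Omega> (\<lambda>x. b x + (-1) * a x)"
proof -
  have "(a x + (-1) * b x) * (a x + (-1) * b x) = (b x + (-1) * a x) * (b x + (-1) * a x)" for x
    by (simp add: algebra_simps)
  then show ?thesis unfolding L2_norm_def L2_inner_real by (simp only:)
qed

text \<open>The closure definition, spelled out for the function and each of its derivatives. Uniqueness of weak
  derivatives identifies the derivative of the difference with the difference of the derivatives.\<close>

lemma H10_approximation:
  assumes "open \<Omega>" "f \<in> H10 \<Omega>"
  obtains \<phi> where "\<And>k::nat. test_function \<Omega> (\<phi> k)" "(\<lambda>k. L2_norm \<Omega> (\<lambda>x. \<phi> k x + (-1) * f x)) \<longlonglongrightarrow> 0"
    "\<And>i. (\<lambda>k. L2_norm \<Omega> (\<lambda>x. partial_deriv i (\<phi> k) x + (-1) * weak_partial \<Omega> i f x)) \<longlonglongrightarrow> 0"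
proof -
  obtain \<phi> where \<phi>: "\<And>k::nat. test_function \<Omega> (\<phi> k)" "(\<lambda>k. H1_norm \<Omega> (\<lambda>x. f x - \<phi> k x)) \<longlonglongrightarrow> 0"
    and f: "f \<in> sobolev \<Omega> 1"
    using assms(2) by (auto simp: H10_def)
  have H: "(\<lambda>k. H1_norm \<Omega> (\<lambda>x. f x + (-1) * \<phi> k x)) \<longlonglongrightarrow> 0" using \<phi>(2) by simp
  note T = test_function_sobolev[OF assms(1) \<phi>(1)]
  note D = sobolev_1_add[OF assms(1) f T(1), where c="-1"]
  note N = L2_norm_le_H1_norm[OF assms(1) D(1)]
  have "(\<lambda>k. L2_norm \<Omega> (\<lambda>x. f x + (-1) * \<phi> k x)) \<longlonglongrightarrow> 0"
    by (rule Lim_null_comparison[OF always_eventually H])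
      (use N(1) in \<open>simp add: L2_norm_nonneg\<close>)
  then have 1: "(\<lambda>k. L2_norm \<Omega> (\<lambda>x. \<phi> k x + (-1) * f x)) \<longlonglongrightarrow> 0" by (subst L2_norm_minus_commute)
  have 2: "(\<lambda>k. L2_norm \<Omega> (\<lambda>x. partial_deriv i (\<phi> k) x + (-1) * weak_partial \<Omega> i f x)) \<longlonglongrightarrow> 0" for i
  proof (rule Lim_null_comparison[OF always_eventually H], rule allI)
    fix k
    have "AE x in lebesgue_on \<Omega>. weak_partial \<Omega> i f x + (-1) * partial_deriv i (\<phi> k) x = weak_partial \<Omega> i (\<lambda>x. f x + (-1) * \<phi> k x) x"
      using D(2)[of i k] T(2)[of i k] by eventually_elim simp
    from L2_norm_cong_AE[OF assms(1) this]
    have "L2_norm \<Omega> (\<lambda>x. partial_deriv i (\<phi> k) x + (-1) * weak_partial \<Omega> i f x) = L2_norm \<Omega> (weak_partial \<Omega> i (\<lambda>x. f x + (-1) * \<phi> k x))"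
      by (subst L2_norm_minus_commute)
    then show "norm (L2_norm \<Omega> (\<lambda>x. partial_deriv i (\<phi> k) x + (-1) * weak_partial \<Omega> i f x)) \<le> H1_norm \<Omega> (\<lambda>x. f x + (-1) * \<phi> k x)"
      using N(2)[of i k] by (simp only: real_norm_def abs_of_nonneg[OF L2_norm_nonneg])
  qed
  show ?thesis by (rule that[OF \<phi>(1) 1 2])
qed

lemma H10_integration_by_parts:
  assumes "open \<Omega>" "f \<in> H10 \<Omega>" "G \<in> sobolev \<Omega> 1"
  shows "L2_inner \<Omega> f (weak_partial \<Omega> i G) = - L2_inner \<Omega> (weak_partial \<Omega> i f) G"
proof -
  obtain \<phi> where \<phi>: "\<And>k::nat. test_function \<Omega> (\<phi> k)" "(\<lambda>k. L2_norm \<Omega> (\<lambda>x. \<phi> k x + (-1) * f x)) \<longlonglongrightarrow> 0"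
    "\<And>i. (\<lambda>k. L2_norm \<Omega> (\<lambda>x. partial_deriv i (\<phi> k) x + (-1) * weak_partial \<Omega> i f x)) \<longlonglongrightarrow> 0"
    by (rule H10_approximation[OF assms(1,2)]) (rule that)
  have f: "f \<in> sobolev \<Omega> 1" using assms(2) by (simp add: H10_def)
  note F = sobolev_1[OF assms(1) f] and G = sobolev_1[OF assms(1,3)]
  note T = test_function_sobolev[OF assms(1) \<phi>(1)]
  have c: "(\<lambda>k. L2_norm \<Omega> (\<lambda>x. g x + (-1) * g x)) \<longlonglongrightarrow> 0" for g :: "real^2 \<Rightarrow> real" by (simp add: L2_norm_def L2_inner_def)
  have 1: "(\<lambda>k. L2_inner \<Omega> (\<phi> k) (weak_partial \<Omega> i G)) \<longlonglongrightarrow> L2_inner \<Omega> f (weak_partial \<Omega> i G)"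
    by (rule L2_inner_tendsto[OF sobolev_1(1)[OF assms(1) T(1)] G(3) F(1) G(3) \<phi>(2) c])
  have 2: "(\<lambda>k. L2_inner \<Omega> (partial_deriv i (\<phi> k)) G) \<longlonglongrightarrow> L2_inner \<Omega> (weak_partial \<Omega> i f) G"
    by (rule L2_inner_tendsto[OF T(3) G(1) F(3) G(1) \<phi>(3) c])
  have "L2_inner \<Omega> (\<phi> k) (weak_partial \<Omega> i G) = - L2_inner \<Omega> (partial_deriv i (\<phi> k)) G" for k
    using G(2)[of i] \<phi>(1)[of k] unfolding has_weak_partial_def
    by (simp add: L2_inner_commute[of _ "\<phi> k"] L2_inner_commute[of _ "partial_deriv i (\<phi> k)"])
  with 1 have "(\<lambda>k. - L2_inner \<Omega> (partial_deriv i (\<phi> k)) G) \<longlonglongrightarrow> L2_inner \<Omega> f (weak_partial \<Omega> i G)" by simp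
  from LIMSEQ_unique[OF this tendsto_minus[OF 2]] show ?thesis .
qed

lemma H10_partials_swap:
  assumes "open \<Omega>" "f \<in> H10 \<Omega>" "g \<in> H10 \<Omega>"
  shows "L2_inner \<Omega> (weak_partial \<Omega> i f) (weak_partial \<Omega> j g) = L2_inner \<Omega> (weak_partial \<Omega> j f) (weak_partial \<Omega> i g)"
proof -
  obtain \<phi> where \<phi>: "\<And>k::nat. test_function \<Omega> (\<phi> k)" "(\<lambda>k. L2_norm \<Omega> (\<lambda>x. \<phi> k x + (-1) * f x)) \<longlonglongrightarrow> 0"
    "\<And>i. (\<lambda>k. L2_norm \<Omega> (\<lambda>x. partial_deriv i (\<phi> k) x + (-1) * weak_partial \<Omega> i f x)) \<longlonglongrightarrow> 0"
    by (rule H10_approximation[OF assms(1,2)]) (rule that)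
  obtain \<psi> where \<psi>: "\<And>k::nat. test_function \<Omega> (\<psi> k)" "(\<lambda>k. L2_norm \<Omega> (\<lambda>x. \<psi> k x + (-1) * g x)) \<longlonglongrightarrow> 0"
    "\<And>i. (\<lambda>k. L2_norm \<Omega> (\<lambda>x. partial_deriv i (\<psi> k) x + (-1) * weak_partial \<Omega> i g x)) \<longlonglongrightarrow> 0"
    by (rule H10_approximation[OF assms(1,3)]) (rule that)
  have fg: "f \<in> sobolev \<Omega> 1" "g \<in> sobolev \<Omega> 1" using assms by (auto simp: H10_def)
  have lim: "(\<lambda>k. L2_inner \<Omega> (partial_deriv i (\<phi> k)) (partial_deriv j (\<psi> k))) \<longlonglongrightarrow> L2_inner \<Omega> (weak_partial \<Omega> i f) (weak_partial \<Omega> j g)" for i j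
    by (rule L2_inner_tendsto[OF test_function_sobolev(3)[OF assms(1) \<phi>(1)] test_function_sobolev(3)[OF assms(1) \<psi>(1)]
        sobolev_1(3)[OF assms(1) fg(1)] sobolev_1(3)[OF assms(1) fg(2)] \<phi>(3) \<psi>(3)])
  have L: "L2_inner \<Omega> a b = integral\<^sup>L lborel (\<lambda>x. a x * b x)"
    if "compact_Ck 0 \<Omega> a" "compact_Ck 0 \<Omega> b" for a b
    by (rule L2_inner_compact_Ck[OF assms(1) compact_Ck_continuous[OF that(1)] that(2)])
  have "L2_inner \<Omega> (partial_deriv i (\<phi> k)) (partial_deriv j (\<psi> k)) = L2_inner \<Omega> (partial_deriv j (\<phi> k)) (partial_deriv i (\<psi> k))" for k
  proof -
    have C: "compact_Ck (Suc (Suc 0)) \<Omega> (\<phi> k)" "compact_Ck (Suc (Suc 0)) \<Omega> (\<psi> k)"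
      using \<phi>(1)[of k] \<psi>(1)[of k] unfolding test_function_iff by blast+
    show ?thesis
      unfolding L[OF test_function_partial_deriv[OF \<phi>(1)] test_function_partial_deriv[OF \<psi>(1)]]
      by (rule integral_partial_derivs_swap[OF C])
  qed
  then have "(\<lambda>k. L2_inner \<Omega> (partial_deriv i (\<phi> k)) (partial_deriv j (\<psi> k))) \<longlonglongrightarrow> L2_inner \<Omega> (weak_partial \<Omega> j f) (weak_partial \<Omega> i g)"
    using lim[of j i] by simp
  from LIMSEQ_unique[OF lim this] show ?thesis .
qed

lemma L2_inner_weak_jacobian:
  assumes "\<And>i j. weak_partial \<Omega> j (\<lambda>x. v x $ i) \<in> L2 \<Omega>"
  shows "L2_inner \<Omega> (weak_jacobian \<Omega> v) (weak_jacobian \<Omega> v)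
    = (\<Sum>i\<in>UNIV. \<Sum>j\<in>UNIV. L2_inner \<Omega> (weak_partial \<Omega> j (\<lambda>x. v x $ i)) (weak_partial \<Omega> j (\<lambda>x. v x $ i)))"
proof -
  have c: "(\<lambda>x. weak_jacobian \<Omega> v x $ i $ j) \<in> L2 \<Omega>" for i j using assms by (simp add: weak_jacobian_def)
  have r: "(\<lambda>x. weak_jacobian \<Omega> v x $ i) \<in> L2 \<Omega>" for i by (rule vec_L2) (rule c)
  show ?thesis unfolding L2_inner_vec[OF r r] L2_inner_vec[OF c c] by (simp add: weak_jacobian_def)
qed

text \<open>The square of the divergence exceeds the sum of the squares of the diagonal entries by
  \<open>2 \<partial>\<^sub>1v\<^sub>1 \<partial>\<^sub>2v\<^sub>2\<close>. Swapping the derivatives turns its integral into that of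
  \<open>2 \<partial>\<^sub>2v\<^sub>1 \<partial>\<^sub>1v\<^sub>2\<close>, which the squares of the off-diagonal entries dominate.\<close>

lemma L2_inner_weak_div_le_jacobian:
  assumes "open \<Omega>" "v \<in> vec_H10 \<Omega>"
  shows "L2_inner \<Omega> (weak_div \<Omega> v) (weak_div \<Omega> v) \<le> L2_inner \<Omega> (weak_jacobian \<Omega> v) (weak_jacobian \<Omega> v)"
proof -
  let ?I = "L2_inner \<Omega>"
  have H: "(\<lambda>x. v x $ i) \<in> H10 \<Omega>" for i using assms(2) by (simp add: vec_H10_def)
  define d where "d = (\<lambda>j i. weak_partial \<Omega> j (\<lambda>x. v x $ i))"
  have L: "d j i \<in> L2 \<Omega>" for i j
    using sobolev_1(3)[OF assms(1)] H unfolding d_def H10_def by blast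
  have JJ: "?I (weak_jacobian \<Omega> v) (weak_jacobian \<Omega> v) = (\<Sum>i\<in>UNIV. \<Sum>j\<in>UNIV. ?I (d j i) (d j i))"
    unfolding d_def by (rule L2_inner_weak_jacobian[OF L[unfolded d_def]])
  have div: "weak_div \<Omega> v = (\<lambda>x. d 1 1 x + 1 *\<^sub>R d 2 2 x)"
    by (rule ext) (simp add: weak_div_def sum_2 d_def)
  have s: "(\<lambda>x. d 1 1 x + 1 *\<^sub>R d 2 2 x) \<in> L2 \<Omega>" by (rule L2_add_scaleR[OF L L])
  have D: "?I (weak_div \<Omega> v) (weak_div \<Omega> v) = ?I (d 1 1) (d 1 1) + ?I (d 2 2) (d 2 2) + 2 * ?I (d 1 1) (d 2 2)"
    unfolding div L2_inner_add_scaleR[OF L L s]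
    using L2_inner_add_scaleR[OF L[of 1 1] L[of 2 2] L[of 1 1], of 1] L2_inner_add_scaleR[OF L[of 1 1] L[of 2 2] L[of 2 2], of 1]
    by (simp add: L2_inner_commute[of _ "d 1 1" "\<lambda>x. d 1 1 x + d 2 2 x"] L2_inner_commute[of _ "d 2 2" "\<lambda>x. d 1 1 x + d 2 2 x"]
        L2_inner_commute[of _ "d 2 2" "d 1 1"])
  have swap: "?I (d 1 1) (d 2 2) = ?I (d 2 1) (d 1 2)"
    unfolding d_def by (rule H10_partials_swap[OF assms(1) H H])
  have n: "0 \<le> ?I (\<lambda>x. d 2 1 x + (-1) *\<^sub>R d 1 2 x) (\<lambda>x. d 2 1 x + (-1) *\<^sub>R d 1 2 x)" by (rule L2_inner_self_nonneg)
  have s': "(\<lambda>x. d 2 1 x + (-1) *\<^sub>R d 1 2 x) \<in> L2 \<Omega>" by (rule L2_add_scaleR[OF L L])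
  have "2 * ?I (d 2 1) (d 1 2) \<le> ?I (d 2 1) (d 2 1) + ?I (d 1 2) (d 1 2)"
    using n unfolding L2_inner_add_scaleR[OF L L s']
    using L2_inner_add_scaleR[OF L[of 2 1] L[of 1 2] L[of 2 1], of "-1"] L2_inner_add_scaleR[OF L[of 2 1] L[of 1 2] L[of 1 2], of "-1"]
    by (simp add: L2_inner_commute[of _ "d 2 1" "\<lambda>x. d 2 1 x - d 1 2 x"] L2_inner_commute[of _ "d 1 2" "\<lambda>x. d 2 1 x - d 1 2 x"]
        L2_inner_commute[of _ "d 1 2" "d 2 1"])
  then show ?thesis unfolding D JJ using swap by (simp add: sum_2)
qed

lemma L2_inner_weak_laplacian:
  assumes "open \<Omega>" "v \<in> vec_sobolev \<Omega> 2 \<inter> vec_H10 \<Omega>"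
  shows "weak_laplacian \<Omega> v \<in> L2 \<Omega>"
    "L2_inner \<Omega> (weak_laplacian \<Omega> v) v = - L2_inner \<Omega> (weak_jacobian \<Omega> v) (weak_jacobian \<Omega> v)"
proof -
  let ?I = "L2_inner \<Omega>"
  have H: "(\<lambda>x. v x $ i) \<in> H10 \<Omega>" "(\<lambda>x. v x $ i) \<in> sobolev \<Omega> 2" for i
    using assms(2) by (auto simp: vec_H10_def vec_sobolev_def)
  note S = sobolev_2[OF assms(1) H(2)]
  define d where "d = (\<lambda>j i. weak_partial \<Omega> j (\<lambda>x. v x $ i))"
  define e where "e = (\<lambda>j i. weak_partial \<Omega> j (d j i))"
  have d: "d j i \<in> sobolev \<Omega> 1" "d j i \<in> L2 \<Omega>" for i j using S(2) sobolev_1(1)[OF assms(1) S(2)] by (auto simp: d_def)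
  have e: "e j i \<in> L2 \<Omega>" for i j unfolding e_def by (rule sobolev_1(3)[OF assms(1) d(1)])
  have vL: "(\<lambda>x. v x $ i) \<in> L2 \<Omega>" for i by (rule sobolev_1(1)[OF assms(1) S(1)])
  have lap: "(\<lambda>x. weak_laplacian \<Omega> v x $ i) = (\<lambda>x. e 1 i x + 1 *\<^sub>R e 2 i x)" for i
    by (rule ext) (simp add: weak_laplacian_def e_def d_def sum_2)
  have lapL: "(\<lambda>x. weak_laplacian \<Omega> v x $ i) \<in> L2 \<Omega>" for i unfolding lap by (rule L2_add_scaleR[OF e e])
  show "weak_laplacian \<Omega> v \<in> L2 \<Omega>" by (rule vec_L2[OF lapL])
  have JJ: "?I (weak_jacobian \<Omega> v) (weak_jacobian \<Omega> v) = (\<Sum>i\<in>UNIV. \<Sum>j\<in>UNIV. ?I (d j i) (d j i))"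
    unfolding d_def by (rule L2_inner_weak_jacobian[OF d(2)[unfolded d_def]])
  have p: "?I (e j i) (\<lambda>x. v x $ i) = - ?I (d j i) (d j i)" for i j
    using H10_integration_by_parts[OF assms(1) H(1) d(1), of i j j i]
    by (simp add: e_def d_def L2_inner_commute[of _ "\<lambda>x. v x $ i"])
  show "?I (weak_laplacian \<Omega> v) v = - ?I (weak_jacobian \<Omega> v) (weak_jacobian \<Omega> v)"
    unfolding L2_inner_vec[OF lapL vL] JJ unfolding lap L2_inner_add_scaleR[OF e e vL] p by (simp add: sum_2)
qed

lemma L2_inner_weak_grad_H10:
  assumes "open \<Omega>" "v \<in> vec_H10 \<Omega>" "P \<in> sobolev \<Omega> 1"
  shows "L2_inner \<Omega> (weak_grad \<Omega> P) v = - L2_inner \<Omega> P (weak_div \<Omega> v)"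
proof -
  let ?I = "L2_inner \<Omega>"
  have H: "(\<lambda>x. v x $ i) \<in> H10 \<Omega>" "(\<lambda>x. v x $ i) \<in> sobolev \<Omega> 1" for i
    using assms(2) by (auto simp: vec_H10_def H10_def)
  note S = sobolev_1[OF assms(1) H(2)] and P = sobolev_1[OF assms(1,3)]
  have c: "(\<lambda>x. weak_grad \<Omega> P x $ i) \<in> L2 \<Omega>" for i using P(3) by (simp add: weak_grad_def)
  have p: "?I (weak_partial \<Omega> i P) (\<lambda>x. v x $ i) = - ?I (weak_partial \<Omega> i (\<lambda>x. v x $ i)) P" for i
    using H10_integration_by_parts[OF assms(1) H(1) assms(3), of i i] by (simp add: L2_inner_commute[of _ "\<lambda>x. v x $ i"])
  have div: "weak_div \<Omega> v = (\<lambda>x. weak_partial \<Omega> 1 (\<lambda>x. v x $ 1) x + 1 *\<^sub>R weak_partial \<Omega> 2 (\<lambda>x. v x $ 2) x)"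
    by (rule ext) (simp add: weak_div_def sum_2)
  show ?thesis
    unfolding L2_inner_vec[OF c S(1)] L2_inner_commute[of _ P] div L2_inner_add_scaleR[OF S(3) S(3) P(1)]
    by (simp add: weak_grad_def p sum_2)
qed

section \<open>The energy balance\<close>

lemma L2_inner_add_scaleR_right:
  assumes "f \<in> L2 \<Omega>" "g \<in> L2 \<Omega>" "h \<in> L2 \<Omega>"
  shows "L2_inner \<Omega> h (\<lambda>x. f x + c *\<^sub>R g x) = L2_inner \<Omega> h f + c * L2_inner \<Omega> h g"
  using L2_inner_add_scaleR[OF assms] by (simp add: L2_inner_commute[of _ h])

lemma L2_inner_self_add_scaleR:
  assumes "f \<in> L2 \<Omega>" "g \<in> L2 \<Omega>"
  shows "L2_inner \<Omega> (\<lambda>x. f x + c *\<^sub>R g x) (\<lambda>x. f x + c *\<^sub>R g x)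
    = L2_inner \<Omega> f f + 2 * c * L2_inner \<Omega> f g + c\<^sup>2 * L2_inner \<Omega> g g"
proof -
  have h: "(\<lambda>x. f x + c *\<^sub>R g x) \<in> L2 \<Omega>" by (rule L2_add_scaleR[OF assms])
  show ?thesis
    unfolding L2_inner_add_scaleR[OF assms h] L2_inner_add_scaleR_right[OF assms assms(1)]
      L2_inner_add_scaleR_right[OF assms assms(2)] L2_inner_commute[of \<Omega> g f]
    by (simp add: algebra_simps power2_eq_square)
qed

lemma weak_div_sobolev:
  assumes "open \<Omega>" "v \<in> vec_sobolev \<Omega> 2"
  shows "weak_div \<Omega> v \<in> sobolev \<Omega> 1"
proof -
  have "weak_partial \<Omega> i (\<lambda>x. v x $ i) \<in> sobolev \<Omega> 1" for i
    using assms(2) by (intro sobolev_2(2)[OF assms(1)]) (simp add: vec_sobolev_def)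
  from sobolev_1_add(1)[OF assms(1) this[of 1] this[of 2], of 1]
  have "(\<lambda>x. weak_partial \<Omega> 1 (\<lambda>x. v x $ 1) x + 1 * weak_partial \<Omega> 2 (\<lambda>x. v x $ 2) x) \<in> sobolev \<Omega> 1" .
  moreover have "weak_div \<Omega> v = (\<lambda>x. weak_partial \<Omega> 1 (\<lambda>x. v x $ 1) x + 1 * weak_partial \<Omega> 2 (\<lambda>x. v x $ 2) x)"
    by (rule ext) (simp add: weak_div_def sum_2)
  ultimately show ?thesis by (simp only:)
qed

lemma weak_grad_add:
  assumes "open \<Omega>" "f \<in> sobolev \<Omega> 1" "g \<in> sobolev \<Omega> 1"
  shows "AE x in lebesgue_on \<Omega>. weak_grad \<Omega> (\<lambda>x. f x + c * g x) x = weak_grad \<Omega> f x + c *\<^sub>R weak_grad \<Omega> g x"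
proof -
  have "AE x in lebesgue_on \<Omega>. \<forall>i. weak_partial \<Omega> i (\<lambda>x. f x + c * g x) x = weak_partial \<Omega> i f x + c * weak_partial \<Omega> i g x"
    unfolding AE_all_countable using sobolev_1_add(2)[OF assms] by blast
  then show ?thesis by eventually_elim (simp add: weak_grad_def vec_eq_iff)
qed

lemma vec_sobolev_L2:
  assumes "open \<Omega>" "v \<in> vec_sobolev \<Omega> 2"
  shows "v \<in> L2 \<Omega>" "v \<in> vec_sobolev \<Omega> 1"
proof -
  have s: "(\<lambda>x. v x $ i) \<in> sobolev \<Omega> 1" for i
    using assms(2) sobolev_2(1)[OF assms(1)] by (simp add: vec_sobolev_def)
  then show "v \<in> vec_sobolev \<Omega> 1" by (simp add: vec_sobolev_def)
  show "v \<in> L2 \<Omega>" by (rule vec_L2[OF sobolev_1(1)[OF assms(1) s]])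
qed

text \<open>One step of the scheme, with the only knowledge about \<open>a, b, c\<close> being their orthogonality to gradients.
  The convection term enters as an arbitrary function \<open>conv\<close>: the momentum equation itself shows that
  \<open>q2 conv\<close> is square integrable.\<close>

lemma rotational_step_energy:
  fixes P1 P2 g1 :: "real^2 \<Rightarrow> real" and a b c v conv :: "real^2 \<Rightarrow> real^2"
  assumes \<Omega>: "open \<Omega>" and pos: "\<nu> > 0" "T > 0" "dt > 0"
    and v: "v \<in> vec_sobolev \<Omega> 2 \<inter> vec_H10 \<Omega>"
    and L: "a \<in> L2 \<Omega>" "b \<in> L2 \<Omega>" "c \<in> L2 \<Omega>"
    and P: "P1 \<in> sobolev \<Omega> 1" "P2 \<in> sobolev \<Omega> 1" "g1 \<in> sobolev \<Omega> 1"
    and orth: "\<And>H. H \<in> sobolev \<Omega> 1 \<Longrightarrow> L2_inner \<Omega> a (weak_grad \<Omega> H) = 0"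
      "\<And>H. H \<in> sobolev \<Omega> 1 \<Longrightarrow> L2_inner \<Omega> b (weak_grad \<Omega> H) = 0"
      "\<And>H. H \<in> sobolev \<Omega> 1 \<Longrightarrow> L2_inner \<Omega> c (weak_grad \<Omega> H) = 0"
    and mom: "AE x in lebesgue_on \<Omega>. (3 *\<^sub>R v x - 4 *\<^sub>R b x + c x) /\<^sub>R (2 * dt) + (q2 / E) *\<^sub>R conv x
        - \<nu> *\<^sub>R weak_laplacian \<Omega> v x + weak_grad \<Omega> P1 x = 0"
    and proj: "AE x in lebesgue_on \<Omega>. (3 *\<^sub>R a x - 3 *\<^sub>R v x) /\<^sub>R (2 * dt)
        + weak_grad \<Omega> (\<lambda>y. P2 y - P1 y + \<nu> * weak_div \<Omega> v y) x = 0"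
    and qeq: "(3 * q2 - 4 * q1 + q0) / (2 * dt) = - (1 / T) * q2 + 1 / E * L2_inner \<Omega> conv v"
  defines "g2 \<equiv> \<lambda>x. \<nu> * weak_div \<Omega> v x + g1 x"
  shows "((L2_norm \<Omega> a)\<^sup>2 + (L2_norm \<Omega> (\<lambda>x. 2 *\<^sub>R a x - b x))\<^sup>2
      + 4 / 3 * dt\<^sup>2 * (L2_norm \<Omega> (weak_grad \<Omega> (\<lambda>x. P2 x + g2 x)))\<^sup>2
      + 2 * inverse \<nu> * dt * (L2_norm \<Omega> g2)\<^sup>2 + \<bar>q2\<bar>\<^sup>2 + \<bar>2 * q2 - q1\<bar>\<^sup>2)
    - ((L2_norm \<Omega> b)\<^sup>2 + (L2_norm \<Omega> (\<lambda>x. 2 *\<^sub>R b x - c x))\<^sup>2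
      + 4 / 3 * dt\<^sup>2 * (L2_norm \<Omega> (weak_grad \<Omega> (\<lambda>x. P1 x + g1 x)))\<^sup>2
      + 2 * inverse \<nu> * dt * (L2_norm \<Omega> g1)\<^sup>2 + \<bar>q1\<bar>\<^sup>2 + \<bar>2 * q1 - q0\<bar>\<^sup>2)
    \<le> - 2 * \<nu> * dt * (L2_norm \<Omega> (weak_jacobian \<Omega> v))\<^sup>2"
proof -
  let ?I = "L2_inner \<Omega>"
  define D where "D = weak_div \<Omega> v"
  define H1 where "H1 = (\<lambda>x. P1 x + 1 * g1 x)"
  define H2 where "H2 = (\<lambda>x. P2 x + 1 * g2 x)"
  define G1 where "G1 = weak_grad \<Omega> H1"
  define G2 where "G2 = weak_grad \<Omega> H2"
  have D: "D \<in> sobolev \<Omega> 1" unfolding D_def using v by (intro weak_div_sobolev[OF \<Omega>]) auto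
  have g2_eq: "g2 = (\<lambda>x. g1 x + \<nu> * D x)" by (simp add: g2_def D_def add.commute)
  have g2: "g2 \<in> sobolev \<Omega> 1" unfolding g2_eq by (rule sobolev_1_add(1)[OF \<Omega> P(3) D])
  have H: "H1 \<in> sobolev \<Omega> 1" "H2 \<in> sobolev \<Omega> 1"
    unfolding H1_def H2_def by (rule sobolev_1_add(1)[OF \<Omega> P(1) P(3)], rule sobolev_1_add(1)[OF \<Omega> P(2) g2])
  have GL: "G1 \<in> L2 \<Omega>" "G2 \<in> L2 \<Omega>" unfolding G1_def G2_def by (rule weak_grad_L2[OF \<Omega> H(1)], rule weak_grad_L2[OF \<Omega> H(2)])
  have vL: "v \<in> L2 \<Omega>" using vec_sobolev_L2(1)[OF \<Omega>] v by blast
  have v0: "v \<in> vec_H10 \<Omega>" using v by blast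
  have DL: "D \<in> L2 \<Omega>" "g1 \<in> L2 \<Omega>" using sobolev_1(1)[OF \<Omega>] D P(3) by blast+
  define s where "s = 2 * dt / 3"
  \<comment> \<open>the projection step, solved for the intermediate velocity\<close>
  define W where "W = (\<lambda>x. G2 x + (-1) *\<^sub>R G1 x)"
  have W: "W \<in> L2 \<Omega>" unfolding W_def by (rule L2_add_scaleR[OF GL(2,1)])
  have vV: "AE x in lebesgue_on \<Omega>. v x = a x + s *\<^sub>R W x"
  proof -
    have e: "(\<lambda>y. P2 y - P1 y + \<nu> * weak_div \<Omega> v y) = (\<lambda>y. H2 y + (-1) * H1 y)"
      by (rule ext) (simp add: H1_def H2_def g2_def)
    have "AE x in lebesgue_on \<Omega>. (3 *\<^sub>R a x - 3 *\<^sub>R v x) /\<^sub>R (2 * dt) + W x = 0"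
      using proj[unfolded e] weak_grad_add[OF \<Omega> H(2,1), of "-1"] by eventually_elim (simp add: W_def G1_def G2_def)
    then show ?thesis
    proof eventually_elim
      case (elim x)
      then have h1: "s *\<^sub>R ((3 *\<^sub>R a x - 3 *\<^sub>R v x) /\<^sub>R (2 * dt)) + s *\<^sub>R W x = 0"
        by (simp only: scaleR_add_right[symmetric] scaleR_zero_right)
      have h2: "s *\<^sub>R ((3 *\<^sub>R a x - 3 *\<^sub>R v x) /\<^sub>R (2 * dt)) = a x - v x"
        using pos by (simp add: s_def scaleR_diff_right)
      have "a x + s *\<^sub>R W x - v x = 0" using h1[unfolded h2] by (simp only: diff_add_eq)
      then show ?case by simp
    qed
  qed
  have V: "(\<lambda>x. a x + s *\<^sub>R W x) \<in> L2 \<Omega>" by (rule L2_add_scaleR[OF L(1) W])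
  have o: "?I a G1 = 0" "?I a G2 = 0" "?I b G1 = 0" "?I b G2 = 0" "?I c G1 = 0" "?I c G2 = 0"
    unfolding G1_def G2_def by (rule orth H)+
  have hW: "?I h W = ?I h G2 - ?I h G1" if "h \<in> L2 \<Omega>" for h
    unfolding W_def L2_inner_add_scaleR_right[OF GL(2,1) that] by simp
  have hv: "?I h v = ?I h a + s * ?I h W" if "h \<in> L2 \<Omega>" for h
  proof -
    have "?I h v = ?I h (\<lambda>x. a x + s *\<^sub>R W x)" by (rule L2_inner_cong_AE[OF \<Omega> _ vV]) simp
    then show ?thesis by (simp only: L2_inner_add_scaleR_right[OF L(1) W that])
  qed
  have WW: "?I W W = ?I G2 G2 - 2 * ?I G1 G2 + ?I G1 G1"
    using L2_inner_self_add_scaleR[OF GL(2,1), of "-1"] by (simp add: W_def L2_inner_commute[of _ G2 G1])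
  have bv: "?I b v = ?I a b" and cv: "?I c v = ?I a c"
    using hv[OF L(2)] hv[OF L(3)] hW[OF L(2)] hW[OF L(3)] o by (simp_all add: L2_inner_commute[of _ a])
  have vv: "?I v v = ?I a a + s\<^sup>2 * ?I W W"
  proof -
    have "?I v v = ?I (\<lambda>x. a x + s *\<^sub>R W x) (\<lambda>x. a x + s *\<^sub>R W x)"
      by (rule L2_inner_cong_AE[OF \<Omega> vV vV])
    also have "\<dots> = ?I a a + 2 * s * ?I a W + s\<^sup>2 * ?I W W" by (rule L2_inner_self_add_scaleR[OF L(1) W])
    finally show ?thesis using hW[OF L(1)] o by simp
  qed
  have G1v: "?I G1 v = s * (?I G1 G2 - ?I G1 G1)"
    using hv[OF GL(1)] hW[OF GL(1)] o by (simp add: L2_inner_commute[of _ G1 a])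
  define J where "J = ?I (weak_jacobian \<Omega> v) (weak_jacobian \<Omega> v)"
  note lap = L2_inner_weak_laplacian[OF \<Omega> v]
  have gv: "?I (weak_grad \<Omega> P1) v = ?I G1 v + ?I g1 D"
  proof -
    have e: "AE x in lebesgue_on \<Omega>. G1 x = weak_grad \<Omega> P1 x + 1 *\<^sub>R weak_grad \<Omega> g1 x"
      unfolding G1_def H1_def by (rule weak_grad_add[OF \<Omega> P(1,3)])
    have "?I G1 v = ?I (\<lambda>x. weak_grad \<Omega> P1 x + 1 *\<^sub>R weak_grad \<Omega> g1 x) v"
      by (rule L2_inner_cong_AE[OF \<Omega> e]) simp
    also have "\<dots> = ?I (weak_grad \<Omega> P1) v + ?I (weak_grad \<Omega> g1) v"
      using L2_inner_add_scaleR[OF weak_grad_L2[OF \<Omega> P(1)] weak_grad_L2[OF \<Omega> P(3)] vL, of 1] by simp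
    also have "?I (weak_grad \<Omega> g1) v = - ?I g1 D" unfolding D_def by (rule L2_inner_weak_grad_H10[OF \<Omega> v0 P(3)])
    finally show ?thesis by simp
  qed
  \<comment> \<open>the momentum equation tested with the intermediate velocity\<close>
  have momv: "(q2 / E) * ?I conv v = - (1 / (2 * dt)) * (3 * ?I v v - 4 * ?I b v + ?I c v) - \<nu> * J - ?I (weak_grad \<Omega> P1) v"
  proof -
    define R1 where "R1 = (\<lambda>x. v x + (- 4 / 3) *\<^sub>R b x)"
    define R2 where "R2 = (\<lambda>x. R1 x + (1 / 3) *\<^sub>R c x)"
    define R3 where "R3 = (\<lambda>x. weak_grad \<Omega> P1 x + (3 / (2 * dt)) *\<^sub>R R2 x)"
    define R4 where "R4 = (\<lambda>x. R3 x + (- \<nu>) *\<^sub>R weak_laplacian \<Omega> v x)"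
    have R1: "R1 \<in> L2 \<Omega>" unfolding R1_def by (rule L2_add_scaleR[OF vL L(2)])
    have R2: "R2 \<in> L2 \<Omega>" unfolding R2_def by (rule L2_add_scaleR[OF R1 L(3)])
    have R3: "R3 \<in> L2 \<Omega>" unfolding R3_def by (rule L2_add_scaleR[OF weak_grad_L2[OF \<Omega> P(1)] R2])
    have e: "AE x in lebesgue_on \<Omega>. (q2 / E) *\<^sub>R conv x = - R4 x"
      using mom
    proof eventually_elim
      case (elim x)
      define Z K Y X where "Z = (3 *\<^sub>R v x - 4 *\<^sub>R b x + c x) /\<^sub>R (2 * dt)"
        and "K = (q2 / E) *\<^sub>R conv x" and "Y = \<nu> *\<^sub>R weak_laplacian \<Omega> v x" and "X = weak_grad \<Omega> P1 x"
      have h: "3 *\<^sub>R v x - 4 *\<^sub>R b x + c x = 3 *\<^sub>R R2 x"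
        by (simp add: R2_def R1_def scaleR_add_right scaleR_diff_right)
      have Z: "Z = (3 / (2 * dt)) *\<^sub>R R2 x" 
        unfolding Z_def h scaleR_scaleR by (simp only: divide_inverse mult.commute)
      have "Z + K - Y + X = 0" using elim by (simp only: Z_def K_def Y_def X_def)
      then have "K = - (X + Z + - Y)" by (simp add: eq_neg_iff_add_eq_0 algebra_simps)
      then show ?case unfolding R4_def R3_def Z K_def X_def Y_def by simp
    qed
    have "(q2 / E) * ?I conv v = ?I (\<lambda>x. (q2 / E) *\<^sub>R conv x) v" by (simp add: L2_inner_def)
    also have "\<dots> = ?I (\<lambda>x. - R4 x) v" by (rule L2_inner_cong_AE[OF \<Omega> e]) simp
    also have "\<dots> = - ?I R4 v" by (simp add: L2_inner_def)
    also have "?I R4 v = ?I R3 v + (- \<nu>) * ?I (weak_laplacian \<Omega> v) v" unfolding R4_def by (rule L2_inner_add_scaleR[OF R3 lap(1) vL])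
    also have "?I R3 v = ?I (weak_grad \<Omega> P1) v + (3 / (2 * dt)) * ?I R2 v" unfolding R3_def by (rule L2_inner_add_scaleR[OF weak_grad_L2[OF \<Omega> P(1)] R2 vL])
    also have "?I R2 v = ?I R1 v + (1 / 3) * ?I c v" unfolding R2_def by (rule L2_inner_add_scaleR[OF R1 L(3) vL])
    also have "?I R1 v = ?I v v + (- 4 / 3) * ?I b v" unfolding R1_def by (rule L2_inner_add_scaleR[OF vL L(2) vL])
    finally have fin: "(q2 / E) * ?I conv v = - (?I (weak_grad \<Omega> P1) v
        + (3 / (2 * dt)) * (?I v v + (- 4 / 3) * ?I b v + (1 / 3) * ?I c v) + (- \<nu>) * ?I (weak_laplacian \<Omega> v) v)" .
    show ?thesis unfolding fin using pos by (simp add: lap(2) J_def field_simps)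
  qed
  have "4 * dt * ((q2 / E) * ?I conv v) = - 2 * (3 * ?I v v - 4 * ?I b v + ?I c v) - 4 * dt * \<nu> * J - 4 * dt * (?I G1 v + ?I g1 D)"
    unfolding momv gv using pos by (simp add: field_simps)
  also have "\<dots> = - 2 * (3 * ?I a a - 4 * ?I a b + ?I a c) - 4 / 3 * (dt\<^sup>2 * ?I G2 G2) + 4 / 3 * (dt\<^sup>2 * ?I G1 G1)
      - 4 / 3 * (dt\<^sup>2 * ?I W W) - 4 * dt * \<nu> * J - 4 * dt * ?I g1 D"
    unfolding vv bv cv G1v WW s_def by (simp add: field_simps power2_eq_square)
  finally have mom': "4 * dt * ((q2 / E) * ?I conv v) = \<dots>" .
  have q: "2 * q2 * (3 * q2 - 4 * q1 + q0) = - (4 * dt / T) * q2\<^sup>2 + 4 * dt * ((q2 / E) * ?I conv v)"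
  proof -
    have "2 * q2 * (3 * q2 - 4 * q1 + q0) = 4 * dt * q2 * ((3 * q2 - 4 * q1 + q0) / (2 * dt))"
      using pos by simp
    also have "\<dots> = 4 * dt * q2 * (- (1 / T) * q2 + 1 / E * ?I conv v)" by (simp only: qeq)
    also have "\<dots> = - (4 * dt / T) * q2\<^sup>2 + 4 * dt * ((q2 / E) * ?I conv v)"
      by (simp add: algebra_simps power2_eq_square)
    finally show ?thesis .
  qed
  have q': "\<bar>q2\<bar>\<^sup>2 + \<bar>2 * q2 - q1\<bar>\<^sup>2 - (\<bar>q1\<bar>\<^sup>2 + \<bar>2 * q1 - q0\<bar>\<^sup>2) + (q2 - 2 * q1 + q0)\<^sup>2 = 2 * q2 * (3 * q2 - 4 * q1 + q0)"
    by (simp add: algebra_simps power2_eq_square)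
  have qT: "(4 * dt / T) * q2\<^sup>2 \<ge> 0" using pos by simp
  have ab: "(L2_norm \<Omega> (\<lambda>x. 2 *\<^sub>R f x - h x))\<^sup>2 = 4 * ?I f f - 4 * ?I f h + ?I h h" if "f \<in> L2 \<Omega>" "h \<in> L2 \<Omega>" for f h :: "real^2 \<Rightarrow> real^2"
  proof -
    have "?I (\<lambda>x. 2 *\<^sub>R f x - h x) (\<lambda>x. 2 *\<^sub>R f x - h x) = ?I (\<lambda>x. h x + (-2) *\<^sub>R f x) (\<lambda>x. h x + (-2) *\<^sub>R f x)"
      unfolding L2_inner_def by (rule Bochner_Integration.integral_cong) (simp_all add: inner_diff_left inner_diff_right inner_commute algebra_simps)
    then show ?thesis using L2_inner_self_add_scaleR[OF that(2,1), of "-2"] by (simp add: L2_norm_power2 L2_inner_commute[of _ h f])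
  qed
  have sq: "0 \<le> ?I a a + 4 * ?I b b + ?I c c - 4 * ?I a b + 2 * ?I a c - 4 * ?I b c"
  proof -
    \<comment> \<open>the second difference \<open>a - 2b + c\<close> has nonnegative square\<close>
    define d where "d = (\<lambda>x. a x + (-2) *\<^sub>R b x)"
    have d: "d \<in> L2 \<Omega>" unfolding d_def by (rule L2_add_scaleR[OF L(1,2)])
    have "0 \<le> ?I (\<lambda>x. d x + 1 *\<^sub>R c x) (\<lambda>x. d x + 1 *\<^sub>R c x)" by (rule L2_inner_self_nonneg)
    also have "\<dots> = ?I d d + 2 * ?I d c + ?I c c" using L2_inner_self_add_scaleR[OF d L(3), of 1] by simp
    also have "?I d d = ?I a a - 4 * ?I a b + 4 * ?I b b" unfolding d_def using L2_inner_self_add_scaleR[OF L(1,2), of "-2"] by simp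
    also have "?I d c = ?I a c - 2 * ?I b c" unfolding d_def using L2_inner_add_scaleR[OF L(1,2,3), of "-2"] by simp
    finally show ?thesis by simp
  qed
  have g22: "2 * inverse \<nu> * dt * ?I g2 g2 = 2 * inverse \<nu> * dt * ?I g1 g1 + 4 * dt * ?I g1 D + 2 * dt * \<nu> * ?I D D"
  proof -
    have "?I g2 g2 = ?I g1 g1 + 2 * \<nu> * ?I g1 D + \<nu>\<^sup>2 * ?I D D"
      using L2_inner_self_add_scaleR[OF DL(2,1), of \<nu>] by (simp add: g2_eq)
    then show ?thesis using pos by (simp add: field_simps power2_eq_square)
  qed
  have DJ: "2 * dt * \<nu> * ?I D D \<le> 2 * dt * \<nu> * J"
    using L2_inner_weak_div_le_jacobian[OF \<Omega> v0] pos by (simp add: D_def J_def)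
  have WW0: "0 \<le> dt\<^sup>2 * ?I W W" by (intro mult_nonneg_nonneg L2_inner_self_nonneg) simp
  have e1: "(\<lambda>x. P1 x + g1 x) = H1" "(\<lambda>x. P2 x + g2 x) = H2" by (simp_all add: H1_def H2_def)
  have 1: "4 * (dt * ((q2 / E) * ?I conv v)) = - 2 * (3 * ?I a a - 4 * ?I a b + ?I a c) - 4 / 3 * (dt\<^sup>2 * ?I G2 G2)
      + 4 / 3 * (dt\<^sup>2 * ?I G1 G1) - 4 / 3 * (dt\<^sup>2 * ?I W W) - 4 * (\<nu> * dt * J) - 4 * (dt * ?I g1 D)"
    using mom' by (simp only: mult.assoc mult.left_commute[of dt \<nu>])
  have 2: "2 * q2 * (3 * q2 - 4 * q1 + q0) \<le> 4 * (dt * ((q2 / E) * ?I conv v))"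
    using q qT by (simp only: mult.assoc)
  have qd: "q2\<^sup>2 + (2 * q2 - q1)\<^sup>2 \<le> q1\<^sup>2 + (2 * q1 - q0)\<^sup>2 + 4 * (dt * ((q2 / E) * ?I conv v))"
  proof -
    have "X \<le> Y + K" if "X - Y + Z = W" "W \<le> K" "0 \<le> Z" for X Y Z W K :: real using that by linarith
    from this[OF q'[unfolded power2_abs] 2 zero_le_power2] show ?thesis .
  qed
  have 3: "2 * inverse \<nu> * dt * ?I g2 g2 \<le> 2 * inverse \<nu> * dt * ?I g1 g1 + 4 * (dt * ?I g1 D) + 2 * (\<nu> * dt * J)"
    using g22 DJ by (simp only: mult.assoc mult.left_commute[of dt \<nu>])
  have 4: "- 2 * \<nu> * dt * J = - 2 * (\<nu> * dt * J)" by simp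
  have 5: "4 / 3 * dt\<^sup>2 * ?I G2 G2 = 4 / 3 * (dt\<^sup>2 * ?I G2 G2)" "4 / 3 * dt\<^sup>2 * ?I G1 G1 = 4 / 3 * (dt\<^sup>2 * ?I G1 G1)"
    by simp_all
  show ?thesis
    unfolding e1 ab[OF L(1,2)] ab[OF L(2,3)]
    unfolding L2_norm_power2 G1_def[symmetric] G2_def[symmetric] J_def[symmetric] 4 5 power2_abs
    using 1 qd 3 sq WW0 by argo
qed

theorem theorem4p2:
  fixes \<Omega> :: "(real^2) set"
    and \<nu> T dt :: real
    and N :: nat
    and ut u :: "nat \<Rightarrow> real^2 \<Rightarrow> real^2"
    and p :: "nat \<Rightarrow> real^2 \<Rightarrow> real"
    and q :: "nat \<Rightarrow> real"
  assumes "open \<Omega>" "connected \<Omega>" "\<Omega> \<noteq> {}" "bounded \<Omega>" "Ck_boundary 2 \<Omega>"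
    and "\<nu> > 0" "T > 0" "N \<ge> 2" "dt = T / real N"
    and "u 0 \<in> vec_sobolev \<Omega> 2 \<inter> vec_H10 \<Omega>"
    and "AE x in lebesgue_on \<Omega>. weak_div \<Omega> (u 0) x = 0"
    and "p 0 \<in> sobolev \<Omega> 1"
    and "\<And>n. 1 \<le> n \<Longrightarrow> n \<le> N \<Longrightarrow> ut n \<in> vec_sobolev \<Omega> 2 \<inter> vec_H10 \<Omega>"
    and "\<And>n. 1 \<le> n \<Longrightarrow> n \<le> N \<Longrightarrow> u n \<in> vec_sobolev \<Omega> 2"
    and "\<And>n. 1 \<le> n \<Longrightarrow> n \<le> N \<Longrightarrow> p n \<in> sobolev \<Omega> 1"
    and "first_order_step \<Omega> \<nu> T dt ut u p q"
    and "\<And>n. 1 \<le> n \<Longrightarrow> n \<le> N - 1 \<Longrightarrow> rotational_step \<Omega> \<nu> T dt ut u p q n"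
  shows "\<forall>n. 1 \<le> n \<and> n \<le> N - 1 \<longrightarrow>
           sav_energy \<Omega> \<nu> dt ut u p q (n+1) - sav_energy \<Omega> \<nu> dt ut u p q n
             \<le> - 2 * \<nu> * dt * (L2_norm \<Omega> (weak_jacobian \<Omega> (ut (n+1))))\<^sup>2"
proof (intro allI impI)
  fix n assume n: "1 \<le> n \<and> n \<le> N - 1"
  note \<Omega> = assms(1,4)
  have dt: "dt > 0" using assms(7-9) by simp
  have bd: "Ck_boundary (Suc 1) \<Omega>" using assms(5) by (simp add: numeral_2_eq_2)
  have uL: "u k \<in> vec_sobolev \<Omega> 2" if "k \<le> N" for k
    using assms(10,14) that by (cases k) auto
  have solenoidal: "(AE x in lebesgue_on \<Omega>. weak_div \<Omega> (u k) x = 0) \<and> zero_normal_trace \<Omega> (u k)"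
    if "1 \<le> k" "k \<le> N" for k
  proof (cases "k = 1")
    case True
    then show ?thesis using assms(16) by (simp add: first_order_step_def)
  next
    case False
    then have "rotational_step \<Omega> \<nu> T dt ut u p q (k - 1)" using that by (intro assms(17)) auto
    moreover have "k - 1 + 1 = k" using that by simp
    ultimately show ?thesis unfolding rotational_step_def by (simp only:)
  qed
  \<comment> \<open>at level 0 the field vanishes on the boundary; at later levels only its normal component does\<close>
  have orth: "L2_inner \<Omega> (u k) (weak_grad \<Omega> H) = 0" if "k \<le> N" "H \<in> sobolev \<Omega> 1" for k H
  proof (cases "k = 0")
    case True
    have "L2_inner \<Omega> H (weak_div \<Omega> (u 0)) = L2_inner \<Omega> H (\<lambda>x. 0)"
      by (rule L2_inner_cong_AE[OF \<Omega>(1) _ assms(11)]) simp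
    then show ?thesis
      using L2_inner_weak_grad_H10[OF \<Omega>(1) _ that(2), of "u 0"] assms(10) True
      by (simp add: L2_inner_commute[of _ "u 0"]) (simp add: L2_inner_def)
  next
    case False
    then show ?thesis
      using normal_trace_orthogonal[OF \<Omega> bd that(2) vec_sobolev_L2(2)[OF \<Omega>(1) uL[OF that(1)]]] solenoidal[of k] that by simp
  qed
  have g: "div_sum \<Omega> \<nu> ut k \<in> sobolev \<Omega> 1" if "k \<le> N" for k
    using that
  proof (induction k)
    case 0
    have "test_function \<Omega> (\<lambda>x. 0)" by (simp add: test_function_def Ck_on_const)
    then show ?case using test_function_sobolev(1)[OF \<Omega>(1)] by simp
  next
    case (Suc k)
    have "weak_div \<Omega> (ut (Suc k)) \<in> sobolev \<Omega> 1" using assms(13)[of "Suc k"] Suc.prems by (intro weak_div_sobolev[OF \<Omega>(1)]) auto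
    from sobolev_1_add(1)[OF \<Omega>(1) Suc.IH this, of \<nu>] Suc.prems show ?case by (simp add: add.commute)
  qed
  have step: "rotational_step \<Omega> \<nu> T dt ut u p q n" using assms(17) n by blast
  have nN: "n + 1 \<le> N" "n \<le> N" "n - 1 \<le> N" using n assms(8) by auto
  have "sav_energy \<Omega> \<nu> dt ut u p q (n+1) - sav_energy \<Omega> \<nu> dt ut u p q n
    = ((L2_norm \<Omega> (u (n+1)))\<^sup>2 + (L2_norm \<Omega> (\<lambda>x. 2 *\<^sub>R u (n+1) x - u n x))\<^sup>2
      + 4 / 3 * dt\<^sup>2 * (L2_norm \<Omega> (weak_grad \<Omega> (\<lambda>x. p (n+1) x + (\<nu> * weak_div \<Omega> (ut (n+1)) x + div_sum \<Omega> \<nu> ut n x))))\<^sup>2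
      + 2 * inverse \<nu> * dt * (L2_norm \<Omega> (\<lambda>x. \<nu> * weak_div \<Omega> (ut (n+1)) x + div_sum \<Omega> \<nu> ut n x))\<^sup>2 + \<bar>q (n+1)\<bar>\<^sup>2 + \<bar>2 * q (n+1) - q n\<bar>\<^sup>2)
    - ((L2_norm \<Omega> (u n))\<^sup>2 + (L2_norm \<Omega> (\<lambda>x. 2 *\<^sub>R u n x - u (n-1) x))\<^sup>2
      + 4 / 3 * dt\<^sup>2 * (L2_norm \<Omega> (weak_grad \<Omega> (\<lambda>x. p n x + div_sum \<Omega> \<nu> ut n x)))\<^sup>2
      + 2 * inverse \<nu> * dt * (L2_norm \<Omega> (div_sum \<Omega> \<nu> ut n))\<^sup>2 + \<bar>q n\<bar>\<^sup>2 + \<bar>2 * q n - q (n-1)\<bar>\<^sup>2)"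
    by (simp add: sav_energy_def)
  also have "\<dots> \<le> - 2 * \<nu> * dt * (L2_norm \<Omega> (weak_jacobian \<Omega> (ut (n+1))))\<^sup>2"
  proof (rule rotational_step_energy[OF \<Omega>(1) assms(6,7) dt, where E="exp (- (real (n+1) * dt) / T)"
        and conv="convection \<Omega> (extrapolation u n) (extrapolation u n)"])
    show "ut (n+1) \<in> vec_sobolev \<Omega> 2 \<inter> vec_H10 \<Omega>" using nN by (intro assms(13)) auto
    show "u (n+1) \<in> L2 \<Omega>" "u n \<in> L2 \<Omega>" "u (n-1) \<in> L2 \<Omega>"
      using vec_sobolev_L2(1)[OF \<Omega>(1) uL] nN by blast+
    show "p n \<in> sobolev \<Omega> 1" "p (n+1) \<in> sobolev \<Omega> 1" using n nN by (intro assms(15); simp)+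
    show "div_sum \<Omega> \<nu> ut n \<in> sobolev \<Omega> 1" by (rule g[OF nN(2)])
  qed (use step orth nN in \<open>simp_all add: rotational_step_def\<close>)
  finally show "sav_energy \<Omega> \<nu> dt ut u p q (n+1) - sav_energy \<Omega> \<nu> dt ut u p q n
             \<le> - 2 * \<nu> * dt * (L2_norm \<Omega> (weak_jacobian \<Omega> (ut (n+1))))\<^sup>2" .
qed

end
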